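(* Let $A$ be a partial combinatory algebra and let $f:A\to A$ be a partial function with domain $B\subseteq A$. Let $(B,\{\cdot\})$ be the $A$-assembly assigning $\{b\}$ to $b\in B$, and let $(B,E)$ be the $A$-assembly with $E(b)=\{\pi b f(b)\}$. Consider the least local operator on $\mathsf{RT}(A)$ which inverts the monomorphism $(B,E)\to(B,\{\cdot\})$ given by the identity function on $B$ ("forcing $f$ to be realizable"). Then the category of sheaves for this local operator is $\mathsf{RT}(A[f])$.
   Context: Partial combinatory algebras. A pca is a set $A$ with a partial binary application $(a,b)\mapsto ab$ (associating to the left) for which there exist $\mathsf{k},\mathsf{s}\in A$ such that for all $a,b,c\in A$: $\mathsf{k}ab=a$; $\mathsf{s}ab$ is defined; and whenever $ac(bc)$ is defined, $\mathsf{s}abc$ is defined and equal to it. $t{\downarrow}$ means "$t$ is defined". Booleans: $\mathsf{T}=\mathsf{k}$, $\mathsf{F}=\mathsf{k}(\mathsf{skk})$. Every pca has pairing and unpairing elements $\pi,\pi_0,\pi_1$ with $\pi_0(\pi ab)=a$, $\pi_1(\pi ab)=b$. Toposes. $\mathrm{Ass}(A)$ has as objects ($A$-assemblies) pairs $(X,E)$ with $X$ a set and $E(x)\subseteq A$ nonempty for each $x\in X$; a morphism $(X,E)\to(Y,F)$ is a function $g:X\to Y$ for which some $a\in A$ satisfies $ab{\downarrow}$ and $ab\in F(g(x))$ for all $x\in X$, $b\in E(x)$. The realizability topos $\mathsf{RT}(A)$ is the ex/reg completion of $\mathrm{Ass}(A)$. Local operators. A local operator is a Lawvere–Tierney topology;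 it inverts a monomorphism $m$ if the sheafification of $m$ is an isomorphism. For any mono in a topos there is a least local operator inverting it. In $\mathsf{RT}(A)$, every local operator is represented by a function $J:\mathcal{P}(A)\to\mathcal{P}(A)$ for which $\bigcap_{U}U\Rightarrow J(U)$, $\bigcap_U JJ(U)\Rightarrow J(U)$ and $\bigcap_{U,V}(U\Rightarrow V)\Rightarrow(J(U)\Rightarrow J(V))$ are nonempty, where $U\Rightarrow V=\{a\in A\mid \forall x\in U\ (ax{\downarrow}\text{ and }ax\in V)\}$. The order is $J\leq K$ iff $\bigcap_U J(U)\Rightarrow K(U)$ is nonempty. The pca $A[f]$. An applicative morphism $\gamma:A\to C$ of pcas assigns to each $a\in A$ a nonempty subset $\gamma(a)\subseteq C$ such that there is $r\in C$ with: whenever $aa'{\downarrow}$, $b\in\gamma(a)$, $b'\in\gamma(a')$, then $rbb'{\downarrow}$ and $rbb'\in\gamma(aa')$. Composition is composition of relations. It is decidable if there is $d\in C$ with $db=\mathsf{T}_C$ for all $b\in\gamma(\mathsf{T}_A)$ and $db=\mathsf{F}_C$ for all $b\in\gamma(\mathsf{F}_A)$. A partial function $f:A\to A$ is representable w.r.t. $\gamma$ if there is $b\in C$ such that for each $a\in\mathrm{dom}(f)$ and $c\in\gamma(a)$, $bc{\downarrow}$ and $bc\in\gamma(f(a))$. It is known that there is a pca $A[f]$ and a decidable applicative morphism $\iota_f:A\to A[f]$ w.r.t. which $f$ is representable, universal with this property: every decidable $\gamma:A\to C$ w.r.t. which $f$ is representable factors uniquely through $\iota_f$. This determines $A[f]$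 up to isomorphism. Concretely, $A[f]$ has underlying set $A$, $\iota_f$ is the identity function ($a\mapsto\{a\}$), and application is: $a\cdot^f b=c$ iff either $a[b]=\pi\mathsf{T}c$, or there is a sequence $a_1,\ldots,a_n$ such that $a[b]=\pi\mathsf{F}d$ for some $d$ with $f(d)=a_1$, for all $1<k\leq n$, $a[b,a_1,\ldots,a_{k-1}]=\pi\mathsf{F}d$ for some $d$ with $f(d)=a_k$, and $a[b,a_1,\ldots,a_n]=\pi\mathsf{T}c$; here $[\ldots]$ is a standard coding of tuples in $A$. The topos $\mathsf{RT}(A[f])$ is regarded as a subtopos of $\mathsf{RT}(A)$ via the geometric inclusion whose inverse image is induced by $\iota_f$, i.e. extends the functor $\mathrm{Ass}(A)\to\mathrm{Ass}(A[f])$, $(X,E)\mapsto(X,E)$. *)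

theory Defs
  imports "HOL-Library.Nat_Bijection"
begin

section \<open>Partial combinatory algebras\<close>

text \<open>The underlying set of a pca is a whole type \<open>'a\<close>; \<open>A a b = None\<close> means that
  \<open>ab\<close> is undefined.\<close>

type_synonym 'a papp = "'a \<Rightarrow> 'a \<Rightarrow> 'a option"

definition ap2 :: "'a papp \<Rightarrow> 'a \<Rightarrow> 'a \<Rightarrow> 'a \<Rightarrow> 'a option" where
  "ap2 A a b c = Option.bind (A a b) (\<lambda>d. A d c)"

definition ap3 :: "'a papp \<Rightarrow> 'a \<Rightarrow> 'a \<Rightarrow> 'a \<Rightarrow> 'a \<Rightarrow> 'a option" where
  "ap3 A a b c d = Option.bind (ap2 A a b c) (\<lambda>e. A e d)"

definition pca :: "'a papp \<Rightarrow> 'a \<Rightarrow> 'a \<Rightarrow> bool" where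
  "pca A k s \<longleftrightarrow>
     (\<forall>a b. ap2 A k a b = Some a) \<and>
     (\<forall>a b. ap2 A s a b \<noteq> None) \<and>
     (\<forall>a b c x y z. A a c = Some x \<longrightarrow> A b c = Some y \<longrightarrow> A x y = Some z \<longrightarrow>
        ap3 A s a b c = Some z)"

definition pairing :: "'a papp \<Rightarrow> 'a \<Rightarrow> 'a \<Rightarrow> 'a \<Rightarrow> bool" where
  "pairing A p p0 p1 \<longleftrightarrow>
     (\<forall>a b. \<exists>c. ap2 A p a b = Some c \<and> A p0 c = Some a \<and> A p1 c = Some b)"

definition fls :: "'a papp \<Rightarrow> 'a \<Rightarrow> 'a \<Rightarrow> 'a" where
  "fls A k s = the (A k (the (ap2 A s k k)))"

definition pr :: "'a papp \<Rightarrow> 'a \<Rightarrow> 'a \<Rightarrow> 'a \<Rightarrow> 'a" where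
  "pr A p a b = the (ap2 A p a b)"

text \<open>Coding of tuples: \<open>[] = \<pi>TT\<close> and \<open>[a\<^sub>1,\<dots>,a\<^sub>n] = \<pi>F(\<pi>a\<^sub>1[a\<^sub>2,\<dots>,a\<^sub>n])\<close>; the boolean tag
  tells the empty tuple from the others.\<close>

fun tup :: "'a papp \<Rightarrow> 'a \<Rightarrow> 'a \<Rightarrow> 'a \<Rightarrow> 'a list \<Rightarrow> 'a" where
  "tup A k s p [] = pr A p k k"
| "tup A k s p (a # as) = pr A p (fls A k s) (pr A p a (tup A k s p as))"


section \<open>The pca \<open>A[f]\<close>\<close>

text \<open>\<open>as\<close> is the sequence \<open>a\<^sub>1,\<dots>,a\<^sub>n\<close> of oracle answers; the empty sequence is the case in which
  \<open>a[b] = \<pi>Tc\<close> outright. At most one \<open>c\<close> satisfies \<open>computes A k s p f a b c\<close>.\<close>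

definition computes ::
  "'a papp \<Rightarrow> 'a \<Rightarrow> 'a \<Rightarrow> 'a \<Rightarrow> ('a \<Rightarrow> 'a option) \<Rightarrow> 'a \<Rightarrow> 'a \<Rightarrow> 'a \<Rightarrow> bool" where
  "computes A k s p f a b c \<longleftrightarrow>
     (\<exists>as. (\<forall>i<length as. \<exists>d.
              A a (tup A k s p (b # take i as)) = Some (pr A p (fls A k s) d) \<and>
              f d = Some (as ! i)) \<and>
           A a (tup A k s p (b # as)) = Some (pr A p k c))"

definition adjoin :: "'a papp \<Rightarrow> 'a \<Rightarrow> 'a \<Rightarrow> 'a \<Rightarrow> ('a \<Rightarrow> 'a option) \<Rightarrow> 'a papp" where
  "adjoin A k s p f a b =
     (if \<exists>c. computes A k s p f a b c then Some (THE c. computes A k s p f a b c) else None)"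


section \<open>Realizability\<close>

definition imp :: "'a papp \<Rightarrow> 'a set \<Rightarrow> 'a set \<Rightarrow> 'a set" where
  "imp A V W = {a. \<forall>x\<in>V. \<exists>y\<in>W. A a x = Some y}"

definition meet :: "'a papp \<Rightarrow> 'a set \<Rightarrow> 'a set \<Rightarrow> 'a set" where
  "meet A V W =
     {c. \<exists>v\<in>V. \<exists>w\<in>W. ap2 A (SOME p. \<exists>p0 p1. pairing A p p0 p1) v w = Some c}"

definition entails :: "'a papp \<Rightarrow> 'i set \<Rightarrow> ('i \<Rightarrow> 'a set) \<Rightarrow> ('i \<Rightarrow> 'a set) \<Rightarrow> bool" where
  "entails A I \<phi> \<psi> \<longleftrightarrow> (\<Inter>i\<in>I. imp A (\<phi> i) (\<psi> i)) \<noteq> {}"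


section \<open>Categories\<close>

record ('o, 'm) cat =
  Ob :: "'o set"
  Hom :: "'o \<Rightarrow> 'o \<Rightarrow> 'm set"
  Id :: "'o \<Rightarrow> 'm"
  Comp :: "'m \<Rightarrow> 'm \<Rightarrow> 'm"  \<comment> \<open>\<open>Comp C g f\<close> is \<open>g\<close> after \<open>f\<close>\<close>

record ('o, 'm, 'p, 'n) fnctr =
  omap :: "'o \<Rightarrow> 'p"
  amap :: "'m \<Rightarrow> 'n"

definition mono_arr :: "('o, 'm) cat \<Rightarrow> 'o \<Rightarrow> 'o \<Rightarrow> 'm \<Rightarrow> bool" where
  "mono_arr C X Y m \<longleftrightarrow> m \<in> Hom C X Y \<and>
     (\<forall>W\<in>Ob C. \<forall>g\<in>Hom C W X. \<forall>h\<in>Hom C W X. Comp C m g = Comp C m h \<longrightarrow> g = h)"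

definition iso_arr :: "('o, 'm) cat \<Rightarrow> 'o \<Rightarrow> 'o \<Rightarrow> 'm \<Rightarrow> bool" where
  "iso_arr C X Y f \<longleftrightarrow> f \<in> Hom C X Y \<and>
     (\<exists>g\<in>Hom C Y X. Comp C g f = Id C X \<and> Comp C f g = Id C Y)"

definition terminal :: "('o, 'm) cat \<Rightarrow> 'o \<Rightarrow> bool" where
  "terminal C T \<longleftrightarrow> T \<in> Ob C \<and> (\<forall>X\<in>Ob C. \<exists>!f. f \<in> Hom C X T)"

definition pullback ::
  "('o, 'm) cat \<Rightarrow> 'o \<Rightarrow> 'o \<Rightarrow> 'o \<Rightarrow> 'o \<Rightarrow> 'm \<Rightarrow> 'm \<Rightarrow> 'm \<Rightarrow> 'm \<Rightarrow> bool" where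
  "pullback C P X Y Z p q f g \<longleftrightarrow>
     P \<in> Ob C \<and> X \<in> Ob C \<and> Y \<in> Ob C \<and> Z \<in> Ob C \<and>
     p \<in> Hom C P X \<and> q \<in> Hom C P Y \<and> f \<in> Hom C X Z \<and> g \<in> Hom C Y Z \<and>
     Comp C f p = Comp C g q \<and>
     (\<forall>W\<in>Ob C. \<forall>u\<in>Hom C W X. \<forall>v\<in>Hom C W Y. Comp C f u = Comp C g v \<longrightarrow>
        (\<exists>!h. h \<in> Hom C W P \<and> Comp C p h = u \<and> Comp C q h = v))"

definition full_sub :: "('o, 'm) cat \<Rightarrow> 'o set \<Rightarrow> ('o, 'm) cat" where
  "full_sub C S = C\<lparr>Ob := Ob C \<inter> S\<rparr>"

definition is_functor :: "('o, 'm) cat \<Rightarrow> ('p, 'n) cat \<Rightarrow> ('o, 'm, 'p, 'n) fnctr \<Rightarrow> bool" where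
  "is_functor C D F \<longleftrightarrow>
     (\<forall>X\<in>Ob C. omap F X \<in> Ob D \<and> amap F (Id C X) = Id D (omap F X)) \<and>
     (\<forall>X\<in>Ob C. \<forall>Y\<in>Ob C. \<forall>f\<in>Hom C X Y. amap F f \<in> Hom D (omap F X) (omap F Y)) \<and>
     (\<forall>X\<in>Ob C. \<forall>Y\<in>Ob C. \<forall>Z\<in>Ob C. \<forall>f\<in>Hom C X Y. \<forall>g\<in>Hom C Y Z.
        amap F (Comp C g f) = Comp D (amap F g) (amap F f))"

definition fully_faithful :: "('o, 'm) cat \<Rightarrow> ('p, 'n) cat \<Rightarrow> ('o, 'm, 'p, 'n) fnctr \<Rightarrow> bool" where
  "fully_faithful C D F \<longleftrightarrow>
     (\<forall>X\<in>Ob C. \<forall>Y\<in>Ob C. bij_betw (amap F) (Hom C X Y) (Hom D (omap F X) (omap F Y)))"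

definition equivalence :: "('o, 'm) cat \<Rightarrow> ('p, 'n) cat \<Rightarrow> ('o, 'm, 'p, 'n) fnctr \<Rightarrow> bool" where
  "equivalence C D F \<longleftrightarrow> is_functor C D F \<and> fully_faithful C D F \<and>
     (\<forall>Y\<in>Ob D. \<exists>X\<in>Ob C. \<exists>f. iso_arr D (omap F X) Y f)"

definition left_adjoint ::
  "('o, 'm) cat \<Rightarrow> ('p, 'n) cat \<Rightarrow> ('o, 'm, 'p, 'n) fnctr \<Rightarrow> ('p, 'n, 'o, 'm) fnctr \<Rightarrow> bool" where
  "left_adjoint C D F G \<longleftrightarrow> is_functor C D F \<and> is_functor D C G \<and>
     (\<exists>\<eta> \<epsilon>.
        (\<forall>X\<in>Ob C. \<eta> X \<in> Hom C X (omap G (omap F X))) \<and>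
        (\<forall>Y\<in>Ob D. \<epsilon> Y \<in> Hom D (omap F (omap G Y)) Y) \<and>
        (\<forall>X\<in>Ob C. \<forall>X'\<in>Ob C. \<forall>f\<in>Hom C X X'.
           Comp C (\<eta> X') f = Comp C (amap G (amap F f)) (\<eta> X)) \<and>
        (\<forall>Y\<in>Ob D. \<forall>Y'\<in>Ob D. \<forall>g\<in>Hom D Y Y'.
           Comp D g (\<epsilon> Y) = Comp D (\<epsilon> Y') (amap F (amap G g))) \<and>
        (\<forall>X\<in>Ob C. Comp D (\<epsilon> (omap F X)) (amap F (\<eta> X)) = Id D (omap F X)) \<and>
        (\<forall>Y\<in>Ob D. Comp C (amap G (\<epsilon> Y)) (\<eta> (omap G Y)) = Id C (omap G Y)))"

definition left_exact :: "('o, 'm) cat \<Rightarrow> ('p, 'n) cat \<Rightarrow> ('o, 'm, 'p, 'n) fnctr \<Rightarrow> bool" where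
  "left_exact C D F \<longleftrightarrow>
     (\<forall>T. terminal C T \<longrightarrow> terminal D (omap F T)) \<and>
     (\<forall>P X Y Z p q f g. pullback C P X Y Z p q f g \<longrightarrow>
        pullback D (omap F P) (omap F X) (omap F Y) (omap F Z)
          (amap F p) (amap F q) (amap F f) (amap F g))"

text \<open>An inclusion \<open>D \<rightarrow> C\<close> with inverse image \<open>F\<close> and direct image \<open>G\<close>.\<close>

definition geometric_inclusion ::
  "('p, 'n) cat \<Rightarrow> ('o, 'm) cat \<Rightarrow> ('o, 'm, 'p, 'n) fnctr \<Rightarrow> ('p, 'n, 'o, 'm) fnctr \<Rightarrow> bool" where
  "geometric_inclusion D C F G \<longleftrightarrow>
     left_adjoint C D F G \<and> left_exact C D F \<and> fully_faithful D C G"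


section \<open>The realizability topos\<close>

text \<open>HOL has no type of all sets, so the underlying sets of assemblies are taken from a family
  \<open>U\<close> of small subsets of a type \<open>'u\<close>. The family contains a copy of \<open>A\<close> and an infinite set
  and, up to bijection, is closed under subsets, binary products and \<open>A\<close>-indexed powers. This
  holds for the sets in any Grothendieck universe containing \<open>A\<close>. Weaker than being a universe,
  it still puts the finite limits, the object of truth values and the sheafifications (for every
  local operator) of the objects considered among the objects considered, and it can be
  satisfied in HOL by arbitrarily large types, as the lemma below shows.\<close>

definition universe :: "'u set set \<Rightarrow> ('a \<Rightarrow> 'u) \<Rightarrow> bool" where
  "universe U code \<longleftrightarrow>
     inj code \<and> range code \<in> U \<and> (\<exists>N\<in>U. infinite N) \<and>
     (\<forall>S\<in>U. \<forall>T. T \<subseteq> S \<longrightarrow> T \<in> U) \<and>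
     (\<forall>S\<in>U. \<forall>T\<in>U. \<exists>h :: 'u \<times> 'u \<Rightarrow> 'u. inj_on h (S \<times> T) \<and> h ` (S \<times> T) \<in> U) \<and>
     (\<forall>S\<in>U. \<exists>h :: ('a \<Rightarrow> 'u) \<Rightarrow> 'u.
        inj_on h {g. range g \<subseteq> S} \<and> h ` {g. range g \<subseteq> S} \<in> U)"

lemma universe_UNIV:
  "universe (UNIV :: (('a + 'v) list \<Rightarrow> nat) set set)
     (\<lambda>a l. case l of [Inl b] \<Rightarrow> if a = b then 1 else 0 | _ \<Rightarrow> 0)"
proof -
  let ?code = "\<lambda>(a :: 'a) (l :: ('a + 'v) list).
    case l of [Inl b] \<Rightarrow> if a = b then 1 else 0 | _ \<Rightarrow> (0 :: nat)"
  let ?h = "\<lambda>(p :: (('a + 'v) list \<Rightarrow> nat) \<times> (('a + 'v) list \<Rightarrow> nat)) l.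
    prod_encode (fst p l, snd p l)"
  let ?k = "\<lambda>(g :: 'a \<Rightarrow> ('a + 'v) list \<Rightarrow> nat) l. case l of Inl a # as \<Rightarrow> g a as | _ \<Rightarrow> 0"
  have "inj ?code"
  proof (rule injI)
    fix a b assume "?code a = ?code b"
    from fun_cong[OF this, of "[Inl a]"] show "a = b" by (simp split: if_splits)
  qed
  moreover have "infinite (UNIV :: (('a + 'v) list \<Rightarrow> nat) set)"
  proof -
    have "inj (\<lambda>(n :: nat) (l :: ('a + 'v) list). n)" by (rule injI) (metis)
    then show ?thesis by (meson finite_imageD finite_subset infinite_UNIV_nat subset_UNIV)
  qed
  moreover have "inj ?k"
  proof (rule injI, rule ext, rule ext)
    fix g g' a l assume "?k g = ?k g'"
    from fun_cong[OF this, of "Inl a # l"] show "g a l = g' a l" by simp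
  qed
  moreover have "inj ?h"
  proof (rule injI)
    fix p q assume "?h p = ?h q"
    from fun_cong[OF this] show "p = q"
      by (auto simp: prod_eq_iff fun_eq_iff)
  qed
  ultimately show ?thesis
    unfolding universe_def by (meson UNIV_I inj_on_subset subset_UNIV)
qed

record ('u, 'a) assembly =
  Car :: "'u set"
  Ex :: "'u \<Rightarrow> 'a set"

record ('u, 'a) rtobj = "('u, 'a) assembly" +
  Eq :: "'u \<Rightarrow> 'u \<Rightarrow> 'a set"

text \<open>\<open>RT(A)\<close> as the ex/reg completion of \<open>Ass(A)\<close>: objects are assemblies with an equivalence
  relation (a subobject of \<open>X \<times> X\<close> in \<open>Ass(A)\<close>); arrows are the relations (subobjects of \<open>X \<times> Y\<close>)
  that are compatible with the equivalence relations, single-valued and total. A subobject of an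
  assembly \<open>(X,E)\<close> is given by a function \<open>\<phi>\<close> from \<open>X\<close> to the powerset of \<open>A\<close> with
  \<open>\<phi> \<turnstile> E\<close>, standing for the assembly on \<open>{x. \<phi> x \<noteq> \<emptyset>}\<close> with realizers \<open>\<phi>\<close>; two functions give
  the same subobject iff each entails the other.\<close>

definition is_rtobj :: "'u set set \<Rightarrow> 'a papp \<Rightarrow> ('u, 'a) rtobj \<Rightarrow> bool" where
  "is_rtobj U A X \<longleftrightarrow>
     Car X \<in> U \<and> (\<forall>x\<in>Car X. Ex X x \<noteq> {}) \<and>
     entails A (Car X \<times> Car X) (\<lambda>(x, y). Eq X x y) (\<lambda>(x, y). meet A (Ex X x) (Ex X y)) \<and>
     entails A (Car X) (Ex X) (\<lambda>x. Eq X x x) \<and>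
     entails A (Car X \<times> Car X) (\<lambda>(x, y). Eq X x y) (\<lambda>(x, y). Eq X y x) \<and>
     entails A (Car X \<times> Car X \<times> Car X)
       (\<lambda>(x, y, z). meet A (Eq X x y) (Eq X y z)) (\<lambda>(x, y, z). Eq X x z)"

definition is_funrel ::
  "'a papp \<Rightarrow> ('u, 'a) rtobj \<Rightarrow> ('u, 'a) rtobj \<Rightarrow> ('u \<Rightarrow> 'u \<Rightarrow> 'a set) \<Rightarrow> bool" where
  "is_funrel A X Y F \<longleftrightarrow>
     entails A (Car X \<times> Car Y) (\<lambda>(x, y). F x y) (\<lambda>(x, y). meet A (Ex X x) (Ex Y y)) \<and>
     entails A (Car X \<times> Car X \<times> Car Y \<times> Car Y)
       (\<lambda>(x, x', y, y'). meet A (Eq X x x') (meet A (F x y) (Eq Y y y')))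
       (\<lambda>(x, x', y, y'). F x' y') \<and>
     entails A (Car X \<times> Car Y \<times> Car Y)
       (\<lambda>(x, y, y'). meet A (F x y) (F x y')) (\<lambda>(x, y, y'). Eq Y y y') \<and>
     entails A (Car X) (Ex X) (\<lambda>x. \<Union>y\<in>Car Y. F x y)"

definition same_rel ::
  "'a papp \<Rightarrow> ('u, 'a) rtobj \<Rightarrow> ('u, 'a) rtobj \<Rightarrow>
   ('u \<Rightarrow> 'u \<Rightarrow> 'a set) \<Rightarrow> ('u \<Rightarrow> 'u \<Rightarrow> 'a set) \<Rightarrow> bool" where
  "same_rel A X Y F G \<longleftrightarrow>
     entails A (Car X \<times> Car Y) (\<lambda>(x, y). F x y) (\<lambda>(x, y). G x y) \<and>
     entails A (Car X \<times> Car Y) (\<lambda>(x, y). G x y) (\<lambda>(x, y). F x y)"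

text \<open>An arrow is a triple of domain, codomain and class of representing relations.\<close>

type_synonym ('u, 'a) rtarr =
  "('u, 'a) rtobj \<times> ('u, 'a) rtobj \<times> ('u \<Rightarrow> 'u \<Rightarrow> 'a set) set"

definition rt_arr ::
  "'a papp \<Rightarrow> ('u, 'a) rtobj \<Rightarrow> ('u, 'a) rtobj \<Rightarrow> ('u \<Rightarrow> 'u \<Rightarrow> 'a set) \<Rightarrow> ('u, 'a) rtarr" where
  "rt_arr A X Y F = (X, Y, {G. same_rel A X Y F G})"

definition rt_comp :: "'a papp \<Rightarrow> ('u, 'a) rtarr \<Rightarrow> ('u, 'a) rtarr \<Rightarrow> ('u, 'a) rtarr" where
  "rt_comp A = (\<lambda>(Y', Z, c') (X, Y, c).
     (X, Z, {H. \<exists>F\<in>c. \<exists>G\<in>c'.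
        same_rel A X Z (\<lambda>x z. \<Union>y\<in>Car Y. meet A (F x y) (G y z)) H}))"

definition RT :: "'u set set \<Rightarrow> 'a papp \<Rightarrow> (('u, 'a) rtobj, ('u, 'a) rtarr) cat" where
  "RT U A = \<lparr>
     Ob = {X. is_rtobj U A X},
     Hom = (\<lambda>X Y. {rt_arr A X Y F |F. is_funrel A X Y F}),
     Id = (\<lambda>X. rt_arr A X X (Eq X)),
     Comp = rt_comp A\<rparr>"

text \<open>The embedding of \<open>Ass(A)\<close> in \<open>RT(A)\<close>: diagonals and graphs.\<close>

definition asm :: "('u, 'a) assembly \<Rightarrow> ('u, 'a) rtobj" where
  "asm X = \<lparr>Car = Car X, Ex = Ex X, Eq = (\<lambda>x y. if x = y then Ex X x else {})\<rparr>"

definition asm_arr ::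
  "'a papp \<Rightarrow> ('u, 'a) assembly \<Rightarrow> ('u, 'a) assembly \<Rightarrow> ('u \<Rightarrow> 'u) \<Rightarrow> ('u, 'a) rtarr" where
  "asm_arr A X Y g = rt_arr A (asm X) (asm Y) (\<lambda>x y. if y = g x then Ex X x else {})"

text \<open>For an applicative morphism \<open>\<iota> : A \<rightarrow> A'\<close> that is the identity on elements, the functor
  \<open>(X,E) \<mapsto> (X,E)\<close> sends the subobject given by \<open>\<phi>\<close> to the subobject given by \<open>\<phi>\<close>, so its extension to
  the ex/reg completions leaves equivalence relations and representing relations unchanged.\<close>

definition inverse_image ::
  "'a papp \<Rightarrow> (('u, 'a) rtobj, ('u, 'a) rtarr, ('u, 'a) rtobj, ('u, 'a) rtarr) fnctr" where
  "inverse_image A' = \<lparr>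
     omap = (\<lambda>X. X),
     amap = (\<lambda>(X, Y, c). (X, Y, {G. \<exists>F\<in>c. same_rel A' X Y F G}))\<rparr>"


section \<open>Local operators\<close>

definition local_operator :: "'a papp \<Rightarrow> ('a set \<Rightarrow> 'a set) \<Rightarrow> bool" where
  "local_operator A J \<longleftrightarrow>
     (\<Inter>V. imp A V (J V)) \<noteq> {} \<and>
     (\<Inter>V. imp A (J (J V)) (J V)) \<noteq> {} \<and>
     (\<Inter>V. \<Inter>W. imp A (imp A V W) (imp A (J V) (J W))) \<noteq> {}"

definition le_operator :: "'a papp \<Rightarrow> ('a set \<Rightarrow> 'a set) \<Rightarrow> ('a set \<Rightarrow> 'a set) \<Rightarrow> bool" where
  "le_operator A J K \<longleftrightarrow> (\<Inter>V. imp A (J V) (K V)) \<noteq> {}"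

text \<open>The classifying map of a mono \<open>m : X \<rightarrow> Y\<close> represented by \<open>M\<close> is represented by
  \<open>y \<mapsto> \<Union>x. M x y\<close>. The mono is dense if composing this map with the local operator gives
  the constant map to true.\<close>

definition dense_mono ::
  "'u set set \<Rightarrow> 'a papp \<Rightarrow> ('a set \<Rightarrow> 'a set) \<Rightarrow>
   ('u, 'a) rtobj \<Rightarrow> ('u, 'a) rtobj \<Rightarrow> ('u, 'a) rtarr \<Rightarrow> bool" where
  "dense_mono U A J X Y m \<longleftrightarrow> mono_arr (RT U A) X Y m \<and>
     (\<exists>M. m = rt_arr A X Y M \<and> entails A (Car Y) (Ex Y) (\<lambda>y. J (\<Union>x\<in>Car X. M x y)))"

definition is_sheaf :: "'u set set \<Rightarrow> 'a papp \<Rightarrow> ('a set \<Rightarrow> 'a set) \<Rightarrow> ('u, 'a) rtobj \<Rightarrow> bool" where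
  "is_sheaf U A J S \<longleftrightarrow> S \<in> Ob (RT U A) \<and>
     (\<forall>X\<in>Ob (RT U A). \<forall>Y\<in>Ob (RT U A). \<forall>m. dense_mono U A J X Y m \<longrightarrow>
        (\<forall>g\<in>Hom (RT U A) X S. \<exists>!h. h \<in> Hom (RT U A) Y S \<and> Comp (RT U A) h m = g))"

definition Sh ::
  "'u set set \<Rightarrow> 'a papp \<Rightarrow> ('a set \<Rightarrow> 'a set) \<Rightarrow> (('u, 'a) rtobj, ('u, 'a) rtarr) cat" where
  "Sh U A J = full_sub (RT U A) {S. is_sheaf U A J S}"

definition sheafification ::
  "'u set set \<Rightarrow> 'a papp \<Rightarrow> ('a set \<Rightarrow> 'a set) \<Rightarrow>
   ('u, 'a) rtobj \<Rightarrow> ('u, 'a) rtobj \<Rightarrow> ('u, 'a) rtarr \<Rightarrow> bool" where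
  "sheafification U A J X L \<eta> \<longleftrightarrow> L \<in> Ob (Sh U A J) \<and> \<eta> \<in> Hom (RT U A) X L \<and>
     (\<forall>S\<in>Ob (Sh U A J). \<forall>g\<in>Hom (RT U A) X S.
        \<exists>!h. h \<in> Hom (Sh U A J) L S \<and> Comp (RT U A) h \<eta> = g)"

text \<open>The arrow \<open>l\<close> is the sheafification of \<open>m\<close>.\<close>

definition inverts ::
  "'u set set \<Rightarrow> 'a papp \<Rightarrow> ('a set \<Rightarrow> 'a set) \<Rightarrow>
   ('u, 'a) rtobj \<Rightarrow> ('u, 'a) rtobj \<Rightarrow> ('u, 'a) rtarr \<Rightarrow> bool" where
  "inverts U A J X Y m \<longleftrightarrow>
     (\<exists>LX \<eta>X LY \<eta>Y l.
        sheafification U A J X LX \<eta>X \<and> sheafification U A J Y LY \<eta>Y \<and>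
        l \<in> Hom (Sh U A J) LX LY \<and> Comp (RT U A) l \<eta>X = Comp (RT U A) \<eta>Y m \<and>
        iso_arr (Sh U A J) LX LY l)"

definition least_inverting ::
  "'u set set \<Rightarrow> 'a papp \<Rightarrow> ('a set \<Rightarrow> 'a set) \<Rightarrow>
   ('u, 'a) rtobj \<Rightarrow> ('u, 'a) rtobj \<Rightarrow> ('u, 'a) rtarr \<Rightarrow> bool" where
  "least_inverting U A J X Y m \<longleftrightarrow>
     local_operator A J \<and> inverts U A J X Y m \<and>
     (\<forall>K. local_operator A K \<longrightarrow> inverts U A K X Y m \<longrightarrow> le_operator A J K)"


section \<open>Forcing \<open>f\<close> to be realizable\<close>

text \<open>The assemblies \<open>(B,{\<cdot>})\<close> and \<open>(B,E)\<close>, carried along \<open>code\<close> into \<open>'u\<close>.\<close>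

definition dom_asm :: "('a \<Rightarrow> 'u) \<Rightarrow> ('a \<Rightarrow> 'a option) \<Rightarrow> ('u, 'a) assembly" where
  "dom_asm code f = \<lparr>Car = code ` dom f, Ex = (\<lambda>u. {b. u = code b})\<rparr>"

definition graph_asm :: "'a papp \<Rightarrow> 'a \<Rightarrow> ('a \<Rightarrow> 'u) \<Rightarrow> ('a \<Rightarrow> 'a option) \<Rightarrow> ('u, 'a) assembly" where
  "graph_asm A p code f =
     \<lparr>Car = code ` dom f, Ex = (\<lambda>u. {pr A p b c |b c. u = code b \<and> f b = Some c})\<rparr>"

end

theory Submission
  imports Defs
begin

text \<open>Let \<open>K V\<close> be the set of those \<open>e\<close> whose dialogue with the oracle \<open>f\<close> ends with an element
  of \<open>V\<close>. Since application in \<open>A[f]\<close> is given by such dialogues, a predicate \<open>\<phi>\<close> is realized over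
  \<open>A[f]\<close> iff \<open>K \<circ> \<phi>\<close> is realized over \<open>A\<close>. As the oracle is a function, \<open>K\<close> commutes with unions;
  therefore the right adjoint of the inverse image just applies \<open>K\<close> to existence predicates,
  equality predicates and functional relations, it is fully faithful, and its essential image
  consists of the sheaves for \<open>K\<close>. Finally \<open>K\<close> is equivalent to the given local operator \<open>J\<close>: \<open>K\<close>
  inverts the mono because the oracle realizes \<open>f\<close>, so \<open>J \<le> K\<close>; and a local operator that inverts
  the mono makes it dense, hence provides realizers of \<open>b \<mapsto> J {f b}\<close>, which can answer the queries
  of a dialogue one after the other, so \<open>K \<le> J\<close>.

  Statements of the internal logic are evaluated at stages, which are partial families of
  realizers. At a fixed stage, conjunction and existential quantification have their ordinary
  meaning, so that \<open>RT(A)\<close> is treated like the category of sets with a partial equivalence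
  relation; implications and local operators quantify over restrictions of stages, as in Kripke
  semantics.\<close>

section \<open>Combinatory completeness\<close>

text \<open>A stage is a partitioned assembly: each index in its domain carries exactly one
  realizer. Partitioned assemblies are projective in \<open>RT(A)\<close>, which is why an
  existential has a witness over the same stage.

  Stages are not objects of the category, so universal properties cannot be applied to them
  directly. The bridge is tabulation: a relation between two objects is itself an object with two
  legs, the generic related pair.

  Truth over \<open>A[f]\<close> is truth over \<open>A\<close> at a refinement, and refinements are
  directed. So every condition with finitely many premises and a conclusion built from conjunction
  and existence passes from \<open>A\<close> to \<open>A[f]\<close>. Objects, functional relations,
  monos and finite limits are all described by such conditions, and this gives left exactness.

  To invert a mono, an operator must have sheafifications of both ends. For \<open>K\<close> they
  are explicit: assemblies are separated, so the unit into the direct image is a dense mono into a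
  sheaf. For an arbitrary inverting \<open>J\<close> only the universal property is at hand, and it
  is tested on the object of \<open>J\<close>-closed truth values.\<close>

datatype 'a tm = Var nat | Cst 'a | App "'a tm" "'a tm"

primrec eval :: "'a papp \<Rightarrow> (nat \<Rightarrow> 'a) \<Rightarrow> 'a tm \<Rightarrow> 'a option" where
  "eval A \<rho> (Var n) = Some (\<rho> n)"
| "eval A \<rho> (Cst a) = Some a"
| "eval A \<rho> (App t u) = Option.bind (eval A \<rho> t) (\<lambda>a. Option.bind (eval A \<rho> u) (A a))"

text \<open>Bracket abstraction without the shortcut \<open>k t\<close> for a compound term
  \<open>t\<close> free of the variable: every application becomes an \<open>s\<close>. So an
  abstraction is always defined, even where its body is not.\<close>

primrec lam :: "'a \<Rightarrow> 'a \<Rightarrow> nat \<Rightarrow> 'a tm \<Rightarrow> 'a tm" where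
  "lam k s n (Var m) = (if m = n then App (App (Cst s) (Cst k)) (Cst k) else App (Cst k) (Var m))"
| "lam k s n (Cst a) = App (Cst k) (Cst a)"
| "lam k s n (App t u) = App (App (Cst s) (lam k s n t)) (lam k s n u)"

primrec lams :: "'a \<Rightarrow> 'a \<Rightarrow> nat \<Rightarrow> nat \<Rightarrow> 'a tm \<Rightarrow> 'a tm" where
  "lams k s j 0 t = t"
| "lams k s j (Suc n) t = lam k s j (lams k s (Suc j) n t)"

primrec apps :: "'a papp \<Rightarrow> 'a \<Rightarrow> 'a list \<Rightarrow> 'a option" where
  "apps A a [] = Some a"
| "apps A a (x # xs) = Option.bind (A a x) (\<lambda>b. apps A b xs)"

lemma apps_append: "apps A a (xs @ ys) = Option.bind (apps A a xs) (\<lambda>b. apps A b ys)"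
  by (induction xs arbitrary: a) (auto split: Option.bind_splits)

lemma eval_App_Some:
  "eval A \<rho> (App t u) = Some z \<longleftrightarrow>
     (\<exists>a b. eval A \<rho> t = Some a \<and> eval A \<rho> u = Some b \<and> A a b = Some z)"
  by (cases "eval A \<rho> t"; cases "eval A \<rho> u") auto

lemma imp_iff: "g \<in> imp A V W \<longleftrightarrow> (\<forall>x\<in>V. \<exists>y\<in>W. A g x = Some y)"
  by (simp add: imp_def)

lemma impE:
  assumes "g \<in> imp A V W" "x \<in> V"
  obtains y where "y \<in> W" "A g x = Some y"
  using assms by (auto simp: imp_iff)

lemma local_operatorI:
  assumes "\<And>V. u \<in> imp A V (J V)" "\<And>V. j \<in> imp A (J (J V)) (J V)"
    "\<And>V W. m \<in> imp A (imp A V W) (imp A (J V) (J W))"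
  shows "local_operator A J"
proof -
  have "u \<in> (\<Inter>V. imp A V (J V))" "j \<in> (\<Inter>V. imp A (J (J V)) (J V))"
    "m \<in> (\<Inter>V. \<Inter>W. imp A (imp A V W) (imp A (J V) (J W)))"
    using assms by simp_all
  then show ?thesis unfolding local_operator_def by blast
qed

lemma local_operatorD:
  assumes "local_operator A J"
  shows "\<exists>u j m. (\<forall>V. u \<in> imp A V (J V)) \<and> (\<forall>V. j \<in> imp A (J (J V)) (J V)) \<and>
    (\<forall>V W. m \<in> imp A (imp A V W) (imp A (J V) (J W)))"
  using assms unfolding local_operator_def ex_in_conv[symmetric] INT_iff by blast

locale pca_pairing =
  fixes A :: "'a papp" and k s p p0 p1 :: 'a
  assumes pca: "pca A k s" and pairing: "pairing A p p0 p1"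
begin

abbreviation pair :: "'a \<Rightarrow> 'a \<Rightarrow> 'a" where "pair \<equiv> pr A p"
abbreviation F :: 'a where "F \<equiv> fls A k s"
abbreviation ev :: "(nat \<Rightarrow> 'a) \<Rightarrow> 'a tm \<Rightarrow> 'a option" where "ev \<equiv> eval A"
abbreviation env :: "'a list \<Rightarrow> nat \<Rightarrow> 'a" where "env xs \<equiv> \<lambda>i. if i < length xs then xs ! i else k"
abbreviation lm :: "nat \<Rightarrow> 'a tm \<Rightarrow> 'a tm" where "lm \<equiv> lam k s"

definition k1 :: "'a \<Rightarrow> 'a" where "k1 a = the (A k a)"
definition s1 :: "'a \<Rightarrow> 'a" where "s1 a = the (A s a)"
definition s2 :: "'a \<Rightarrow> 'a \<Rightarrow> 'a" where "s2 a b = the (A (s1 a) b)"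

lemma k_app [simp]: "A k a = Some (k1 a)" "A (k1 a) b = Some a"
proof -
  have k: "Option.bind (A k a) (\<lambda>d. A d b) = Some a" for b
    using pca unfolding pca_def ap2_def by blast
  then show "A k a = Some (k1 a)" by (cases "A k a") (auto simp: k1_def)
  with k[of b] show "A (k1 a) b = Some a" by simp
qed

lemma s_app [simp]: "A s a = Some (s1 a)" "A (s1 a) b = Some (s2 a b)"
proof -
  have s: "Option.bind (A s a) (\<lambda>d. A d b) \<noteq> None" for b
    using pca unfolding pca_def ap2_def by blast
  then show "A s a = Some (s1 a)" by (cases "A s a") (auto simp: s1_def)
  with s[of b] show "A (s1 a) b = Some (s2 a b)" by (auto simp: s2_def)
qed

lemma s2_app: "A a c = Some x \<Longrightarrow> A b c = Some y \<Longrightarrow> A x y = Some z \<Longrightarrow> A (s2 a b) c = Some z"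
proof -
  assume "A a c = Some x" "A b c = Some y" "A x y = Some z"
  then have "ap3 A s a b c = Some z" using pca unfolding pca_def by blast
  then show "A (s2 a b) c = Some z" by (simp add: ap3_def ap2_def)
qed

lemma pair_app: "\<exists>u. A p a = Some u \<and> A u b = Some (pair a b)"
  and fst_pair [simp]: "A p0 (pair a b) = Some a"
  and snd_pair [simp]: "A p1 (pair a b) = Some b"
  using pairing unfolding pairing_def pr_def ap2_def
  by (metis bind_eq_Some_conv option.sel)+

lemma pair_inject [simp]: "pair a b = pair a' b' \<longleftrightarrow> a = a' \<and> b = b'"
  by (metis fst_pair snd_pair option.inject)

lemma eval_lam_Some: "\<exists>e. ev \<rho> (lm n t) = Some e"
  by (induction t) auto

text \<open>Beta reduction is claimed only where the body is defined, because the axiom for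
  \<open>s\<close> says nothing about \<open>sabc\<close> where \<open>ac(bc)\<close> is
  undefined.\<close>

lemma eval_lam_app:
  "ev \<rho> (lm n t) = Some e \<Longrightarrow> ev (\<rho>(n := x)) t = Some y \<Longrightarrow> A e x = Some y"
proof (induction t arbitrary: e y)
  case (Var m)
  have "A (s2 k k) x = Some x" using s2_app[of k x "k1 x" k "k1 x" x] by simp
  with Var show ?case by (auto split: if_splits)
next
  case (Cst a)
  then show ?case by auto
next
  case (App t u)
  obtain a b where ab: "ev \<rho> (lm n t) = Some a" "ev \<rho> (lm n u) = Some b"
    using eval_lam_Some by blast
  obtain c d where cd: "ev (\<rho>(n := x)) t = Some c" "ev (\<rho>(n := x)) u = Some d" "A c d = Some y"
    using App.prems(2) unfolding eval_App_Some by blast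
  have "A a x = Some c" "A b x = Some d" using App.IH ab cd by blast+
  moreover have "e = s2 a b" using App.prems(1) ab by simp
  ultimately show ?case using cd(3) s2_app by blast
qed

lemma F_app: "\<exists>u. A F a = Some u \<and> A u b = Some b"
proof -
  have "A (s2 k k) b = Some b" using s2_app[of k b "k1 b" k "k1 b" b] by simp
  moreover have "F = k1 (s2 k k)" by (simp add: fls_def ap2_def)
  ultimately show ?thesis by simp
qed

text \<open>If the booleans coincide, then \<open>a = kab = Fab = b\<close>. Only in this degenerate
  case could a move of a dialogue be read both as a halt and as a query, and then all results are
  equal anyway.\<close>

lemma trivial_if_k_eq_F: assumes "k = F" shows "a = (b :: 'a)"
  using F_app[of a b] assms by simp

text \<open>Besides beta reduction for \<open>n\<close> arguments, shorter argument lists are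
  recorded to give defined values. Codes obtained by partial application therefore exist before it
  is known whether the procedure terminates.\<close>

lemma ex_lams:
  "\<exists>a. (\<forall>xs. length xs < n \<longrightarrow> (\<exists>b. apps A a xs = Some b)) \<and>
     (\<forall>xs z. length xs = n \<longrightarrow> ev (env xs) t = Some z \<longrightarrow>
        apps A a xs = Some z)"
proof (cases n)
  case 0
  show ?thesis
  proof (cases "ev (\<lambda>i. k) t")
    case None then show ?thesis using 0 by auto
  next
    case (Some a) then show ?thesis using 0 by (intro exI[of _ a]) auto
  qed
next
  case (Suc m)
  \<comment> \<open>Peeling off the outermost abstraction fixes variable \<open>j\<close> and leaves
    a block that starts at \<open>Suc j\<close>; hence the start of the block and the outer
    environment are generalized. With at least one abstraction the term is certain to have a
    value.\<close>
  have gen: "\<exists>a. ev \<rho> (lams k s j (Suc m) t) = Some a \<and>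
      (\<forall>xs. length xs < Suc m \<longrightarrow> (\<exists>b. apps A a xs = Some b)) \<and>
      (\<forall>xs z. length xs = Suc m \<longrightarrow>
         ev (\<lambda>i. if j \<le> i \<and> i < j + Suc m then xs ! (i - j) else \<rho> i) t = Some z \<longrightarrow>
         apps A a xs = Some z)" for \<rho> j m
  proof (induction m arbitrary: \<rho> j)
    case 0
    obtain a where a: "ev \<rho> (lams k s j (Suc 0) t) = Some a" using eval_lam_Some by fastforce
    have "apps A a xs = Some z"
      if "length xs = Suc 0"
        "ev (\<lambda>i. if j \<le> i \<and> i < j + Suc 0 then xs ! (i - j) else \<rho> i) t = Some z" for xs z
    proof -
      from that(1) obtain x where x: "xs = [x]" by (auto simp: length_Suc_conv)
      have "(\<lambda>i. if j \<le> i \<and> i < j + Suc 0 then xs ! (i - j) else \<rho> i) = \<rho>(j := x)"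
        by (auto simp: x fun_eq_iff)
      then show ?thesis using that a x eval_lam_app by (simp add: bind_eq_Some_conv)
    qed
    then show ?case using a by auto
  next
    case (Suc m)
    obtain a where a: "ev \<rho> (lams k s j (Suc (Suc m)) t) = Some a"
      using eval_lam_Some by (metis lams.simps(2))
    have step: "\<exists>b. A a x = Some b \<and>
      (\<forall>xs. length xs < Suc m \<longrightarrow> (\<exists>c. apps A b xs = Some c)) \<and>
      (\<forall>xs z. length xs = Suc m \<longrightarrow>
         ev (\<lambda>i. if Suc j \<le> i \<and> i < Suc j + Suc m then xs ! (i - Suc j) else (\<rho>(j := x)) i) t = Some z \<longrightarrow>
         apps A b xs = Some z)" for x
    proof -
      obtain b where b: "ev (\<rho>(j := x)) (lams k s (Suc j) (Suc m) t) = Some b \<and>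
      (\<forall>xs. length xs < Suc m \<longrightarrow> (\<exists>c. apps A b xs = Some c)) \<and>
      (\<forall>xs z. length xs = Suc m \<longrightarrow>
         ev (\<lambda>i. if Suc j \<le> i \<and> i < Suc j + Suc m then xs ! (i - Suc j) else (\<rho>(j := x)) i) t = Some z \<longrightarrow>
         apps A b xs = Some z)"
        using Suc.IH[of "\<rho>(j := x)" "Suc j"] by (elim exE)
      have "A a x = Some b"
        by (rule eval_lam_app[OF a[unfolded lams.simps(2)[of _ _ _ "Suc m"]] conjunct1[OF b]])
      then show ?thesis using b by blast
    qed
    have "\<exists>b. apps A a xs = Some b" if "length xs < Suc (Suc m)" for xs
    proof (cases xs)
      case (Cons x ys) then show ?thesis using step[of x] that by auto
    qed simp
    moreover have "apps A a xs = Some z" if "length xs = Suc (Suc m)"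
       and e: "ev (\<lambda>i. if j \<le> i \<and> i < j + Suc (Suc m) then xs ! (i - j) else \<rho> i) t = Some z" for xs z
    proof -
      from that(1) obtain x ys where x: "xs = x # ys" "length ys = Suc m"
        by (auto simp: length_Suc_conv)
      have "(\<lambda>i. if j \<le> i \<and> i < j + Suc (Suc m) then xs ! (i - j) else \<rho> i) =
        (\<lambda>i. if Suc j \<le> i \<and> i < Suc j + Suc m then ys ! (i - Suc j) else (\<rho>(j := x)) i)"
        by (auto simp: x(1) fun_eq_iff nth_Cons' Suc_diff_Suc)
      then show ?thesis using step[of x] e x by auto
    qed
    ultimately show ?case using a by blast
  qed
  show ?thesis using gen[where j = 0 and \<rho> = "\<lambda>_. k" and m = m] Suc by (auto cong: if_cong)
qed

lemma ex_lam1: "\<exists>a. \<forall>x z. ev (env [x]) t = Some z \<longrightarrow> A a x = Some z"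
proof -
  obtain a where a: "\<forall>xs z. length xs = 1 \<longrightarrow> ev (env xs) t = Some z \<longrightarrow>
      apps A a xs = Some z"
    using ex_lams[of 1 t] by blast
  have "A a x = Some z" if "ev (env [x]) t = Some z" for x z
    using a[rule_format, of "[x]" z] that by (auto simp: bind_eq_Some_conv)
  then show ?thesis by blast
qed

lemma ex_lam2: "\<exists>a. \<forall>x. \<exists>b. A a x = Some b \<and>
   (\<forall>y z. ev (env [x, y]) t = Some z \<longrightarrow> A b y = Some z)"
proof -
  obtain a where a: "\<forall>xs. length xs < 2 \<longrightarrow> (\<exists>b. apps A a xs = Some b)"
    "\<forall>xs z. length xs = 2 \<longrightarrow> ev (env xs) t = Some z \<longrightarrow>
      apps A a xs = Some z"
    using ex_lams[of 2 t] by blast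
  have "\<exists>b. A a x = Some b \<and>
   (\<forall>y z. ev (env [x, y]) t = Some z \<longrightarrow> A b y = Some z)" for x
  proof -
    obtain b where b: "A a x = Some b" using a(1)[rule_format, of "[x]"] by (auto simp: bind_eq_Some_conv)
    have "A b y = Some z" if "ev (env [x, y]) t = Some z" for y z
      using a(2)[rule_format, of "[x, y]" z] that b by (auto simp: bind_eq_Some_conv)
    then show ?thesis using b by blast
  qed
  then show ?thesis by blast
qed

definition pairT :: "'a tm \<Rightarrow> 'a tm \<Rightarrow> 'a tm" where
  "pairT t u = App (App (Cst p) t) u"
definition fstT :: "'a tm \<Rightarrow> 'a tm" where "fstT = App (Cst p0)"
definition sndT :: "'a tm \<Rightarrow> 'a tm" where "sndT = App (Cst p1)"

text \<open>The branches are abstracted over a dummy variable, so that only the selected one is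
  evaluated.\<close>

definition ite :: "'a tm \<Rightarrow> 'a tm \<Rightarrow> 'a tm \<Rightarrow> 'a tm" where
  "ite b t u = App (App (App b (lm 99 t)) (lm 99 u)) (Cst k)"

lemma eval_pairT [simp]:
  "ev \<rho> (pairT t u) =
     Option.bind (ev \<rho> t) (\<lambda>a. Option.bind (ev \<rho> u) (\<lambda>b. Some (pair a b)))"
proof (cases "ev \<rho> t"; cases "ev \<rho> u")
  fix a b assume "ev \<rho> t = Some a" "ev \<rho> u = Some b"
  then show ?thesis using pair_app[of a b] by (auto simp: pairT_def)
next
  fix a assume "ev \<rho> t = Some a" "ev \<rho> u = None"
  then show ?thesis using pair_app[of a] by (auto simp: pairT_def)
qed (auto simp: pairT_def)

lemma eval_fstT [simp]: "ev \<rho> (fstT t) = Option.bind (ev \<rho> t) (A p0)"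
  and eval_sndT [simp]: "ev \<rho> (sndT t) = Option.bind (ev \<rho> t) (A p1)"
  by (simp_all add: fstT_def sndT_def)

text \<open>The dummy variable \<open>99\<close> receives the dummy argument \<open>k\<close>
  supplied by \<open>ite\<close>. It lies beyond all variables of the programs below, so the updated
  environment agrees with the old one on them. The branch that is not chosen may be
  undefined.\<close>

lemma eval_ite:
  "ev \<rho> b = Some k \<Longrightarrow> ev (\<rho>(99 := k)) t = Some z \<Longrightarrow> ev \<rho> (ite b t u) = Some z"
  "ev \<rho> b = Some F \<Longrightarrow> ev (\<rho>(99 := k)) u = Some z \<Longrightarrow> ev \<rho> (ite b t u) = Some z"
proof -
  obtain c d where cd: "ev \<rho> (lm 99 t) = Some c" "ev \<rho> (lm 99 u) = Some d"
    using eval_lam_Some by blast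
  show "ev \<rho> b = Some k \<Longrightarrow> ev (\<rho>(99 := k)) t = Some z \<Longrightarrow> ev \<rho> (ite b t u) = Some z"
    using cd eval_lam_app[of \<rho> 99 t] by (auto simp: ite_def)
  show "ev \<rho> b = Some F \<Longrightarrow> ev (\<rho>(99 := k)) u = Some z \<Longrightarrow> ev \<rho> (ite b t u) = Some z"
    using cd F_app[of c d] eval_lam_app[of \<rho> 99 u] by (auto simp: ite_def)
qed

end

section \<open>Dialogues with the oracle\<close>

locale oracle_pca = pca_pairing +
  fixes f :: "'a \<Rightarrow> 'a option"
begin

abbreviation tp :: "'a list \<Rightarrow> 'a" where "tp \<equiv> tup A k s p"
abbreviation A' :: "'a papp" where "A' \<equiv> adjoin A k s p f"

text \<open>\<open>t\<close> maps the answers received so far to the next move. It is an arbitrary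
  partial function, so that the same notion serves for application in \<open>A[f]\<close>, where the
  input precedes the answers, and for computations without input.\<close>

inductive run :: "('a list \<Rightarrow> 'a option) \<Rightarrow> 'a list \<Rightarrow> 'a \<Rightarrow> bool" for t where
  halt: "t h = Some (pair k c) \<Longrightarrow> run t h c"
| query: "t h = Some (pair F d) \<Longrightarrow> f d = Some a \<Longrightarrow> run t (h @ [a]) c \<Longrightarrow> run t h c"

lemma run_deterministic: "run t h c \<Longrightarrow> run t h c' \<Longrightarrow> c = c'"
proof (induction rule: run.induct)
  case (halt h c)
  from halt.prems show ?case
    by cases (use halt.hyps trivial_if_k_eq_F in auto)
next
  case (query h d a c)
  from query.prems show ?case
    by cases (use query trivial_if_k_eq_F in auto)
qed

text \<open>Replaces the sequence of answers in \<open>computes\<close> by an inductive dialogue;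
  the induction forces the generalization to an initial history \<open>h\<close>.\<close>

lemma run_iff:
  "run t h c \<longleftrightarrow> (\<exists>as. (\<forall>i<length as. \<exists>d. t (h @ take i as) = Some (pair F d) \<and> f d = Some (as ! i)) \<and>
     t (h @ as) = Some (pair k c))" (is "_ \<longleftrightarrow> (\<exists>as. ?D h as)")
proof
  show "run t h c \<Longrightarrow> \<exists>as. ?D h as"
  proof (induction rule: run.induct)
    case (halt h c)
    then show ?case by (intro exI[of _ "[]"]) simp
  next
    case (query h d a c)
    then obtain as where as: "\<forall>i<length as. \<exists>d. t ((h @ [a]) @ take i as) = Some (pair F d) \<and> f d = Some (as ! i)"
      "t ((h @ [a]) @ as) = Some (pair k c)" by blast
    have "\<exists>d. t (h @ take i (a # as)) = Some (pair F d) \<and> f d = Some ((a # as) ! i)"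
      if "i < length (a # as)" for i
      using that query.hyps as(1) by (cases i) auto
    then show ?case using as(2) by (intro exI[of _ "a # as"]) auto
  qed
next
  have "?D h as \<Longrightarrow> run t h c" for as
  proof (induction as arbitrary: h)
    case Nil
    then show ?case by (auto intro: run.halt)
  next
    case (Cons a as)
    obtain d where "t h = Some (pair F d)" "f d = Some a" using Cons.prems by auto
    moreover have "\<exists>d. t ((h @ [a]) @ take i as) = Some (pair F d) \<and> f d = Some (as ! i)"
      if "i < length as" for i
      using conjunct1[OF Cons.prems, rule_format, of "Suc i"] that by simp
    with Cons.prems have "run t (h @ [a]) c" by (intro Cons.IH) auto
    ultimately show ?case by (rule run.query)
  qed
  then show "\<exists>as. ?D h as \<Longrightarrow> run t h c" by blast
qed

lemma adjoin_iff: "A' a b = Some c \<longleftrightarrow> run (\<lambda>l. A a (tp (b # l))) [] c"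
proof -
  let ?R = "run (\<lambda>l. A a (tp (b # l))) []"
  have c: "computes A k s p f a b = ?R"
    by (rule ext) (simp add: computes_def run_iff)
  have the: "(THE c. ?R c) = c" if "?R c" for c
    by (rule the_equality[where P = ?R, OF that]) (rule run_deterministic[OF _ that])
  show ?thesis
  proof (cases "\<exists>c. ?R c")
    case True
    then obtain d where d: "?R d" by (rule exE)
    have "A' a b = Some d" using True the[OF d] by (simp add: adjoin_def c)
    then show ?thesis using d run_deterministic[OF d, of c] by auto
  next
    case False
    then show ?thesis by (simp add: adjoin_def c)
  qed
qed

text \<open>\<open>e\<close> is read as a suspended computation with its input already built in: in
  contrast to application in \<open>A[f]\<close>, the tuples given to it consist of answers
  only.\<close>

definition halts :: "'a \<Rightarrow> 'a \<Rightarrow> bool" where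
  "halts e c \<longleftrightarrow> run (\<lambda>l. A e (tp l)) [] c"

definition K :: "'a set \<Rightarrow> 'a set" where "K V = {e. \<exists>c\<in>V. halts e c}"

text \<open>Copying every defined move copies the whole dialogue. Both translations between
  application in \<open>A[f]\<close> and suspended computations are instances.\<close>

lemma run_mono: "run t h c \<Longrightarrow> (\<And>h z. t h = Some z \<Longrightarrow> t' h = Some z) \<Longrightarrow> run t' h c"
  by (induction rule: run.induct) (auto intro: run.intros)

lemma tp_fst [simp]: "A p0 (tp []) = Some k" "A p0 (tp (a # l)) = Some F"
  and tp_snd [simp]: "A p1 (tp (a # l)) = Some (pair a (tp l))"
  by simp_all

declare tup.simps [simp del]

lemma tp_Cons: "pair F (pair a (tp l)) = tp (a # l)" by (simp add: tup.simps)

text \<open>Currying: the program takes \<open>a\<close>, \<open>x\<close> and the answers, and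
  hands the tuple of \<open>x\<close> followed by the answers to \<open>a\<close>. Two of its three
  arguments already give a value, so \<open>e\<close> exists whether or not the dialogue of
  \<open>a\<close> on \<open>x\<close> ends.\<close>

lemma ex_code: "\<exists>\<phi>. \<forall>a. \<exists>\<phi>a. A \<phi> a = Some \<phi>a \<and> (\<forall>x. \<exists>e. A \<phi>a x = Some e \<and>
    (\<forall>c. A' a x = Some c \<longrightarrow> halts e c))"
proof -
  let ?t = "App (Var 0) (pairT (Cst F) (pairT (Var 1) (Var 2)))"
  obtain \<phi> where \<phi>: "\<forall>xs. length xs < 3 \<longrightarrow> (\<exists>b. apps A \<phi> xs = Some b)"
    "\<forall>xs z. length xs = 3 \<longrightarrow> ev (env xs) ?t = Some z \<longrightarrow>
      apps A \<phi> xs = Some z"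
    using ex_lams[of 3 ?t] by blast
  have "\<exists>\<phi>a. A \<phi> a = Some \<phi>a \<and> (\<forall>x. \<exists>e. A \<phi>a x = Some e \<and>
    (\<forall>c. A' a x = Some c \<longrightarrow> halts e c))" for a
  proof -
    obtain \<phi>a where \<phi>a: "A \<phi> a = Some \<phi>a"
      using \<phi>(1)[rule_format, of "[a]"] by (auto simp: bind_eq_Some_conv)
    have "\<exists>e. A \<phi>a x = Some e \<and> (\<forall>c. A' a x = Some c \<longrightarrow> halts e c)" for x
    proof -
      obtain e where e: "A \<phi>a x = Some e"
        using \<phi>(1)[rule_format, of "[a, x]"] \<phi>a by (auto simp: bind_eq_Some_conv)
      have e': "A a (tp (x # l)) = Some z \<Longrightarrow> A e (tp l) = Some z" for l z
        using \<phi>(2)[rule_format, of "[a, x, tp l]" z] \<phi>a e by (simp add: tp_Cons)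
      have "run (\<lambda>l. A e (tp l)) [] c" if "run (\<lambda>l. A a (tp (x # l))) [] c" for c
        by (rule run_mono[OF that]) (rule e')
      then show ?thesis using e unfolding adjoin_iff halts_def by blast
    qed
    then show ?thesis using \<phi>a by blast
  qed
  then show ?thesis by blast
qed

text \<open>Uncurrying, the converse of \<open>ex_code\<close>: the tuple received is split into the
  input \<open>x\<close> and the answers.\<close>

lemma ex_lift: "\<exists>L. \<forall>a. \<exists>a'. A L a = Some a' \<and>
    (\<forall>x e c. A a x = Some e \<longrightarrow> halts e c \<longrightarrow> A' a' x = Some c)"
proof -
  let ?t = "App (App (Var 0) (fstT (sndT (Var 1)))) (sndT (sndT (Var 1)))"
  obtain L where L: "\<forall>a. \<exists>b. A L a = Some b \<and>
   (\<forall>y z. ev (env [a, y]) ?t = Some z \<longrightarrow> A b y = Some z)"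
    using ex_lam2[of ?t] by blast
  have "\<exists>a'. A L a = Some a' \<and>
    (\<forall>x e c. A a x = Some e \<longrightarrow> halts e c \<longrightarrow> A' a' x = Some c)" for a
  proof -
    obtain a' where a': "A L a = Some a'"
      "\<And>y z. ev (env [a, y]) ?t = Some z \<Longrightarrow> A a' y = Some z"
      using L by blast
    have a'': "A a x = Some e \<Longrightarrow> A e (tp l) = Some z \<Longrightarrow> A a' (tp (x # l)) = Some z" for x e l z
      using a'(2)[of "tp (x # l)" z] by simp
    have "run (\<lambda>l. A a' (tp (x # l))) [] c"
      if "A a x = Some e" "run (\<lambda>l. A e (tp l)) [] c" for x e c
      by (rule run_mono[OF that(2)]) (rule a''[OF that(1)])
    then show ?thesis using a'(1) unfolding adjoin_iff halts_def by blast
  qed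
  then show ?thesis by blast
qed

section \<open>Unit, query and sequencing of suspended computations\<close>

lemma ex_unit: "\<exists>u. \<forall>c. \<exists>e. A u c = Some e \<and> halts e c"
proof -
  obtain u where u: "\<forall>x. \<exists>b. A u x = Some b \<and>
   (\<forall>y z. ev (env [x, y]) (pairT (Cst k) (Var 0)) = Some z \<longrightarrow>
      A b y = Some z)"
    using ex_lam2 by blast
  have "\<exists>e. A u c = Some e \<and> halts e c" for c
  proof -
    obtain e where "A u c = Some e" "\<And>y. A e y = Some (pair k c)"
      using u[rule_format, of c] by auto
    then show ?thesis unfolding halts_def by (blast intro: run.halt)
  qed
  then show ?thesis by blast
qed

text \<open>The code inspects the tag of its tuple: with no answer yet it asks \<open>b\<close>,
  otherwise it returns the first answer. This is where the oracle makes \<open>f\<close>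
  representable.\<close>

lemma ex_query: "\<exists>q. \<forall>b c. f b = Some c \<longrightarrow> (\<exists>e. A q b = Some e \<and> halts e c)"
proof -
  let ?t = "ite (fstT (Var 1)) (pairT (Cst F) (Var 0)) (pairT (Cst k) (fstT (sndT (Var 1))))"
  obtain q where q: "\<forall>x. \<exists>b. A q x = Some b \<and>
   (\<forall>y z. ev (env [x, y]) ?t = Some z \<longrightarrow> A b y = Some z)"
    using ex_lam2[of ?t] by blast
  have "\<exists>e. A q b = Some e \<and> halts e c" if "f b = Some c" for b c
  proof -
    obtain e where e: "A q b = Some e"
      "\<And>y z. ev (env [b, y]) ?t = Some z \<Longrightarrow> A e y = Some z"
      using q[rule_format, of b] by blast
    have "A e (tp []) = Some (pair F b)" by (rule e(2), rule eval_ite(1)) simp_all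
    moreover have "A e (tp [c]) = Some (pair k c)" by (rule e(2), rule eval_ite(2)) simp_all
    ultimately have "halts e c"
      unfolding halts_def using that by (intro run.query[of _ "[]"] run.halt) simp_all
    then show ?thesis using e(1) by blast
  qed
  then show ?thesis by blast
qed

text \<open>The next move of \<open>e\<close> after the history accumulated in \<open>q\<close>:
  applied to the empty tuple, \<open>q\<close> returns that history.\<close>

abbreviation answer :: "nat \<Rightarrow> nat \<Rightarrow> 'a tm" where
  "answer e q \<equiv> App (Var e) (App (Var q) (Cst (tp [])))"

text \<open>Accumulators for answers of the oracle: an answer is appended by composition, without
  recursion over a tuple.\<close>

definition represents :: "'a \<Rightarrow> 'a list \<Rightarrow> bool" where
  "represents q h \<longleftrightarrow> (\<forall>l. A q (tp l) = Some (tp (h @ l)))"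

lemma ex_represents_Nil: "\<exists>q. represents q []"
proof -
  obtain i where "\<forall>x z. ev (env [x]) (Var 0) = Some z \<longrightarrow> A i x = Some z"
    using ex_lam1 by blast
  then show ?thesis unfolding represents_def by (intro exI[of _ i]) simp
qed

lemma ex_snoc:
  "\<exists>D. \<forall>q a. \<exists>q'. apps A D [q, a] = Some q' \<and>
     (\<forall>h. represents q h \<longrightarrow> represents q' (h @ [a]))"
proof -
  let ?t = "App (Var 0) (pairT (Cst F) (pairT (Var 1) (Var 2)))"
  obtain D where D: "\<forall>xs. length xs < 3 \<longrightarrow> (\<exists>b. apps A D xs = Some b)"
    "\<forall>xs z. length xs = 3 \<longrightarrow> ev (env xs) ?t = Some z \<longrightarrow>
      apps A D xs = Some z"
    using ex_lams[of 3 ?t] by blast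
  have "\<exists>q'. apps A D [q, a] = Some q' \<and>
     (\<forall>h. represents q h \<longrightarrow> represents q' (h @ [a]))" for q a
  proof -
    obtain q' where q': "apps A D [q, a] = Some q'"
      using D(1)[rule_format, of "[q, a]"] by auto
    have "A q' (tp l) = Some z" if "A q (tp (a # l)) = Some z" for l z
      using D(2)[rule_format, of "[q, a, tp l]" z] q' that apps_append[of A D "[q, a]" "[tp l]"]
      by (simp add: tp_Cons)
    then show ?thesis using q' unfolding represents_def by fastforce
  qed
  then show ?thesis by blast
qed

definition snoc :: 'a where
  "snoc = (SOME D. \<forall>q a. \<exists>q'. apps A D [q, a] = Some q' \<and>
     (\<forall>h. represents q h \<longrightarrow> represents q' (h @ [a])))"

definition snc :: "'a \<Rightarrow> 'a \<Rightarrow> 'a" where "snc q a = the (apps A snoc [q, a])"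

definition snocT :: "nat \<Rightarrow> 'a tm \<Rightarrow> 'a tm" where
  "snocT q t = App (App (Cst snoc) (Var q)) t"

lemma apps_snoc: "apps A snoc [q, a] = Some (snc q a)"
  and represents_snc: "represents q h \<Longrightarrow> represents (snc q a) (h @ [a])"
proof -
  have *: "\<exists>q'. apps A snoc [q, a] = Some q' \<and>
     (\<forall>h. represents q h \<longrightarrow> represents q' (h @ [a]))" for q a
    using someI_ex[OF ex_snoc] unfolding snoc_def by blast
  show "apps A snoc [q, a] = Some (snc q a)" using *[of q a] by (auto simp: snc_def)
  show "represents q h \<Longrightarrow> represents (snc q a) (h @ [a])" using *[of q a] by (auto simp: snc_def)
qed

lemma eval_snocT [simp]: "ev \<rho> t = Some a \<Longrightarrow> ev \<rho> (snocT q t) = Some (snc (\<rho> q) a)"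
  using apps_snoc[of "\<rho> q" a] by (auto simp: snocT_def bind_eq_Some_conv)

text \<open>Run \<open>e\<close> until it halts, then continue with \<open>g\<close> applied to its result. The variables
  \<open>0, \<dots>, 4\<close> stand for the procedure itself, \<open>g\<close>, \<open>e\<close>, the answers already consumed and the
  remaining ones.\<close>

definition bindT :: "'a tm" where
  "bindT = ite (fstT (answer 2 3)) (App (App (Var 1) (sndT (answer 2 3))) (Var 4))
     (ite (fstT (Var 4)) (answer 2 3)
       (App (App (App (App (App (Var 0) (Var 0)) (Var 1)) (Var 2))
          (snocT 3 (fstT (sndT (Var 4))))) (sndT (sndT (Var 4)))))"

lemma eval_apps5:
  assumes "eval A \<rho> t = Some a" "eval A \<rho> t1 = Some a1" "eval A \<rho> t2 = Some a2"
    "eval A \<rho> t3 = Some a3" "eval A \<rho> t4 = Some a4" "eval A \<rho> t5 = Some a5"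
  shows "eval A \<rho> (App (App (App (App (App t t1) t2) t3) t4) t5) = apps A a [a1, a2, a3, a4, a5]"
  using assms by simp

lemma eval_bindT_halt:
  assumes "represents (\<rho> 3) h" "A (\<rho> 2) (tp h) = Some (pair k c)"
    and "A (\<rho> 1) c = Some r" "A r (\<rho> 4) = Some z"
  shows "ev \<rho> bindT = Some z"
  unfolding bindT_def
  by (rule eval_ite(1)) (use assms in \<open>simp_all add: represents_def\<close>)

lemma eval_bindT_ask:
  assumes "represents (\<rho> 3) h" "A (\<rho> 2) (tp h) = Some (pair F d)" "\<rho> 4 = tp []"
  shows "ev \<rho> bindT = Some (pair F d)"
  unfolding bindT_def
proof (rule eval_ite(2), goal_cases)
  case 1 show ?case using assms by (simp add: represents_def)
next
  case 2 show ?case by (rule eval_ite(1)) (use assms in \<open>simp_all add: represents_def\<close>)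
qed

lemma eval_bindT_step:
  assumes "represents (\<rho> 3) h" "A (\<rho> 2) (tp h) = Some (pair F d)" "\<rho> 4 = tp (a # l)"
    and z: "apps A (\<rho> 0) [\<rho> 0, \<rho> 1, \<rho> 2, snc (\<rho> 3) a, tp l] = Some z"
  shows "ev \<rho> bindT = Some z"
  unfolding bindT_def
proof (rule eval_ite(2), goal_cases)
  case 1 show ?case using assms by (simp add: represents_def)
next
  case 2
  show ?case
  proof (rule eval_ite(2), goal_cases)
    case 1 show ?case using assms by simp
  next
    case 2
    show ?case
      by (subst eval_apps5[where a = "\<rho> 0" and ?a1.0 = "\<rho> 0" and ?a2.0 = "\<rho> 1" and
            ?a3.0 = "\<rho> 2" and ?a4.0 = "snc (\<rho> 3) a" and ?a5.0 = "tp l"])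
        (use assms(3) z in simp_all)
  qed
qed

text \<open>When a continuation takes over, its own history is empty, although the answers
  \<open>h\<close> have been used up before it.\<close>

lemma run_shift: "run t l c \<Longrightarrow> (\<And>l z. t l = Some z \<Longrightarrow> t' (h @ l) = Some z) \<Longrightarrow> run t' (h @ l) c"
  by (induction rule: run.induct) (auto intro: run.intros)

text \<open>Recursion is by self-application: \<open>M\<close> receives itself as first argument. On
  each tuple the simulation of \<open>e\<close> starts afresh and moves answers one by one from the
  remaining to the consumed ones. A query of \<open>e\<close> is passed on when no answer remains;
  when \<open>e\<close> halts, the answers left over belong to the continuation.\<close>

lemma ex_bind: "\<exists>B. \<forall>g. \<exists>Bg. A B g = Some Bg \<and>
   (\<forall>e. \<exists>e'. A Bg e = Some e' \<and>
      (\<forall>c r c'. halts e c \<longrightarrow> A g c = Some r \<longrightarrow> halts r c' \<longrightarrow> halts e' c'))"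
proof -
  obtain M where M: "\<forall>xs. length xs < 5 \<longrightarrow> (\<exists>b. apps A M xs = Some b)"
    "\<forall>xs z. length xs = 5 \<longrightarrow> ev (env xs) bindT = Some z \<longrightarrow>
      apps A M xs = Some z"
    using ex_lams[of 5 bindT] by blast
  obtain i where i: "represents i []" using ex_represents_Nil by blast
  let ?B = "App (App (App (App (Cst M) (Cst M)) (Var 0)) (Var 1)) (Cst i)"
  obtain B where B: "\<forall>g. \<exists>b. A B g = Some b \<and>
    (\<forall>e z. ev (env [g, e]) ?B = Some z \<longrightarrow> A b e = Some z)"
    using ex_lam2[of ?B] by blast
  have main: "halts e' c'"
    if e': "apps A M [M, g, e, i] = Some e'" and "halts e c" and r: "A g c = Some r" "halts r c'"
    for g e e' c r c'
  proof -
    have t': "apps A M [M, g, e, i, x] = A e' x" for x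
      using e' apps_append[of A M "[M, g, e, i]" "[x]"] by simp
    \<comment> \<open>Invariant: after the history \<open>h @ l\<close>, \<open>e'\<close> acts like
      the procedure that has consumed \<open>h\<close>, stored in \<open>q\<close>, and has
      \<open>l\<close> remaining.\<close>
    have sim: "run (\<lambda>l. A e (tp l)) h c \<Longrightarrow> represents q h \<Longrightarrow> A g c = Some r \<Longrightarrow>
      (\<And>l z. apps A M [M, g, e, q, tp l] = Some z \<Longrightarrow> A e' (tp (h @ l)) = Some z) \<Longrightarrow>
      run (\<lambda>l. A e' (tp l)) h c'" for h c q
    proof (induction arbitrary: q rule: run.induct)
      case (halt h c)
      have "run (\<lambda>l. A e' (tp l)) (h @ []) c'"
      proof (rule run_shift)
        show "run (\<lambda>l. A r (tp l)) [] c'" using r(2) by (simp add: halts_def)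
        fix l z assume z: "A r (tp l) = Some z"
        show "A e' (tp (h @ l)) = Some z"
        proof (rule halt.prems(3), rule M(2)[rule_format], simp)
          show "ev (env [M, g, e, q, tp l]) bindT = Some z"
            by (rule eval_bindT_halt[of _ h c r]) (use halt z in simp_all)
        qed
      qed
      then show ?case by simp
    next
      case (query h d a c)
      let ?\<rho> = "\<lambda>l. env [M, g, e, q, l]"
      have "A e' (tp (h @ [])) = Some (pair F d)"
      proof (rule query.prems(3), rule M(2)[rule_format], simp)
        show "ev (?\<rho> (tp [])) bindT = Some (pair F d)"
          by (rule eval_bindT_ask[of _ h]) (use query in simp_all)
      qed
      moreover have "run (\<lambda>l. A e' (tp l)) (h @ [a]) c'"
      proof (rule query.IH[OF represents_snc[OF query.prems(1)] query.prems(2)])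
        fix l z assume z: "apps A M [M, g, e, snc q a, tp l] = Some z"
        have "A e' (tp (h @ (a # l))) = Some z"
        proof (rule query.prems(3), rule M(2)[rule_format], simp)
          show "ev (?\<rho> (tp (a # l))) bindT = Some z"
            by (rule eval_bindT_step[of _ h d a l]) (use query z in simp_all)
        qed
        then show "A e' (tp ((h @ [a]) @ l)) = Some z" by simp
      qed
      ultimately show ?case using query.hyps(2) run.query[of "\<lambda>l. A e' (tp l)" h] by simp
    qed
    have "run (\<lambda>l. A e' (tp l)) [] c'"
      by (rule sim[OF _ i r(1)]) (use that(2) t' in \<open>simp_all add: halts_def\<close>)
    then show ?thesis by (simp add: halts_def)
  qed
  have "\<exists>Bg. A B g = Some Bg \<and> (\<forall>e. \<exists>e'. A Bg e = Some e' \<and>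
      (\<forall>c r c'. halts e c \<longrightarrow> A g c = Some r \<longrightarrow> halts r c' \<longrightarrow> halts e' c'))" for g
  proof -
    obtain Bg where Bg: "A B g = Some Bg"
      "\<And>e z. ev (env [g, e]) ?B = Some z \<Longrightarrow> A Bg e = Some z"
      using B by blast
    have "\<exists>e'. A Bg e = Some e' \<and>
      (\<forall>c r c'. halts e c \<longrightarrow> A g c = Some r \<longrightarrow> halts r c' \<longrightarrow> halts e' c')" for e
    proof -
      obtain e' where e': "apps A M [M, g, e, i] = Some e'"
        using M(1)[rule_format, of "[M, g, e, i]"] by auto
      then have "A Bg e = Some e'" by (intro Bg(2)) simp
      then show ?thesis using main[OF e'] by blast
    qed
    then show ?thesis using Bg(1) by blast
  qed
  then show ?thesis by blast
qed

text \<open>Unit and bind suffice: multiplication is bind with the identity as continuation, and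
  functoriality along \<open>g\<close> is bind with \<open>u\<close> after \<open>g\<close>.\<close>

lemma local_operator_K: "local_operator A K"
proof -
  obtain u where u: "\<forall>c. \<exists>e. A u c = Some e \<and> halts e c" using ex_unit by blast
  obtain B where B: "\<forall>g. \<exists>Bg. A B g = Some Bg \<and>
   (\<forall>e. \<exists>e'. A Bg e = Some e' \<and>
      (\<forall>c r c'. halts e c \<longrightarrow> A g c = Some r \<longrightarrow> halts r c' \<longrightarrow> halts e' c'))"
    using ex_bind by blast
  obtain i where i: "\<And>x. A i x = Some x" using ex_lam1[of "Var 0"] by auto
  have "u \<in> imp A V (K V)" for V using u by (fastforce simp: imp_def K_def)
  moreover
  obtain Bi where "A B i = Some Bi" "\<And>e. \<exists>e'. A Bi e = Some e' \<and>
      (\<forall>c r c'. halts e c \<longrightarrow> A i c = Some r \<longrightarrow> halts r c' \<longrightarrow> halts e' c')"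
    using B by blast
  then have "Bi \<in> imp A (K (K V)) (K V)" for V using i by (fastforce simp: imp_def K_def)
  moreover have "\<exists>m. \<forall>V W. m \<in> imp A (imp A V W) (imp A (K V) (K W))"
  proof -
    let ?t = "App (Cst u) (App (Var 0) (Var 1))"
    obtain T where T: "\<forall>x. \<exists>b. A T x = Some b \<and>
      (\<forall>y z. ev (env [x, y]) ?t = Some z \<longrightarrow> A b y = Some z)"
      using ex_lam2[of ?t] by blast
    let ?m = "App (Cst B) (App (Cst T) (Var 0))"
    obtain m where m: "\<And>x z. ev (env [x]) ?m = Some z \<Longrightarrow> A m x = Some z"
      using ex_lam1[of ?m] by blast
    have "\<exists>y\<in>imp A (K V) (K W). A m g = Some y" if g: "g \<in> imp A V W" for V W g
    proof -
      obtain b where b: "A T g = Some b" "\<And>y z. ev (env [g, y]) ?t = Some z \<Longrightarrow> A b y = Some z"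
        using T by blast
      obtain Bb where Bb: "A B b = Some Bb" "\<And>e. \<exists>e'. A Bb e = Some e' \<and>
        (\<forall>c r c'. halts e c \<longrightarrow> A b c = Some r \<longrightarrow> halts r c' \<longrightarrow> halts e' c')"
        using B by blast
      have "\<exists>r w. w \<in> W \<and> A b c = Some r \<and> halts r w" if c: "c \<in> V" for c
      proof -
        obtain w where w: "w \<in> W" "A g c = Some w" using impE[OF g c] .
        obtain r where r: "A u w = Some r" "halts r w" using u by blast
        have "A b c = Some r" by (rule b(2)) (use w r in simp)
        then show ?thesis using w r by blast
      qed
      then have "Bb \<in> imp A (K V) (K W)" using Bb(2) by (fastforce simp: imp_def K_def)
      moreover have "A m g = Some Bb" by (rule m) (use b Bb in simp)
      ultimately show ?thesis by blast
    qed
    then have "m \<in> imp A (imp A V W) (imp A (K V) (K W))" for V W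
      unfolding imp_iff[of m] by (intro ballI)
    then show ?thesis by blast
  qed
  ultimately show ?thesis by (blast intro: local_operatorI)
qed

text \<open>The queries of \<open>e\<close> are answered by \<open>q\<close>, and the answers are combined by the extension operation
  \<open>B\<close> of a local operator with unit \<open>u\<close>. The variables \<open>0, 1, 2\<close> stand for the procedure itself,
  \<open>e\<close> and the answers already obtained.\<close>

definition leastT :: "'a \<Rightarrow> 'a \<Rightarrow> 'a \<Rightarrow> 'a tm" where
  "leastT u B q = ite (fstT (answer 1 2)) (App (Cst u) (sndT (answer 1 2)))
     (App (App (Cst B) (lm 50 (App (App (App (Var 0) (Var 0)) (Var 1)) (snocT 2 (Var 50)))))
        (App (Cst q) (sndT (answer 1 2))))"

text \<open>The assumption on \<open>q\<close> turns a query into a \<open>J\<close>-realizer of its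
  answer. Self-application, as in \<open>ex_bind\<close>, chains these realizers, and the induction
  follows the dialogue that actually takes place.\<close>

lemma K_least:
  assumes J: "local_operator A J"
    and q: "\<And>b c. f b = Some c \<Longrightarrow> \<exists>e\<in>J {c}. A q b = Some e"
  shows "le_operator A K J"
proof -
  obtain u j m where u': "\<forall>V. u \<in> imp A V (J V)" and j': "\<forall>V. j \<in> imp A (J (J V)) (J V)"
    and m': "\<forall>V W. m \<in> imp A (imp A V W) (imp A (J V) (J W))"
    using local_operatorD[OF J] by (elim exE conjE)
  have u: "\<exists>e\<in>J V. A u c = Some e" if "c \<in> V" for V c
    using u' that unfolding imp_iff by blast
  have j: "\<exists>e\<in>J V. A j c = Some e" if "c \<in> J (J V)" for V c
    using j' that unfolding imp_iff by blast
  have m: "\<exists>e\<in>imp A (J V) (J W). A m g = Some e" if "g \<in> imp A V W" for V W g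
    using m'[rule_format, of V W] that unfolding imp_iff[of m] by blast
  let ?t = "App (Cst j) (App (App (Cst m) (Var 0)) (Var 1))"
  obtain B where B: "\<forall>x. \<exists>b. A B x = Some b \<and>
      (\<forall>y z. ev (env [x, y]) ?t = Some z \<longrightarrow> A b y = Some z)"
    using ex_lam2[of ?t] by blast
  have bind: "\<exists>b. A B g = Some b \<and> (\<exists>z\<in>J W. A b e = Some z)"
    if g: "g \<in> imp A V (J W)" and e: "e \<in> J V" for g e V W
  proof -
    obtain g' where g': "A m g = Some g'" "g' \<in> imp A (J V) (J (J W))" using m g by blast
    obtain w where w: "w \<in> J (J W)" "A g' e = Some w" using impE[OF g'(2) e] .
    then obtain z where z: "A j w = Some z" "z \<in> J W" using j by blast
    obtain b where b: "A B g = Some b" "\<And>y z. ev (env [g, y]) ?t = Some z \<Longrightarrow> A b y = Some z"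
      using B by blast
    have "A b e = Some z" by (rule b(2)) (use g' w z in simp)
    then show ?thesis using b z by blast
  qed
  obtain N where N: "\<And>xs z. length xs = 3 \<Longrightarrow> ev (env xs) (leastT u B q) = Some z \<Longrightarrow>
      apps A N xs = Some z"
    using ex_lams[of 3 "leastT u B q"] by blast
  obtain i where i: "represents i []" using ex_represents_Nil by blast
  have main: "run (\<lambda>l. A e (tp l)) h c \<Longrightarrow> represents r h \<Longrightarrow> c \<in> V \<Longrightarrow>
    \<exists>y\<in>J V. apps A N [N, e, r] = Some y" for e h c r V
  proof (induction arbitrary: r rule: run.induct)
    case (halt h c)
    obtain y where y: "y \<in> J V" "A u c = Some y" using u halt.prems by blast
    have "apps A N [N, e, r] = Some y"
    proof (rule N, simp)
      show "ev (env [N, e, r]) (leastT u B q) = Some y"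
        unfolding leastT_def
        by (rule eval_ite(1)) (use halt y in \<open>simp_all add: represents_def\<close>)
    qed
    then show ?case using y by blast
  next
    case (query h d a c)
    obtain d' where d': "d' \<in> J {a}" "A q d = Some d'" using q[OF query.hyps(2)] by blast
    obtain y where y: "y \<in> J V" "apps A N [N, e, snc r a] = Some y"
      using query.IH[OF represents_snc[OF query.prems(1)] query.prems(2)] by blast
    \<comment> \<open>The abstraction over \<open>50\<close> stands in a branch of
      \<open>ite\<close>, hence is evaluated with the dummy \<open>99\<close> set to
      \<open>k\<close>; \<open>50\<close> differs from this dummy and from the variables of the
      procedure.\<close>
    let ?\<rho> = "(env [N, e, r])(99 := k)"
    let ?s = "App (App (App (Var 0) (Var 0)) (Var 1)) (snocT 2 (Var 50))"
    obtain g where g: "ev ?\<rho> (lm 50 ?s) = Some g" using eval_lam_Some by blast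
    have "ev (?\<rho>(50 := a)) (snocT 2 (Var 50)) = Some (snc r a)" by simp
    then have "ev (?\<rho>(50 := a)) ?s = Some y"
      using y(2) by (simp add: bind_eq_Some_conv)
    then have "A g a = Some y" by (rule eval_lam_app[OF g])
    \<comment> \<open>The oracle has the single answer \<open>a\<close> to this query, so the
      continuation has to succeed at \<open>a\<close> alone, and the induction hypothesis is
      enough.\<close>
    then have "g \<in> imp A {a} (J V)" using y(1) by (simp add: imp_def)
    then obtain b z where z: "A B g = Some b" "z \<in> J V" "A b d' = Some z"
      using bind d'(1) by blast
    have "apps A N [N, e, r] = Some z"
    proof (rule N, simp)
      show "ev (env [N, e, r]) (leastT u B q) = Some z"
        unfolding leastT_def
      proof (rule eval_ite(2), goal_cases)
        case 1 show ?case using query by (simp add: represents_def)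
      next
        case 2
        have d: "ev ?\<rho> (App (Cst q) (sndT (answer 1 2))) = Some d'"
          using query d' by (simp add: represents_def)
        show ?case
          unfolding eval.simps(3)[of _ _ "App (Cst B) _"] eval.simps(3)[of _ _ "Cst B"] d g
          by (simp add: z)
      qed
    qed
    then show ?case using z by blast
  qed
  let ?t = "App (App (App (Cst N) (Cst N)) (Var 0)) (Cst i)"
  obtain n where n: "\<And>x z. ev (env [x]) ?t = Some z \<Longrightarrow> A n x = Some z"
    using ex_lam1[of ?t] by blast
  have "\<exists>y\<in>J V. A n e = Some y" if e: "e \<in> K V" for e V
  proof -
    obtain c where "c \<in> V" "run (\<lambda>l. A e (tp l)) [] c"
      using e unfolding K_def halts_def by blast
    then obtain y where y: "y \<in> J V" "apps A N [N, e, i] = Some y" using main[OF _ i] by blast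
    have "A n e = Some y" by (rule n) (use y in simp)
    then show ?thesis using y by blast
  qed
  then have "n \<in> (\<Inter>V. imp A (K V) (J V))" by (simp add: imp_def)
  then show ?thesis unfolding le_operator_def by blast
qed

end

section \<open>Truth at a stage\<close>

text \<open>The indices of a stage are pairs of lists: the first component makes room for index sets of
  any number of variables, the second for additional realizers.\<close>

type_synonym ('u, 'a) stage = "'u list \<times> 'a list \<Rightarrow> 'a option"
type_synonym ('u, 'a) element = "'u list \<times> 'a list \<Rightarrow> 'u"

text \<open>With the stage viewed as a partitioned assembly, this is entailment from its existence
  predicate, the singleton of the realizer at each index, to \<open>\<phi>\<close>.\<close>

definition holds :: "'a papp \<Rightarrow> ('u, 'a) stage \<Rightarrow> ('u list \<times> 'a list \<Rightarrow> 'a set) \<Rightarrow> bool" where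
  "holds A \<Gamma> \<phi> \<longleftrightarrow> (\<exists>r. \<forall>c x. \<Gamma> c = Some x \<longrightarrow> (\<exists>y\<in>\<phi> c. A r x = Some y))"

text \<open>Elements are total functions of which only the values on the domain of the stage count;
  hence the congruence lemmas.\<close>

definition els :: "('u, 'a) stage \<Rightarrow> 'i set \<Rightarrow> ('u list \<times> 'a list \<Rightarrow> 'i) set" where
  "els \<Gamma> S = {x. \<forall>c\<in>dom \<Gamma>. x c \<in> S}"

definition ex :: "'a papp \<Rightarrow> ('u, 'a) stage \<Rightarrow> ('u, 'a) rtobj \<Rightarrow> ('u, 'a) element \<Rightarrow> bool" where
  "ex A \<Gamma> X x \<longleftrightarrow> x \<in> els \<Gamma> (Car X) \<and> holds A \<Gamma> (\<lambda>c. Ex X (x c))"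

definition rel :: "'a papp \<Rightarrow> ('u, 'a) stage \<Rightarrow> ('u, 'a) rtobj \<Rightarrow> ('u, 'a) rtobj \<Rightarrow>
    ('u \<Rightarrow> 'u \<Rightarrow> 'a set) \<Rightarrow> ('u, 'a) element \<Rightarrow> ('u, 'a) element \<Rightarrow> bool" where
  "rel A \<Gamma> X Y R x y \<longleftrightarrow>
     x \<in> els \<Gamma> (Car X) \<and> y \<in> els \<Gamma> (Car Y) \<and> holds A \<Gamma> (\<lambda>c. R (x c) (y c))"

abbreviation eq where "eq A \<Gamma> X \<equiv> rel A \<Gamma> X X (Eq X)"

lemma holds_cong:
  "(\<And>c. c \<in> dom \<Gamma> \<Longrightarrow> \<phi> c = \<psi> c) \<Longrightarrow> holds A \<Gamma> \<phi> \<longleftrightarrow> holds A \<Gamma> \<psi>"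
  unfolding holds_def by (metis domI)

lemma holds_mono:
  "holds A \<Gamma> \<phi> \<Longrightarrow> (\<And>c. c \<in> dom \<Gamma> \<Longrightarrow> \<phi> c \<subseteq> \<psi> c) \<Longrightarrow> holds A \<Gamma> \<psi>"
  unfolding holds_def by (metis domI subsetD)

lemma holds_nonempty: "holds A \<Gamma> \<phi> \<Longrightarrow> c \<in> dom \<Gamma> \<Longrightarrow> \<phi> c \<noteq> {}"
  unfolding holds_def by fastforce

lemma els_cong: "(\<And>c. c \<in> dom \<Gamma> \<Longrightarrow> x c = x' c) \<Longrightarrow> x \<in> els \<Gamma> S \<longleftrightarrow> x' \<in> els \<Gamma> S"
  by (auto simp: els_def)

lemma rel_cong:
  assumes "\<And>c. c \<in> dom \<Gamma> \<Longrightarrow> x c = x' c" "\<And>c. c \<in> dom \<Gamma> \<Longrightarrow> y c = y' c"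
  shows "rel A \<Gamma> X Y R x y \<longleftrightarrow> rel A \<Gamma> X Y R x' y'"
proof -
  have "holds A \<Gamma> (\<lambda>c. R (x c) (y c)) \<longleftrightarrow> holds A \<Gamma> (\<lambda>c. R (x' c) (y' c))"
    by (rule holds_cong) (simp add: assms)
  then show ?thesis
    unfolding rel_def using els_cong[of \<Gamma> x x'] els_cong[of \<Gamma> y y'] assms by blast
qed

text \<open>An existential is witnessed by a choice of elements over the same stage: the realizer fixes
  the witness at every index.\<close>

lemma holds_UN:
  "holds A \<Gamma> (\<lambda>c. \<Union>y\<in>S. \<phi> c y) \<longleftrightarrow> (\<exists>y\<in>els \<Gamma> S. holds A \<Gamma> (\<lambda>c. \<phi> c (y c)))"
proof
  assume "holds A \<Gamma> (\<lambda>c. \<Union>y\<in>S. \<phi> c y)"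
  then obtain r where r: "\<And>c x. \<Gamma> c = Some x \<Longrightarrow> \<exists>z\<in>(\<Union>y\<in>S. \<phi> c y). A r x = Some z"
    unfolding holds_def by blast
  define y where "y c = (SOME y. y \<in> S \<and> (\<exists>z\<in>\<phi> c y. A r (the (\<Gamma> c)) = Some z))" for c
  have y: "y c \<in> S \<and> (\<exists>z\<in>\<phi> c (y c). A r x = Some z)" if "\<Gamma> c = Some x" for c x
  proof -
    have "\<exists>y. y \<in> S \<and> (\<exists>z\<in>\<phi> c y. A r (the (\<Gamma> c)) = Some z)"
      using r[OF that] that by auto
    from someI_ex[OF this] show ?thesis using that by (simp add: y_def)
  qed
  have "y \<in> els \<Gamma> S" using y by (auto simp: els_def)
  moreover have "holds A \<Gamma> (\<lambda>c. \<phi> c (y c))" unfolding holds_def using y by blast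
  ultimately show "\<exists>y\<in>els \<Gamma> S. holds A \<Gamma> (\<lambda>c. \<phi> c (y c))" by blast
next
  assume "\<exists>y\<in>els \<Gamma> S. holds A \<Gamma> (\<lambda>c. \<phi> c (y c))"
  then obtain y where "y \<in> els \<Gamma> S" "holds A \<Gamma> (\<lambda>c. \<phi> c (y c))" by blast
  then show "holds A \<Gamma> (\<lambda>c. \<Union>y\<in>S. \<phi> c y)"
    by (elim holds_mono) (auto simp: els_def)
qed

definition stage_obj :: "'a papp \<Rightarrow> ('u, 'a) rtobj \<Rightarrow> bool" where
  "stage_obj A X \<longleftrightarrow> (\<forall>\<Gamma>.
     (\<forall>x y. eq A \<Gamma> X x y \<longrightarrow> ex A \<Gamma> X x \<and> ex A \<Gamma> X y) \<and>
     (\<forall>x. ex A \<Gamma> X x \<longrightarrow> eq A \<Gamma> X x x) \<and>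
     (\<forall>x y. eq A \<Gamma> X x y \<longrightarrow> eq A \<Gamma> X y x) \<and>
     (\<forall>x y z. eq A \<Gamma> X x y \<longrightarrow> eq A \<Gamma> X y z \<longrightarrow> eq A \<Gamma> X x z))"

definition stage_fun ::
  "'a papp \<Rightarrow> ('u, 'a) rtobj \<Rightarrow> ('u, 'a) rtobj \<Rightarrow> ('u \<Rightarrow> 'u \<Rightarrow> 'a set) \<Rightarrow> bool" where
  "stage_fun A X Y F \<longleftrightarrow> (\<forall>\<Gamma>.
     (\<forall>x y. rel A \<Gamma> X Y F x y \<longrightarrow> ex A \<Gamma> X x \<and> ex A \<Gamma> Y y) \<and>
     (\<forall>x x' y y'. eq A \<Gamma> X x x' \<longrightarrow> rel A \<Gamma> X Y F x y \<longrightarrow> eq A \<Gamma> Y y y' \<longrightarrow> rel A \<Gamma> X Y F x' y') \<and>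
     (\<forall>x y y'. rel A \<Gamma> X Y F x y \<longrightarrow> rel A \<Gamma> X Y F x y' \<longrightarrow> eq A \<Gamma> Y y y') \<and>
     (\<forall>x. ex A \<Gamma> X x \<longrightarrow> (\<exists>y. rel A \<Gamma> X Y F x y)))"

definition rcomp :: "'a papp \<Rightarrow> ('u, 'a) rtobj \<Rightarrow> ('u \<Rightarrow> 'u \<Rightarrow> 'a set) \<Rightarrow> ('u \<Rightarrow> 'u \<Rightarrow> 'a set) \<Rightarrow>
    'u \<Rightarrow> 'u \<Rightarrow> 'a set" where
  "rcomp A Y F G = (\<lambda>x z. \<Union>y\<in>Car Y. meet A (F x y) (G y z))"

text \<open>Identity, composition and pairing of realizers are what entailment, conjunction and
  existential quantification rest on. The locale is interpreted twice: for \<open>A\<close> and, by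
  way of dialogues, for \<open>A[f]\<close>.\<close>

locale realizability_logic =
  fixes A :: "'a papp"
  assumes app_id: "\<exists>i. \<forall>x. A i x = Some x"
    and app_comp: "\<exists>t. \<forall>x y z. A r x = Some y \<longrightarrow> A r' y = Some z \<longrightarrow> A t x = Some z"
    and app_pair: "\<exists>t. \<forall>x y z w. A r x = Some y \<longrightarrow> A r' x = Some z \<longrightarrow> ap2 A p y z = Some w \<longrightarrow>
      A t x = Some w"
    and ex_pairing: "\<exists>p p0 p1. pairing A p p0 p1"
begin

lemma holds_compose:
  assumes "\<And>c x. \<Gamma> c = Some x \<Longrightarrow> \<exists>y. A r x = Some y \<and> (\<exists>z\<in>\<phi> c. A r' y = Some z)"
  shows "holds A \<Gamma> \<phi>"
proof -
  obtain t where "\<And>x y z. A r x = Some y \<Longrightarrow> A r' y = Some z \<Longrightarrow> A t x = Some z"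
    using app_comp by blast
  then show ?thesis unfolding holds_def using assms by (intro exI[of _ t]) blast
qed

lemma holds_UNIV: "(\<And>c. c \<in> dom \<Gamma> \<Longrightarrow> \<phi> c = UNIV) \<Longrightarrow> holds A \<Gamma> \<phi>"
  unfolding holds_def using app_id by (metis UNIV_I domI)

text \<open>\<open>meet\<close> uses an arbitrarily chosen pairing, possibly unrelated ones for
  \<open>A\<close> and for \<open>A[f]\<close>. At stages the choice becomes invisible, because
  every pairing comes with projections.\<close>

lemma holds_meet: "holds A \<Gamma> (\<lambda>c. meet A (\<phi> c) (\<psi> c)) \<longleftrightarrow> holds A \<Gamma> \<phi> \<and> holds A \<Gamma> \<psi>"
proof -
  define p where "p = (SOME p. \<exists>p0 p1. pairing A p p0 p1)"
  obtain p0 p1 where p: "pairing A p p0 p1"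
    using someI_ex[OF ex_pairing] unfolding p_def by blast
  have meet: "meet A V W = {c. \<exists>v\<in>V. \<exists>w\<in>W. ap2 A p v w = Some c}" for V W
    by (simp add: meet_def p_def)
  have proj: "A p0 c = Some a \<and> A p1 c = Some b" if "ap2 A p a b = Some c" for a b c
    using p that unfolding pairing_def by (metis option.inject)
  show ?thesis
  proof (intro iffI conjI)
    assume "holds A \<Gamma> (\<lambda>c. meet A (\<phi> c) (\<psi> c))"
    then obtain r where r: "\<And>c x. \<Gamma> c = Some x \<Longrightarrow> \<exists>y\<in>meet A (\<phi> c) (\<psi> c). A r x = Some y"
      unfolding holds_def by blast
    have *: "\<exists>y. A r x = Some y \<and> (\<exists>z\<in>\<phi> c. A p0 y = Some z) \<and> (\<exists>z\<in>\<psi> c. A p1 y = Some z)"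
      if x: "\<Gamma> c = Some x" for c x
    proof -
      obtain y v w where "A r x = Some y" "v \<in> \<phi> c" "w \<in> \<psi> c" "ap2 A p v w = Some y"
        using r[OF x] unfolding meet by blast
      then show ?thesis using proj[of v w y] by blast
    qed
    show "holds A \<Gamma> \<phi>" by (rule holds_compose[of _ r _ p0]) (use * in fast)
    show "holds A \<Gamma> \<psi>" by (rule holds_compose[of _ r _ p1]) (use * in fast)
  next
    assume "holds A \<Gamma> \<phi> \<and> holds A \<Gamma> \<psi>"
    then obtain r r' where r: "\<And>c x. \<Gamma> c = Some x \<Longrightarrow> \<exists>y\<in>\<phi> c. A r x = Some y"
      and r': "\<And>c x. \<Gamma> c = Some x \<Longrightarrow> \<exists>y\<in>\<psi> c. A r' x = Some y"
      unfolding holds_def by blast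
    obtain t where t: "\<And>x y z w. A r x = Some y \<Longrightarrow> A r' x = Some z \<Longrightarrow> ap2 A p y z = Some w \<Longrightarrow>
      A t x = Some w" using app_pair by blast
    have "\<exists>y\<in>meet A (\<phi> c) (\<psi> c). A t x = Some y" if x: "\<Gamma> c = Some x" for c x
    proof -
      obtain y y' where y: "y \<in> \<phi> c" "A r x = Some y" "y' \<in> \<psi> c" "A r' x = Some y'"
        using r r' x by blast
      obtain w where w: "ap2 A p y y' = Some w" using p unfolding pairing_def by blast
      have "A t x = Some w" using t y w by blast
      moreover have "w \<in> meet A (\<phi> c) (\<psi> c)" using y w unfolding meet by blast
      ultimately show ?thesis by blast
    qed
    then show "holds A \<Gamma> (\<lambda>c. meet A (\<phi> c) (\<psi> c))" unfolding holds_def by blast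
  qed
qed

lemma holds_entails:
  assumes "entails A I \<phi> \<psi>" "\<And>c. c \<in> dom \<Gamma> \<Longrightarrow> j c \<in> I" "holds A \<Gamma> (\<lambda>c. \<phi> (j c))"
  shows "holds A \<Gamma> (\<lambda>c. \<psi> (j c))"
proof -
  obtain r' where "r' \<in> (\<Inter>i\<in>I. imp A (\<phi> i) (\<psi> i))"
    using assms(1) unfolding entails_def ex_in_conv[symmetric] by (rule exE)
  then have r': "\<exists>y\<in>\<psi> i. A r' x = Some y" if "i \<in> I" "x \<in> \<phi> i" for i x
    using that by (simp add: imp_def)
  obtain r where r: "\<forall>c x. \<Gamma> c = Some x \<longrightarrow> (\<exists>y\<in>\<phi> (j c). A r x = Some y)"
    using assms(3) unfolding holds_def by (rule exE)
  show ?thesis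
  proof (rule holds_compose[of _ r _ r'])
    fix c x assume x: "\<Gamma> c = Some x"
    then obtain y where "y \<in> \<phi> (j c)" "A r x = Some y" using r by fast
    moreover have "j c \<in> I" using assms(2) x by (simp add: domI)
    ultimately show "\<exists>y. A r x = Some y \<and> (\<exists>z\<in>\<psi> (j c). A r' y = Some z)" using r' by fast
  qed
qed

text \<open>The generic stage: its indices are pairs of an index and a realizer of the premise.\<close>

lemma entails_iff:
  fixes enc :: "'i \<Rightarrow> 'u list" and I :: "'i set"
  assumes enc: "inj enc"
  shows "entails A I \<phi> \<psi> \<longleftrightarrow> (\<forall>\<Gamma> :: ('u, 'a) stage. \<forall>j\<in>els \<Gamma> I.
    holds A \<Gamma> (\<lambda>c. \<phi> (j c)) \<longrightarrow> holds A \<Gamma> (\<lambda>c. \<psi> (j c)))" (is "_ \<longleftrightarrow> ?R")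
proof
  assume e: "entails A I \<phi> \<psi>"
  show ?R by (intro allI ballI impI) (rule holds_entails[OF e], simp_all add: els_def)
next
  assume R: ?R
  let ?j = "\<lambda>c :: 'u list \<times> 'a list. inv enc (fst c)"
  define \<Gamma> :: "('u, 'a) stage" where
    "\<Gamma> c = (if \<exists>i\<in>I. \<exists>a\<in>\<phi> i. c = (enc i, [a]) then Some (hd (snd c)) else None)" for c
  have \<Gamma>: "\<Gamma> c = Some x \<longleftrightarrow> (\<exists>i\<in>I. x \<in> \<phi> i \<and> c = (enc i, [x]))" for c x
    by (auto simp: \<Gamma>_def)
  have j: "?j c \<in> I \<and> x \<in> \<phi> (?j c)" if "\<Gamma> c = Some x" for c x
    using that enc by (auto simp: \<Gamma>)
  obtain t where t: "\<And>x. A t x = Some x" using app_id by blast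
  have "holds A \<Gamma> (\<lambda>c. \<phi> (?j c))"
    unfolding holds_def
  proof (intro exI[of _ t] allI impI)
    fix c x assume "\<Gamma> c = Some x"
    then show "\<exists>y\<in>\<phi> (?j c). A t x = Some y" using j t by simp
  qed
  moreover have "?j \<in> els \<Gamma> I" using j by (auto simp: els_def)
  ultimately have "holds A \<Gamma> (\<lambda>c. \<psi> (?j c))" using R[THEN spec, of \<Gamma>, THEN bspec, of ?j] by simp
  then obtain r where r: "\<forall>c x. \<Gamma> c = Some x \<longrightarrow> (\<exists>y\<in>\<psi> (?j c). A r x = Some y)"
    unfolding holds_def by (rule exE)
  have "\<exists>y\<in>\<psi> i. A r x = Some y" if "i \<in> I" "x \<in> \<phi> i" for i x
  proof -
    have "\<Gamma> (enc i, [x]) = Some x" using that by (auto simp: \<Gamma>)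
    from r[rule_format, OF this] show ?thesis using enc by simp
  qed
  then have "r \<in> (\<Inter>i\<in>I. imp A (\<phi> i) (\<psi> i))" by (simp add: imp_def)
  then show "entails A I \<phi> \<psi>" unfolding entails_def by blast
qed

lemma all_els_Times:
  "(\<forall>j\<in>els \<Gamma> (S \<times> T). P j) \<longleftrightarrow> (\<forall>x\<in>els \<Gamma> S. \<forall>y\<in>els \<Gamma> T. P (\<lambda>c. (x c, y c)))"
proof
  assume R: "\<forall>x\<in>els \<Gamma> S. \<forall>y\<in>els \<Gamma> T. P (\<lambda>c. (x c, y c))"
  show "\<forall>j\<in>els \<Gamma> (S \<times> T). P j"
  proof
    fix j assume "j \<in> els \<Gamma> (S \<times> T)"
    then have "(\<lambda>c. fst (j c)) \<in> els \<Gamma> S" "(\<lambda>c. snd (j c)) \<in> els \<Gamma> T"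
      by (auto simp: els_def mem_Times_iff)
    from R[rule_format, OF this] have "P (\<lambda>c. (fst (j c), snd (j c)))" .
    then show "P j" by simp
  qed
qed (simp add: els_def)

lemma entails1: "entails A S \<phi> \<psi> \<longleftrightarrow> (\<forall>\<Gamma> :: ('u, 'a) stage. \<forall>x\<in>els \<Gamma> S.
    holds A \<Gamma> (\<lambda>c. \<phi> (x c)) \<longrightarrow> holds A \<Gamma> (\<lambda>c. \<psi> (x c)))" for S :: "'u set"
proof -
  have "inj (\<lambda>x :: 'u. [x])" by (rule injI) simp
  from entails_iff[OF this] show ?thesis .
qed

lemma entails2: "entails A (S \<times> T) (\<lambda>(x, y). \<phi> x y) (\<lambda>(x, y). \<psi> x y) \<longleftrightarrow>
   (\<forall>\<Gamma> :: ('u, 'a) stage. \<forall>x\<in>els \<Gamma> S. \<forall>y\<in>els \<Gamma> T.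
      holds A \<Gamma> (\<lambda>c. \<phi> (x c) (y c)) \<longrightarrow> holds A \<Gamma> (\<lambda>c. \<psi> (x c) (y c)))"
  for S T :: "'u set"
proof -
  have "inj (\<lambda>(x :: 'u, y). [x, y])" by (rule injI) auto
  from entails_iff[OF this] show ?thesis by (simp only: all_els_Times prod.case)
qed

lemma entails3: "entails A (S \<times> T \<times> V) (\<lambda>(x, y, z). \<phi> x y z) (\<lambda>(x, y, z). \<psi> x y z) \<longleftrightarrow>
   (\<forall>\<Gamma> :: ('u, 'a) stage. \<forall>x\<in>els \<Gamma> S. \<forall>y\<in>els \<Gamma> T. \<forall>z\<in>els \<Gamma> V.
      holds A \<Gamma> (\<lambda>c. \<phi> (x c) (y c) (z c)) \<longrightarrow> holds A \<Gamma> (\<lambda>c. \<psi> (x c) (y c) (z c)))"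
  for S T V :: "'u set"
proof -
  have "inj (\<lambda>(x :: 'u, y, z). [x, y, z])" by (rule injI) auto
  from entails_iff[OF this] show ?thesis by (simp only: all_els_Times prod.case)
qed

lemma entails4: "entails A (S \<times> T \<times> V \<times> W) (\<lambda>(x, y, z, w). \<phi> x y z w) (\<lambda>(x, y, z, w). \<psi> x y z w) \<longleftrightarrow>
   (\<forall>\<Gamma> :: ('u, 'a) stage. \<forall>x\<in>els \<Gamma> S. \<forall>y\<in>els \<Gamma> T. \<forall>z\<in>els \<Gamma> V. \<forall>w\<in>els \<Gamma> W.
      holds A \<Gamma> (\<lambda>c. \<phi> (x c) (y c) (z c) (w c)) \<longrightarrow>
      holds A \<Gamma> (\<lambda>c. \<psi> (x c) (y c) (z c) (w c)))"
  for S T V W :: "'u set"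
proof -
  have "inj (\<lambda>(x :: 'u, y, z, w). [x, y, z, w])" by (rule injI) auto
  from entails_iff[OF this] show ?thesis by (simp only: all_els_Times prod.case)
qed

lemma is_rtobj_iff: "is_rtobj U A X \<longleftrightarrow>
    Car X \<in> U \<and> (\<forall>x\<in>Car X. Ex X x \<noteq> {}) \<and> stage_obj A X"
proof -
  note defs = holds_meet ex_def rel_def
  have "entails A (Car X \<times> Car X) (\<lambda>(x, y). Eq X x y) (\<lambda>(x, y). meet A (Ex X x) (Ex X y)) \<longleftrightarrow>
      (\<forall>\<Gamma>. \<forall>x y. eq A \<Gamma> X x y \<longrightarrow> ex A \<Gamma> X x \<and> ex A \<Gamma> X y)"
    unfolding entails2 defs by blast
  moreover have "entails A (Car X) (Ex X) (\<lambda>x. Eq X x x) \<longleftrightarrow>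
      (\<forall>\<Gamma>. \<forall>x. ex A \<Gamma> X x \<longrightarrow> eq A \<Gamma> X x x)"
    unfolding entails1 defs by blast
  moreover have "entails A (Car X \<times> Car X) (\<lambda>(x, y). Eq X x y) (\<lambda>(x, y). Eq X y x) \<longleftrightarrow>
      (\<forall>\<Gamma>. \<forall>x y. eq A \<Gamma> X x y \<longrightarrow> eq A \<Gamma> X y x)"
    unfolding entails2 defs by blast
  moreover have "entails A (Car X \<times> Car X \<times> Car X)
       (\<lambda>(x, y, z). meet A (Eq X x y) (Eq X y z)) (\<lambda>(x, y, z). Eq X x z) \<longleftrightarrow>
      (\<forall>\<Gamma>. \<forall>x y z. eq A \<Gamma> X x y \<longrightarrow> eq A \<Gamma> X y z \<longrightarrow> eq A \<Gamma> X x z)"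
    unfolding entails3 defs by blast
  ultimately show ?thesis
    unfolding is_rtobj_def stage_obj_def by (simp only: all_conj_distrib)
qed

lemma is_funrel_iff: "is_funrel A X Y F \<longleftrightarrow> stage_fun A X Y F"
proof -
  note defs = holds_meet holds_UN ex_def rel_def
  have "entails A (Car X \<times> Car Y) (\<lambda>(x, y). F x y) (\<lambda>(x, y). meet A (Ex X x) (Ex Y y)) \<longleftrightarrow>
      (\<forall>\<Gamma>. \<forall>x y. rel A \<Gamma> X Y F x y \<longrightarrow> ex A \<Gamma> X x \<and> ex A \<Gamma> Y y)"
    unfolding entails2 defs by blast
  moreover have "entails A (Car X \<times> Car X \<times> Car Y \<times> Car Y)
       (\<lambda>(x, x', y, y'). meet A (Eq X x x') (meet A (F x y) (Eq Y y y')))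
       (\<lambda>(x, x', y, y'). F x' y') \<longleftrightarrow>
      (\<forall>\<Gamma>. \<forall>x x' y y'.
         eq A \<Gamma> X x x' \<longrightarrow> rel A \<Gamma> X Y F x y \<longrightarrow> eq A \<Gamma> Y y y' \<longrightarrow> rel A \<Gamma> X Y F x' y')"
    unfolding entails4 defs by blast
  moreover have "entails A (Car X \<times> Car Y \<times> Car Y)
       (\<lambda>(x, y, y'). meet A (F x y) (F x y')) (\<lambda>(x, y, y'). Eq Y y y') \<longleftrightarrow>
      (\<forall>\<Gamma>. \<forall>x y y'.
         rel A \<Gamma> X Y F x y \<longrightarrow> rel A \<Gamma> X Y F x y' \<longrightarrow> eq A \<Gamma> Y y y')"
    unfolding entails3 defs by blast
  moreover have "entails A (Car X) (Ex X) (\<lambda>x. \<Union>y\<in>Car Y. F x y) \<longleftrightarrow>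
      (\<forall>\<Gamma>. \<forall>x. ex A \<Gamma> X x \<longrightarrow> (\<exists>y. rel A \<Gamma> X Y F x y))"
    unfolding entails1 defs by blast
  ultimately show ?thesis
    unfolding is_funrel_def stage_fun_def by (simp only: all_conj_distrib)
qed

lemma same_rel_iff: "same_rel A X Y F G \<longleftrightarrow>
   (\<forall>\<Gamma>. rel A \<Gamma> X Y F = rel A \<Gamma> X Y G)"
  unfolding same_rel_def entails2 rel_def fun_eq_iff by blast

lemma rel_rcomp: "rel A \<Gamma> X Z (rcomp A Y F G) x z \<longleftrightarrow>
    (\<exists>y. rel A \<Gamma> X Y F x y \<and> rel A \<Gamma> Y Z G y z)"
  unfolding rcomp_def rel_def holds_UN holds_meet by blast

end

section \<open>The realizability topos\<close>

lemma
  assumes "stage_obj A X"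
  shows eq_ex: "eq A \<Gamma> X x y \<Longrightarrow> ex A \<Gamma> X x \<and> ex A \<Gamma> X y"
    and eq_refl: "ex A \<Gamma> X x \<Longrightarrow> eq A \<Gamma> X x x"
    and eq_sym: "eq A \<Gamma> X x y \<Longrightarrow> eq A \<Gamma> X y x"
    and eq_trans: "eq A \<Gamma> X x y \<Longrightarrow> eq A \<Gamma> X y z \<Longrightarrow> eq A \<Gamma> X x z"
proof -
  note X = assms[unfolded stage_obj_def, THEN spec, of \<Gamma>]
  show "eq A \<Gamma> X x y \<Longrightarrow> ex A \<Gamma> X x \<and> ex A \<Gamma> X y"
    and "ex A \<Gamma> X x \<Longrightarrow> eq A \<Gamma> X x x"
    and "eq A \<Gamma> X x y \<Longrightarrow> eq A \<Gamma> X y x"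
    and "eq A \<Gamma> X x y \<Longrightarrow> eq A \<Gamma> X y z \<Longrightarrow> eq A \<Gamma> X x z"
    using X by blast+
qed

lemma
  assumes "stage_fun A X Y F"
  shows fun_ex: "rel A \<Gamma> X Y F x y \<Longrightarrow> ex A \<Gamma> X x \<and> ex A \<Gamma> Y y"
    and fun_ext: "rel A \<Gamma> X Y F x y \<Longrightarrow> eq A \<Gamma> X x x' \<Longrightarrow> eq A \<Gamma> Y y y' \<Longrightarrow> rel A \<Gamma> X Y F x' y'"
    and fun_single: "rel A \<Gamma> X Y F x y \<Longrightarrow> rel A \<Gamma> X Y F x y' \<Longrightarrow> eq A \<Gamma> Y y y'"
    and fun_total: "ex A \<Gamma> X x \<Longrightarrow> \<exists>y. rel A \<Gamma> X Y F x y"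
proof -
  note F = assms[unfolded stage_fun_def, THEN spec, of \<Gamma>]
  show "rel A \<Gamma> X Y F x y \<Longrightarrow> ex A \<Gamma> X x \<and> ex A \<Gamma> Y y"
    and "rel A \<Gamma> X Y F x y \<Longrightarrow> eq A \<Gamma> X x x' \<Longrightarrow> eq A \<Gamma> Y y y' \<Longrightarrow> rel A \<Gamma> X Y F x' y'"
    and "rel A \<Gamma> X Y F x y \<Longrightarrow> rel A \<Gamma> X Y F x y' \<Longrightarrow> eq A \<Gamma> Y y y'"
    and "ex A \<Gamma> X x \<Longrightarrow> \<exists>y. rel A \<Gamma> X Y F x y"
    using F by blast+
qed

lemma fun_ext1: "stage_fun A X Y F \<Longrightarrow> stage_obj A Y \<Longrightarrow> rel A \<Gamma> X Y F x y \<Longrightarrow>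
    eq A \<Gamma> X x x' \<Longrightarrow> rel A \<Gamma> X Y F x' y"
  and fun_ext2: "stage_fun A X Y F \<Longrightarrow> stage_obj A X \<Longrightarrow> rel A \<Gamma> X Y F x y \<Longrightarrow>
    eq A \<Gamma> Y y y' \<Longrightarrow> rel A \<Gamma> X Y F x y'"
  by (meson fun_ex fun_ext eq_refl)+

lemma stage_objI:
  assumes "\<And>\<Gamma> x y. eq A \<Gamma> X x y \<Longrightarrow> ex A \<Gamma> X x"
    and "\<And>\<Gamma> x. ex A \<Gamma> X x \<Longrightarrow> eq A \<Gamma> X x x"
    and "\<And>\<Gamma> x y. eq A \<Gamma> X x y \<Longrightarrow> eq A \<Gamma> X y x"
    and "\<And>\<Gamma> x y z. eq A \<Gamma> X x y \<Longrightarrow> eq A \<Gamma> X y z \<Longrightarrow> eq A \<Gamma> X x z"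
  shows "stage_obj A X"
  unfolding stage_obj_def using assms by blast

lemma stage_funI:
  assumes "\<And>\<Gamma> x y. rel A \<Gamma> X Y F x y \<Longrightarrow> ex A \<Gamma> X x"
    and "\<And>\<Gamma> x y. rel A \<Gamma> X Y F x y \<Longrightarrow> ex A \<Gamma> Y y"
    and "\<And>\<Gamma> x x' y y'. rel A \<Gamma> X Y F x y \<Longrightarrow> eq A \<Gamma> X x x' \<Longrightarrow> eq A \<Gamma> Y y y' \<Longrightarrow>
      rel A \<Gamma> X Y F x' y'"
    and "\<And>\<Gamma> x y y'. rel A \<Gamma> X Y F x y \<Longrightarrow> rel A \<Gamma> X Y F x y' \<Longrightarrow> eq A \<Gamma> Y y y'"
    and "\<And>\<Gamma> x. ex A \<Gamma> X x \<Longrightarrow> \<exists>y. rel A \<Gamma> X Y F x y"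
  shows "stage_fun A X Y F"
  unfolding stage_fun_def using assms by blast

lemma RT_simps [simp]:
  "Ob (RT U A) = {X. is_rtobj U A X}"
  "Id (RT U A) X = rt_arr A X X (Eq X)"
  "Comp (RT U A) = rt_comp A"
  by (simp_all add: RT_def)

context realizability_logic
begin

lemma obj: "is_rtobj U A X \<Longrightarrow> stage_obj A X"
  by (simp add: is_rtobj_iff)

lemma Hom_RT: "m \<in> Hom (RT U A) X Y \<longleftrightarrow> (\<exists>F. m = rt_arr A X Y F \<and> stage_fun A X Y F)"
  by (auto simp: RT_def is_funrel_iff)

lemma Hom_RT_arr: "stage_fun A X Y F \<Longrightarrow> rt_arr A X Y F \<in> Hom (RT U A) X Y"
  unfolding Hom_RT by blast

lemma rt_arr_eq_iff: "rt_arr A X Y F = rt_arr A X Y G \<longleftrightarrow>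
    (\<forall>\<Gamma>. rel A \<Gamma> X Y F = rel A \<Gamma> X Y G)"
  unfolding rt_arr_def prod.inject same_rel_iff set_eq_iff mem_Collect_eq by metis

lemma stage_fun_cong:
  assumes "\<forall>\<Gamma>. rel A \<Gamma> X Y F = rel A \<Gamma> X Y G"
  shows "stage_fun A X Y F \<longleftrightarrow> stage_fun A X Y G"
  unfolding stage_fun_def assms[rule_format] ..

text \<open>Inclusion of functional relations is equality: an element has a value under the smaller
  relation, and single-valuedness of the larger one forces all its values to agree with that
  value.\<close>

lemma fun_le_eq:
  assumes "stage_fun A X Y F" "stage_fun A X Y G" "stage_obj A X"
    and le: "\<And>\<Gamma> x y. rel A \<Gamma> X Y F x y \<Longrightarrow> rel A \<Gamma> X Y G x y"
  shows "rel A \<Gamma> X Y F = rel A \<Gamma> X Y G"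
proof (intro ext iffI)
  fix x y assume G: "rel A \<Gamma> X Y G x y"
  then obtain y' where "rel A \<Gamma> X Y F x y'" using fun_ex[OF assms(2)] fun_total[OF assms(1)] by blast
  then show "rel A \<Gamma> X Y F x y" using G le fun_single[OF assms(2)] fun_ext2[OF assms(1,3)] by blast
qed (rule le)

lemma rt_arr_eqI:
  assumes "stage_fun A X Y F" "stage_fun A X Y G" "stage_obj A X"
    and "\<And>\<Gamma> x y. rel A \<Gamma> X Y F x y \<Longrightarrow> rel A \<Gamma> X Y G x y"
  shows "rt_arr A X Y F = rt_arr A X Y G"
  unfolding rt_arr_eq_iff using fun_le_eq[OF assms] by blast

lemma rt_comp_arr: "rt_comp A (rt_arr A Y Z G) (rt_arr A X Y F) = rt_arr A X Z (rcomp A Y F G)"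
proof -
  have *: "rel A \<Gamma> X Z (rcomp A Y F G) = rel A \<Gamma> X Z (rcomp A Y F' G')"
    if "rel A \<Gamma> X Y F = rel A \<Gamma> X Y F'" "rel A \<Gamma> Y Z G = rel A \<Gamma> Y Z G'"
    for \<Gamma> F' G'
    by (intro ext) (simp add: rel_rcomp that)
  have **: "same_rel A X Z (rcomp A Y F G) H"
    if "same_rel A X Y F F'" "same_rel A Y Z G G'" "same_rel A X Z (rcomp A Y F' G') H" for F' G' H
    using that unfolding same_rel_iff by (simp add: *[of _ F' G'])
  have "{H. \<exists>F'\<in>{F'. same_rel A X Y F F'}. \<exists>G'\<in>{G'. same_rel A Y Z G G'}. same_rel A X Z (rcomp A Y F' G') H} =
      {H. same_rel A X Z (rcomp A Y F G) H}" (is "?L = ?R")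
  proof (intro set_eqI iffI)
    fix H assume "H \<in> ?L"
    then show "H \<in> ?R" using ** by auto
  next
    fix H assume "H \<in> ?R"
    moreover have "same_rel A X Y F F" "same_rel A Y Z G G" by (simp_all add: same_rel_iff)
    ultimately show "H \<in> ?L" by auto
  qed
  then show ?thesis by (simp add: rt_comp_def rt_arr_def rcomp_def)
qed

lemma stage_fun_Eq: "stage_obj A X \<Longrightarrow> stage_fun A X X (Eq X)"
  by (rule stage_funI) (meson eq_ex eq_refl eq_sym eq_trans)+

lemma stage_fun_rcomp:
  assumes F: "stage_fun A X Y F" and G: "stage_fun A Y Z G"
    and X: "stage_obj A X" and Y: "stage_obj A Y" and Z: "stage_obj A Z"
  shows "stage_fun A X Z (rcomp A Y F G)"
proof (rule stage_funI; unfold rel_rcomp)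
  fix \<Gamma> x y y'
  assume "\<exists>z. rel A \<Gamma> X Y F x z \<and> rel A \<Gamma> Y Z G z y"
    "\<exists>z. rel A \<Gamma> X Y F x z \<and> rel A \<Gamma> Y Z G z y'"
  then show "eq A \<Gamma> Z y y'"
    using fun_single[OF F] fun_single[OF G] fun_ext1[OF G Z] by blast
next
  fix \<Gamma> x x' y y'
  assume "\<exists>z. rel A \<Gamma> X Y F x z \<and> rel A \<Gamma> Y Z G z y" "eq A \<Gamma> X x x'" "eq A \<Gamma> Z y y'"
  then show "\<exists>z. rel A \<Gamma> X Y F x' z \<and> rel A \<Gamma> Y Z G z y'"
    using fun_ext1[OF F Y] fun_ext2[OF G Y] by blast
next
  fix \<Gamma> x
  assume "ex A \<Gamma> X x"
  then show "\<exists>y z. rel A \<Gamma> X Y F x z \<and> rel A \<Gamma> Y Z G z y"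
    using fun_total[OF F] fun_ex[OF F] fun_total[OF G] by blast
qed (use fun_ex[OF F] fun_ex[OF G] in blast)+

lemma Comp_RT_in_Hom:
  assumes "m \<in> Hom (RT U A) X Y" "n \<in> Hom (RT U A) Y Z"
    and "is_rtobj U A X" "is_rtobj U A Y" "is_rtobj U A Z"
  shows "rt_comp A n m \<in> Hom (RT U A) X Z"
  using assms unfolding Hom_RT
  by (metis rt_comp_arr stage_fun_rcomp obj)

lemma Comp_RT_assoc:
  assumes "m \<in> Hom (RT U A) X Y" "n \<in> Hom (RT U A) Y Z" "l \<in> Hom (RT U A) Z W"
  shows "rt_comp A l (rt_comp A n m) = rt_comp A (rt_comp A l n) m"
  using assms unfolding Hom_RT
  by (auto simp: rt_comp_arr rt_arr_eq_iff fun_eq_iff rel_rcomp; blast)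

lemma Comp_RT_Id:
  assumes "m \<in> Hom (RT U A) X Y" "is_rtobj U A X" "is_rtobj U A Y"
  shows "rt_comp A m (rt_arr A X X (Eq X)) = m" "rt_comp A (rt_arr A Y Y (Eq Y)) m = m"
proof -
  obtain F where F: "m = rt_arr A X Y F" "stage_fun A X Y F" using assms unfolding Hom_RT by blast
  have "(\<exists>x'. eq A \<Gamma> X x x' \<and> rel A \<Gamma> X Y F x' y) \<longleftrightarrow> rel A \<Gamma> X Y F x y"
    "(\<exists>y'. rel A \<Gamma> X Y F x y' \<and> eq A \<Gamma> Y y' y) \<longleftrightarrow> rel A \<Gamma> X Y F x y" for \<Gamma> x y
    using F(2) obj[OF assms(2)] obj[OF assms(3)]
    by (meson fun_ex fun_ext1 fun_ext2 eq_refl eq_sym)+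
  then show "rt_comp A m (rt_arr A X X (Eq X)) = m" "rt_comp A (rt_arr A Y Y (Eq Y)) m = m"
    unfolding F(1) rt_comp_arr rt_arr_eq_iff fun_eq_iff rel_rcomp by blast+
qed

text \<open>\<open>T\<close> is the generic pair related by \<open>R\<close>, an object of the
  category to which universal properties can be applied; its legs are jointly monic. The carrier is
  small because \<open>U\<close> is closed under binary products and subsets.\<close>

lemma tabulation:
  assumes U: "universe U (code :: 'a \<Rightarrow> 'u)"
    and XY: "is_rtobj U A X" "is_rtobj U A Y"
    and strict: "\<And>\<Gamma> x y. rel A \<Gamma> X Y R x y \<Longrightarrow> ex A \<Gamma> X x \<and> ex A \<Gamma> Y y"
    and ext: "\<And>\<Gamma> x y x' y'. rel A \<Gamma> X Y R x y \<Longrightarrow> eq A \<Gamma> X x x' \<Longrightarrow> eq A \<Gamma> Y y y' \<Longrightarrow>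
      rel A \<Gamma> X Y R x' y'"
  obtains T P Q where "is_rtobj U A T" "stage_fun A T X P" "stage_fun A T Y Q"
    "\<And>\<Gamma> x y. rel A \<Gamma> X Y R x y \<Longrightarrow> \<exists>t. rel A \<Gamma> T X P t x \<and> rel A \<Gamma> T Y Q t y"
    "\<And>\<Gamma> t x y. rel A \<Gamma> T X P t x \<Longrightarrow> rel A \<Gamma> T Y Q t y \<Longrightarrow> rel A \<Gamma> X Y R x y"
    "\<And>\<Gamma> t t' x y. rel A \<Gamma> T X P t x \<Longrightarrow> rel A \<Gamma> T Y Q t y \<Longrightarrow>
      rel A \<Gamma> T X P t' x \<Longrightarrow> rel A \<Gamma> T Y Q t' y \<Longrightarrow> eq A \<Gamma> T t t'"
proof -
  have X: "stage_obj A X" and Y: "stage_obj A Y" using XY by (auto simp: is_rtobj_iff)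
  have cXY: "Car X \<in> U" "Car Y \<in> U" using XY by (auto simp: is_rtobj_iff)
  have "\<forall>S\<in>U. \<forall>T\<in>U. \<exists>h :: 'u \<times> 'u \<Rightarrow> 'u. inj_on h (S \<times> T) \<and> h ` (S \<times> T) \<in> U"
    and sub: "\<And>S T. S \<in> U \<Longrightarrow> T \<subseteq> S \<Longrightarrow> T \<in> U"
    using U unfolding universe_def by blast+
  then obtain h :: "'u \<times> 'u \<Rightarrow> 'u" where h: "inj_on h (Car X \<times> Car Y)" "h ` (Car X \<times> Car Y) \<in> U"
    using cXY by blast
  define dec where "dec = inv_into (Car X \<times> Car Y) h"
  define l where "l t = fst (dec t)" for t
  define r where "r t = snd (dec t)" for t
  have lr: "l (h (x, y)) = x" "r (h (x, y)) = y" if "x \<in> Car X" "y \<in> Car Y" for x y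
    using h(1) that by (simp_all add: l_def r_def dec_def)
  \<comment> \<open>Pairs without a realizer are left out, since existence predicates must be
    nonempty on the carrier.\<close>
  define C where "C = h ` {(x, y) \<in> Car X \<times> Car Y. R x y \<noteq> {}}"
  define T :: "('u, 'a) rtobj" where "T = \<lparr>Car = C, Ex = (\<lambda>t. R (l t) (r t)),
    Eq = (\<lambda>t t'. meet A (meet A (R (l t) (r t)) (R (l t') (r t'))) (meet A (Eq X (l t) (l t')) (Eq Y (r t) (r t'))))\<rparr>"
  define P where "P t x = meet A (R (l t) (r t)) (Eq X (l t) x)" for t x
  define Q where "Q t y = meet A (R (l t) (r t)) (Eq Y (r t) y)" for t y
  have els: "(\<lambda>c. l (t c)) \<in> els \<Gamma> (Car X) \<and> (\<lambda>c. r (t c)) \<in> els \<Gamma> (Car Y)" if "t \<in> els \<Gamma> C"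
    for \<Gamma> t
  proof -
    have "l u \<in> Car X \<and> r u \<in> Car Y" if "u \<in> C" for u using that lr by (auto simp: C_def)
    then show ?thesis using that by (simp add: els_def)
  qed
  have exT: "ex A \<Gamma> T t \<longleftrightarrow> t \<in> els \<Gamma> C \<and> rel A \<Gamma> X Y R (\<lambda>c. l (t c)) (\<lambda>c. r (t c))"
    for \<Gamma> t
    using els[of t \<Gamma>] by (auto simp: ex_def rel_def T_def)
  have eqT: "eq A \<Gamma> T t t' \<longleftrightarrow> ex A \<Gamma> T t \<and> ex A \<Gamma> T t' \<and>
      eq A \<Gamma> X (\<lambda>c. l (t c)) (\<lambda>c. l (t' c)) \<and> eq A \<Gamma> Y (\<lambda>c. r (t c)) (\<lambda>c. r (t' c))"
    for \<Gamma> t t'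
    using els[of t \<Gamma>] els[of t' \<Gamma>] unfolding exT by (auto simp: rel_def T_def holds_meet)
  have relP: "rel A \<Gamma> T X P t x \<longleftrightarrow> ex A \<Gamma> T t \<and> eq A \<Gamma> X (\<lambda>c. l (t c)) x"
    and relQ: "rel A \<Gamma> T Y Q t y \<longleftrightarrow> ex A \<Gamma> T t \<and> eq A \<Gamma> Y (\<lambda>c. r (t c)) y"
    for \<Gamma> t x y
    using els[of t \<Gamma>] unfolding exT by (auto simp: rel_def T_def P_def Q_def holds_meet)
  have exT': "ex A \<Gamma> X (\<lambda>c. l (t c)) \<and> ex A \<Gamma> Y (\<lambda>c. r (t c))" if "ex A \<Gamma> T t"
    for \<Gamma> t
    using that strict unfolding exT by blast
  have oT: "stage_obj A T"
  proof (rule stage_objI; unfold eqT)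
    fix \<Gamma> t u v
    show "ex A \<Gamma> T t" if "ex A \<Gamma> T t \<and> ex A \<Gamma> T u \<and>
      eq A \<Gamma> X (\<lambda>c. l (t c)) (\<lambda>c. l (u c)) \<and> eq A \<Gamma> Y (\<lambda>c. r (t c)) (\<lambda>c. r (u c))"
      using that by (rule conjunct1)
    show "ex A \<Gamma> T t \<and> ex A \<Gamma> T t \<and>
      eq A \<Gamma> X (\<lambda>c. l (t c)) (\<lambda>c. l (t c)) \<and> eq A \<Gamma> Y (\<lambda>c. r (t c)) (\<lambda>c. r (t c))"
      if "ex A \<Gamma> T t"
      using exT'[OF that] that eq_refl[OF X] eq_refl[OF Y] by simp
    assume tu: "ex A \<Gamma> T t \<and> ex A \<Gamma> T u \<and>
      eq A \<Gamma> X (\<lambda>c. l (t c)) (\<lambda>c. l (u c)) \<and> eq A \<Gamma> Y (\<lambda>c. r (t c)) (\<lambda>c. r (u c))"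
    then show "ex A \<Gamma> T u \<and> ex A \<Gamma> T t \<and>
      eq A \<Gamma> X (\<lambda>c. l (u c)) (\<lambda>c. l (t c)) \<and> eq A \<Gamma> Y (\<lambda>c. r (u c)) (\<lambda>c. r (t c))"
      by (simp add: eq_sym[OF X] eq_sym[OF Y])
    assume "ex A \<Gamma> T u \<and> ex A \<Gamma> T v \<and>
      eq A \<Gamma> X (\<lambda>c. l (u c)) (\<lambda>c. l (v c)) \<and> eq A \<Gamma> Y (\<lambda>c. r (u c)) (\<lambda>c. r (v c))"
    with tu show "ex A \<Gamma> T t \<and> ex A \<Gamma> T v \<and>
      eq A \<Gamma> X (\<lambda>c. l (t c)) (\<lambda>c. l (v c)) \<and> eq A \<Gamma> Y (\<lambda>c. r (t c)) (\<lambda>c. r (v c))"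
      by (auto intro: eq_trans[OF X] eq_trans[OF Y])
  qed
  \<comment> \<open>Both legs are treated at once: \<open>q\<close> is \<open>l\<close> for
    \<open>P\<close> and \<open>r\<close> for \<open>Q\<close>.\<close>
  have projection: "stage_fun A T Z S"
    if Z: "stage_obj A Z" and z: "\<And>\<Gamma> t. ex A \<Gamma> T t \<Longrightarrow> ex A \<Gamma> Z (\<lambda>c. q (t c))"
      "\<And>\<Gamma> t t'. eq A \<Gamma> T t t' \<Longrightarrow> eq A \<Gamma> Z (\<lambda>c. q (t c)) (\<lambda>c. q (t' c))"
      and S: "\<And>\<Gamma> t z. rel A \<Gamma> T Z S t z \<longleftrightarrow> ex A \<Gamma> T t \<and> eq A \<Gamma> Z (\<lambda>c. q (t c)) z"
    for Z S q
  proof (rule stage_funI; unfold S)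
    fix \<Gamma> t t' z z'
    show "ex A \<Gamma> T t" if "ex A \<Gamma> T t \<and> eq A \<Gamma> Z (\<lambda>c. q (t c)) z"
      using that by simp
    show "ex A \<Gamma> Z z" if "ex A \<Gamma> T t \<and> eq A \<Gamma> Z (\<lambda>c. q (t c)) z"
      using that eq_ex[OF Z] by blast
    show "\<exists>z. ex A \<Gamma> T t \<and> eq A \<Gamma> Z (\<lambda>c. q (t c)) z" if "ex A \<Gamma> T t"
      using that eq_refl[OF Z] z(1) by blast
    assume a: "ex A \<Gamma> T t \<and> eq A \<Gamma> Z (\<lambda>c. q (t c)) z"
    show "eq A \<Gamma> Z z z'" if "ex A \<Gamma> T t \<and> eq A \<Gamma> Z (\<lambda>c. q (t c)) z'"
      using that a eq_sym[OF Z] eq_trans[OF Z] by blast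
    assume "eq A \<Gamma> T t t'" "eq A \<Gamma> Z z z'"
    then show "ex A \<Gamma> T t' \<and> eq A \<Gamma> Z (\<lambda>c. q (t' c)) z'"
      using a z(2) eq_sym[OF Z] eq_trans[OF Z] eq_ex[OF oT] by meson
  qed
  have "C \<subseteq> h ` (Car X \<times> Car Y)" by (auto simp: C_def)
  then have "C \<in> U" using h(2) sub by blast
  moreover have "\<forall>t\<in>C. R (l t) (r t) \<noteq> {}" by (auto simp: C_def lr)
  ultimately have "is_rtobj U A T" using oT by (simp add: is_rtobj_iff) (simp add: T_def)
  moreover have "stage_fun A T X P"
    by (rule projection[OF X _ _ relP]) (use exT' eqT in blast)+
  moreover have "stage_fun A T Y Q"
    by (rule projection[OF Y _ _ relQ]) (use exT' eqT in blast)+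
  moreover have "\<exists>t. rel A \<Gamma> T X P t x \<and> rel A \<Gamma> T Y Q t y" if R: "rel A \<Gamma> X Y R x y"
    for \<Gamma> x y
  proof -
    define t where "t c = h (x c, y c)" for c
    have xy: "x c \<in> Car X" "y c \<in> Car Y" if "c \<in> dom \<Gamma>" for c
      using R that by (auto simp: rel_def els_def)
    have "R (x c) (y c) \<noteq> {}" if "c \<in> dom \<Gamma>" for c
      using R that by (auto simp: rel_def dest: holds_nonempty)
    then have "t \<in> els \<Gamma> C" using xy by (auto simp: els_def C_def t_def)
    moreover have eqs: "l (t c) = x c" "r (t c) = y c" if "c \<in> dom \<Gamma>" for c
      using xy[OF that] lr by (simp_all add: t_def)
    have "rel A \<Gamma> X Y R (\<lambda>c. l (t c)) (\<lambda>c. r (t c)) = rel A \<Gamma> X Y R x y"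
      "eq A \<Gamma> X (\<lambda>c. l (t c)) x = eq A \<Gamma> X x x" "eq A \<Gamma> Y (\<lambda>c. r (t c)) y = eq A \<Gamma> Y y y"
      by (rule rel_cong; simp add: eqs)+
    ultimately have "rel A \<Gamma> T X P t x \<and> rel A \<Gamma> T Y Q t y"
      using R strict[OF R] eq_refl[OF X] eq_refl[OF Y] unfolding relP relQ exT by blast
    then show ?thesis by blast
  qed
  moreover have "rel A \<Gamma> X Y R x y" if "rel A \<Gamma> T X P t x" "rel A \<Gamma> T Y Q t y"
    for \<Gamma> t x y
    using that ext unfolding relP relQ exT by blast
  moreover have "eq A \<Gamma> T t t'" if "rel A \<Gamma> T X P t x" "rel A \<Gamma> T Y Q t y"
      "rel A \<Gamma> T X P t' x" "rel A \<Gamma> T Y Q t' y" for \<Gamma> t t' x y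
    using that eq_sym[OF X] eq_sym[OF Y] eq_trans[OF X] eq_trans[OF Y] unfolding relP relQ eqT by meson
  ultimately show thesis by (rule that)
qed

end

section \<open>Finite limits and monomorphisms in terms of stages\<close>

definition stage_pullback ::
  "'a papp \<Rightarrow> ('u, 'a) rtobj \<Rightarrow> ('u, 'a) rtobj \<Rightarrow> ('u, 'a) rtobj \<Rightarrow> ('u, 'a) rtobj \<Rightarrow>
   ('u \<Rightarrow> 'u \<Rightarrow> 'a set) \<Rightarrow> ('u \<Rightarrow> 'u \<Rightarrow> 'a set) \<Rightarrow> ('u \<Rightarrow> 'u \<Rightarrow> 'a set) \<Rightarrow> ('u \<Rightarrow> 'u \<Rightarrow> 'a set) \<Rightarrow> bool"
  where "stage_pullback A P X Y Z p q f g \<longleftrightarrow> (\<forall>\<Gamma>.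
    (\<forall>w w' x y. rel A \<Gamma> P X p w x \<longrightarrow> rel A \<Gamma> P X p w' x \<longrightarrow> rel A \<Gamma> P Y q w y \<longrightarrow>
       rel A \<Gamma> P Y q w' y \<longrightarrow> eq A \<Gamma> P w w') \<and>
    (\<forall>x y z. rel A \<Gamma> X Z f x z \<longrightarrow> rel A \<Gamma> Y Z g y z \<longrightarrow>
       (\<exists>w. rel A \<Gamma> P X p w x \<and> rel A \<Gamma> P Y q w y)) \<and>
    (\<forall>w x y. rel A \<Gamma> P X p w x \<longrightarrow> rel A \<Gamma> P Y q w y \<longrightarrow>
       (\<exists>z. rel A \<Gamma> X Z f x z \<and> rel A \<Gamma> Y Z g y z)))"

definition stage_terminal :: "'a papp \<Rightarrow> ('u, 'a) rtobj \<Rightarrow> bool" where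
  "stage_terminal A T \<longleftrightarrow> (\<forall>\<Gamma>. (\<exists>x. ex A \<Gamma> T x) \<and>
     (\<forall>x y. ex A \<Gamma> T x \<longrightarrow> ex A \<Gamma> T y \<longrightarrow> eq A \<Gamma> T x y))"

definition stage_mono ::
  "'a papp \<Rightarrow> ('u, 'a) rtobj \<Rightarrow> ('u, 'a) rtobj \<Rightarrow> ('u \<Rightarrow> 'u \<Rightarrow> 'a set) \<Rightarrow> bool" where
  "stage_mono A X Y M \<longleftrightarrow> (\<forall>\<Gamma>. \<forall>x x' y.
     rel A \<Gamma> X Y M x y \<longrightarrow> rel A \<Gamma> X Y M x' y \<longrightarrow> eq A \<Gamma> X x x')"

context realizability_logic
begin

lemma rt_comp_eqI:
  assumes "stage_fun A W X u" "stage_fun A X Z f" "stage_fun A W Y v" "stage_fun A Y Z g"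
    and "stage_obj A W" "stage_obj A X" "stage_obj A Y" "stage_obj A Z"
    and "\<And>\<Gamma> w x z. rel A \<Gamma> W X u w x \<Longrightarrow> rel A \<Gamma> X Z f x z \<Longrightarrow>
      \<exists>y. rel A \<Gamma> W Y v w y \<and> rel A \<Gamma> Y Z g y z"
  shows "rt_comp A (rt_arr A X Z f) (rt_arr A W X u) = rt_comp A (rt_arr A Y Z g) (rt_arr A W Y v)"
  unfolding rt_comp_arr
  by (rule rt_arr_eqI) (use assms in \<open>auto intro!: stage_fun_rcomp simp: rel_rcomp\<close>)

lemma rt_comp_eqI':
  assumes "stage_fun A W X u" "stage_fun A X Z f" "stage_fun A W Z v"
    and "stage_obj A W" "stage_obj A X" "stage_obj A Z"
    and "\<And>\<Gamma> w x z. rel A \<Gamma> W X u w x \<Longrightarrow> rel A \<Gamma> X Z f x z \<Longrightarrow> rel A \<Gamma> W Z v w z"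
  shows "rt_comp A (rt_arr A X Z f) (rt_arr A W X u) = rt_arr A W Z v"
  unfolding rt_comp_arr
  by (rule rt_arr_eqI) (use assms in \<open>auto intro!: stage_fun_rcomp simp: rel_rcomp\<close>)

lemma rt_comp_eqD:
  assumes "rt_comp A (rt_arr A X Z f) (rt_arr A W X u) = rt_comp A (rt_arr A Y Z g) (rt_arr A W Y v)"
  shows "(\<exists>x. rel A \<Gamma> W X u w x \<and> rel A \<Gamma> X Z f x z) \<longleftrightarrow>
    (\<exists>y. rel A \<Gamma> W Y v w y \<and> rel A \<Gamma> Y Z g y z)"
  using assms unfolding rt_comp_arr rt_arr_eq_iff rel_rcomp[symmetric] by simp

lemma rt_comp_eqD':
  assumes "rt_comp A (rt_arr A X Z f) (rt_arr A W X u) = rt_arr A W Z v"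
  shows "(\<exists>x. rel A \<Gamma> W X u w x \<and> rel A \<Gamma> X Z f x z) \<longleftrightarrow> rel A \<Gamma> W Z v w z"
  using assms unfolding rt_comp_arr rt_arr_eq_iff rel_rcomp[symmetric] by simp

text \<open>Turns uniqueness of arrows into equality of elements: any two related elements are the
  images of one \<open>t\<close> under the two legs of the tabulation, so they are equal as soon as
  the legs are.\<close>

lemma tabulation_eq:
  assumes U: "universe U (code :: 'a \<Rightarrow> 'u)" and X: "is_rtobj U A X"
    and strict: "\<And>\<Gamma> x y. rel A \<Gamma> X X R x y \<Longrightarrow> ex A \<Gamma> X x \<and> ex A \<Gamma> X y"
    and ext: "\<And>\<Gamma> x y x' y'. rel A \<Gamma> X X R x y \<Longrightarrow> eq A \<Gamma> X x x' \<Longrightarrow> eq A \<Gamma> X y y' \<Longrightarrow>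
      rel A \<Gamma> X X R x' y'"
    and eq: "\<And>T P Q. is_rtobj U A T \<Longrightarrow> stage_fun A T X P \<Longrightarrow> stage_fun A T X Q \<Longrightarrow>
      (\<And>\<Gamma> t x y. rel A \<Gamma> T X P t x \<Longrightarrow> rel A \<Gamma> T X Q t y \<Longrightarrow> rel A \<Gamma> X X R x y) \<Longrightarrow>
      rt_arr A T X P = rt_arr A T X Q"
    and R: "rel A \<Gamma> X X R x y"
  shows "eq A \<Gamma> X x y"
proof -
  obtain T P Q where T: "is_rtobj U A T" "stage_fun A T X P" "stage_fun A T X Q"
    "\<And>\<Gamma> x y. rel A \<Gamma> X X R x y \<Longrightarrow> \<exists>t. rel A \<Gamma> T X P t x \<and> rel A \<Gamma> T X Q t y"
    "\<And>\<Gamma> t x y. rel A \<Gamma> T X P t x \<Longrightarrow> rel A \<Gamma> T X Q t y \<Longrightarrow> rel A \<Gamma> X X R x y"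
    by (rule tabulation[OF U X X strict ext]) auto
  have "rt_arr A T X P = rt_arr A T X Q" by (rule eq[OF T(1,2,3)]) (rule T(5))
  moreover obtain t where "rel A \<Gamma> T X P t x" "rel A \<Gamma> T X Q t y" using T(4)[OF R] by blast
  ultimately show ?thesis using fun_single[OF T(3)] unfolding rt_arr_eq_iff by metis
qed

lemma stage_monoD: "stage_mono A X Y M \<Longrightarrow> rel A \<Gamma> X Y M x y \<Longrightarrow> rel A \<Gamma> X Y M x' y \<Longrightarrow> eq A \<Gamma> X x x'"
  unfolding stage_mono_def by blast

text \<open>The forward direction tabulates the kernel pair of \<open>M\<close>: its two legs have
  the same composite with the mono, so they coincide.\<close>

lemma mono_arr_iff:
  assumes U: "universe U (code :: 'a \<Rightarrow> 'u)"
    and XY: "is_rtobj U A X" "is_rtobj U A Y" and M: "stage_fun A X Y M"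
  shows "mono_arr (RT U A) X Y (rt_arr A X Y M) \<longleftrightarrow> stage_mono A X Y M"
proof
  note oX = obj[OF XY(1)] and oY = obj[OF XY(2)]
  assume mono: "mono_arr (RT U A) X Y (rt_arr A X Y M)"
  show "stage_mono A X Y M"
    unfolding stage_mono_def
  proof (intro allI impI)
    fix \<Gamma> x x' y
    let ?R = "\<lambda>x x'. \<Union>y\<in>Car Y. meet A (M x y) (M x' y)"
    have R: "rel A \<Gamma> X X ?R x x' \<longleftrightarrow> (\<exists>y. rel A \<Gamma> X Y M x y \<and> rel A \<Gamma> X Y M x' y)"
      for \<Gamma> x x'
      unfolding rel_def holds_UN holds_meet by blast
    assume xy: "rel A \<Gamma> X Y M x y" "rel A \<Gamma> X Y M x' y"
    show "eq A \<Gamma> X x x'"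
    proof (rule tabulation_eq[where R = ?R, OF U XY(1)]; (unfold R)?)
      fix T P Q
      assume T: "is_rtobj U A T" "stage_fun A T X P" "stage_fun A T X Q"
        and PQ: "\<And>\<Gamma> t x y. rel A \<Gamma> T X P t x \<Longrightarrow> rel A \<Gamma> T X Q t y \<Longrightarrow>
          \<exists>z. rel A \<Gamma> X Y M x z \<and> rel A \<Gamma> X Y M y z"
      have "rt_comp A (rt_arr A X Y M) (rt_arr A T X P) = rt_comp A (rt_arr A X Y M) (rt_arr A T X Q)"
      proof (rule rt_comp_eqI[OF T(2) M T(3) M obj[OF T(1)] oX oX oY])
        fix \<Gamma> t x z
        assume a: "rel A \<Gamma> T X P t x" "rel A \<Gamma> X Y M x z"
        then obtain x' where x': "rel A \<Gamma> T X Q t x'" using fun_ex[OF T(2)] fun_total[OF T(3)] by blast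
        then obtain z' where z': "rel A \<Gamma> X Y M x z'" "rel A \<Gamma> X Y M x' z'" using PQ a by blast
        then have "rel A \<Gamma> X Y M x' z" using fun_single[OF M] fun_ext2[OF M oX] a by blast
        then show "\<exists>y. rel A \<Gamma> T X Q t y \<and> rel A \<Gamma> X Y M y z" using x' by blast
      qed
      then show "rt_arr A T X P = rt_arr A T X Q"
        using mono T unfolding mono_arr_def by (simp add: Hom_RT_arr)
    next
      show "\<exists>y. rel A \<Gamma> X Y M x y \<and> rel A \<Gamma> X Y M x' y" using xy by blast
    next
      fix \<Gamma> x x' y y'
      assume "\<exists>z. rel A \<Gamma> X Y M x z \<and> rel A \<Gamma> X Y M y z" "eq A \<Gamma> X x x'" "eq A \<Gamma> X y y'"
      then show "\<exists>z. rel A \<Gamma> X Y M x' z \<and> rel A \<Gamma> X Y M y' z" using fun_ext1[OF M oY] by blast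
    qed (use fun_ex[OF M] in blast)
  qed
next
  note oX = obj[OF XY(1)] and oY = obj[OF XY(2)]
  assume mono: "stage_mono A X Y M"
  show "mono_arr (RT U A) X Y (rt_arr A X Y M)"
    unfolding mono_arr_def
  proof (intro conjI ballI impI)
    fix W g h assume W: "W \<in> Ob (RT U A)" and "g \<in> Hom (RT U A) W X" "h \<in> Hom (RT U A) W X"
      and e: "Comp (RT U A) (rt_arr A X Y M) g = Comp (RT U A) (rt_arr A X Y M) h"
    then obtain G H where G: "g = rt_arr A W X G" "stage_fun A W X G"
      and H: "h = rt_arr A W X H" "stage_fun A W X H" unfolding Hom_RT by blast
    note e' = e[unfolded RT_simps G(1) H(1), THEN rt_comp_eqD]
    have oW: "stage_obj A W" using W obj by auto
    show "g = h" unfolding G(1) H(1)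
    proof (rule rt_arr_eqI[OF G(2) H(2) oW])
      fix \<Gamma> w x
      assume a: "rel A \<Gamma> W X G w x"
      then obtain y where y: "rel A \<Gamma> X Y M x y" using fun_ex[OF G(2)] fun_total[OF M] by blast
      then obtain x' where x': "rel A \<Gamma> W X H w x'" "rel A \<Gamma> X Y M x' y"
        using a e'[of \<Gamma> w y] by blast
      show "rel A \<Gamma> W X H w x"
        by (rule fun_ext2[OF H(2) oW x'(1)]) (rule stage_monoD[OF mono x'(2) y])
    qed
  qed (rule Hom_RT_arr[OF M])
qed

lemma terminal_iff:
  assumes U: "universe U (code :: 'a \<Rightarrow> 'u)"
  shows "terminal (RT U A) T \<longleftrightarrow> is_rtobj U A T \<and> stage_terminal A T"
proof
  assume t: "terminal (RT U A) T"
  then have T: "is_rtobj U A T" unfolding terminal_def by simp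
  have uniq: "P = Q" if "is_rtobj U A X" "P \<in> Hom (RT U A) X T" "Q \<in> Hom (RT U A) X T" for X P Q
    using t that unfolding terminal_def by auto
  have "range code \<in> U" "\<forall>S\<in>U. \<forall>T. T \<subseteq> S \<longrightarrow> T \<in> U" using U unfolding universe_def by simp_all
  then have "{code undefined} \<in> U" by (meson empty_subsetI insert_subset rangeI)
  \<comment> \<open>The one-point object with all of \<open>A\<close> as realizers; which point is
    taken does not matter. An arrow from it to \<open>T\<close> provides an element of
    \<open>T\<close> at every stage.\<close>
  moreover define I :: "('u, 'a) rtobj" where
    "I = \<lparr>Car = {code undefined}, Ex = (\<lambda>_. UNIV), Eq = (\<lambda>_ _. UNIV)\<rparr>"
  ultimately have I: "is_rtobj U A I"
    unfolding is_rtobj_iff by (auto intro!: stage_objI simp: ex_def rel_def holds_UNIV)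
  then obtain m where "m \<in> Hom (RT U A) I T" using t unfolding terminal_def by auto
  then obtain M where M: "stage_fun A I T M" unfolding Hom_RT by blast
  have "\<exists>x. ex A \<Gamma> T x" for \<Gamma>
  proof -
    have "ex A \<Gamma> I (\<lambda>_. code undefined)" by (simp add: ex_def I_def els_def holds_UNIV)
    then show ?thesis using fun_total[OF M] fun_ex[OF M] by blast
  qed
  moreover have "eq A \<Gamma> T x y" if xy: "ex A \<Gamma> T x" "ex A \<Gamma> T y" for \<Gamma> x y
  proof -
    \<comment> \<open>The tabulation of this relation is the product of \<open>T\<close> with
      itself, whose legs agree because \<open>T\<close> is terminal.\<close>
    have R: "rel A \<Gamma> T T (\<lambda>x y. meet A (Ex T x) (Ex T y)) x y \<longleftrightarrow> ex A \<Gamma> T x \<and> ex A \<Gamma> T y"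
      for \<Gamma> x y
      unfolding rel_def ex_def holds_meet by blast
    show ?thesis
      by (rule tabulation_eq[where R = "\<lambda>x y. meet A (Ex T x) (Ex T y)", OF U T]; (unfold R)?)
        (use xy eq_ex[OF obj[OF T]] uniq Hom_RT_arr in blast)+
  qed
  ultimately show "is_rtobj U A T \<and> stage_terminal A T" using T unfolding stage_terminal_def by blast
next
  assume "is_rtobj U A T \<and> stage_terminal A T"
  then have T: "is_rtobj U A T" and t: "stage_terminal A T" by auto
  note oT = obj[OF T]
  have inh: "\<exists>x. ex A \<Gamma> T x" and one: "ex A \<Gamma> T x \<Longrightarrow> ex A \<Gamma> T y \<Longrightarrow> eq A \<Gamma> T x y"
    for \<Gamma> x y
    using t unfolding stage_terminal_def by blast+
  have "\<exists>!m. m \<in> Hom (RT U A) X T" if X: "is_rtobj U A X" for X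
  proof
    note oX = obj[OF X]
    let ?F = "\<lambda>x y. meet A (Ex X x) (Ex T y)"
    have F: "rel A \<Gamma> X T ?F x y \<longleftrightarrow> ex A \<Gamma> X x \<and> ex A \<Gamma> T y" for \<Gamma> x y
      unfolding rel_def ex_def holds_meet by blast
    have fF: "stage_fun A X T ?F"
      by (rule stage_funI; unfold F) (use inh one eq_ex[OF oX] eq_ex[OF oT] in blast)+
    then show "rt_arr A X T ?F \<in> Hom (RT U A) X T" by (rule Hom_RT_arr)
    fix m assume "m \<in> Hom (RT U A) X T"
    then obtain G where G: "m = rt_arr A X T G" "stage_fun A X T G" unfolding Hom_RT by blast
    show "m = rt_arr A X T ?F" unfolding G(1)
      by (rule rt_arr_eqI[OF G(2) fF oX]) (use fun_ex[OF G(2)] F in blast)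
  qed
  then show "terminal (RT U A) T" using T unfolding terminal_def by simp
qed

lemma stage_pullbackD:
  assumes "stage_pullback A P X Y Z p q f g"
  shows "rel A \<Gamma> P X p w x \<Longrightarrow> rel A \<Gamma> P X p w' x \<Longrightarrow> rel A \<Gamma> P Y q w y \<Longrightarrow>
       rel A \<Gamma> P Y q w' y \<Longrightarrow> eq A \<Gamma> P w w'"
    and "rel A \<Gamma> X Z f x z \<Longrightarrow> rel A \<Gamma> Y Z g y z \<Longrightarrow> \<exists>w. rel A \<Gamma> P X p w x \<and> rel A \<Gamma> P Y q w y"
    and "rel A \<Gamma> P X p w x \<Longrightarrow> rel A \<Gamma> P Y q w y \<Longrightarrow> \<exists>z. rel A \<Gamma> X Z f x z \<and> rel A \<Gamma> Y Z g y z"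
  using assms[unfolded stage_pullback_def, THEN spec, of \<Gamma>] by auto

lemma stage_pullback_imp_pullback:
  assumes ob: "is_rtobj U A P" "is_rtobj U A X" "is_rtobj U A Y" "is_rtobj U A Z"
    and p: "stage_fun A P X p" and q: "stage_fun A P Y q"
    and f: "stage_fun A X Z f" and g: "stage_fun A Y Z g"
    and pb: "stage_pullback A P X Y Z p q f g"
  shows "pullback (RT U A) P X Y Z (rt_arr A P X p) (rt_arr A P Y q) (rt_arr A X Z f) (rt_arr A Y Z g)"
proof -
  note oP = obj[OF ob(1)] and oX = obj[OF ob(2)] and oY = obj[OF ob(3)] and oZ = obj[OF ob(4)]
  note pbD = stage_pullbackD[OF pb]
  have commute: "rt_comp A (rt_arr A X Z f) (rt_arr A P X p) = rt_comp A (rt_arr A Y Z g) (rt_arr A P Y q)"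
  proof (rule rt_comp_eqI[OF p f q g oP oX oY oZ])
    fix \<Gamma> w x z
    assume a: "rel A \<Gamma> P X p w x" "rel A \<Gamma> X Z f x z"
    then obtain y where y: "rel A \<Gamma> P Y q w y" using fun_ex[OF p] fun_total[OF q] by blast
    then obtain z' where z': "rel A \<Gamma> X Z f x z'" "rel A \<Gamma> Y Z g y z'" using pbD(3) a by blast
    then have "rel A \<Gamma> Y Z g y z" using fun_ext2[OF g oY] fun_single[OF f] a(2) by blast
    then show "\<exists>y. rel A \<Gamma> P Y q w y \<and> rel A \<Gamma> Y Z g y z" using y by blast
  qed
  have "\<exists>!h. h \<in> Hom (RT U A) W P \<and> rt_comp A (rt_arr A P X p) h = u \<and> rt_comp A (rt_arr A P Y q) h = v"
    if W: "is_rtobj U A W" and uv: "u \<in> Hom (RT U A) W X" "v \<in> Hom (RT U A) W Y"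
      and e: "rt_comp A (rt_arr A X Z f) u = rt_comp A (rt_arr A Y Z g) v" for W u v
  proof -
    note oW = obj[OF W]
    obtain r s where r: "u = rt_arr A W X r" "stage_fun A W X r"
      and s: "v = rt_arr A W Y s" "stage_fun A W Y s" using uv unfolding Hom_RT by blast
    note e' = e[unfolded r(1) s(1), THEN rt_comp_eqD]
    \<comment> \<open>The mediating arrow: \<open>a\<close> goes to those \<open>w\<close> that
      \<open>p\<close> and \<open>q\<close> send to the values of \<open>a\<close> under
      \<open>u\<close> and \<open>v\<close>.\<close>
    define H where "H a w = (\<Union>x\<in>Car X. \<Union>y\<in>Car Y. meet A (meet A (r a x) (s a y)) (meet A (p w x) (q w y)))" for a w
    have H: "rel A \<Gamma> W P H a w \<longleftrightarrow> (\<exists>x y. rel A \<Gamma> W X r a x \<and> rel A \<Gamma> W Y s a y \<and>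
      rel A \<Gamma> P X p w x \<and> rel A \<Gamma> P Y q w y)" for \<Gamma> a w
      unfolding rel_def H_def holds_UN holds_meet by blast
    have fH: "stage_fun A W P H"
    proof (rule stage_funI; unfold H)
      fix \<Gamma> a a' w w'
      assume h: "\<exists>x y. rel A \<Gamma> W X r a x \<and> rel A \<Gamma> W Y s a y \<and> rel A \<Gamma> P X p w x \<and> rel A \<Gamma> P Y q w y"
      show "ex A \<Gamma> W a" using h fun_ex[OF r(2)] by blast
      show "ex A \<Gamma> P w" using h fun_ex[OF p] by blast
      show "\<exists>x y. rel A \<Gamma> W X r a' x \<and> rel A \<Gamma> W Y s a' y \<and> rel A \<Gamma> P X p w' x \<and> rel A \<Gamma> P Y q w' y"
        if "eq A \<Gamma> W a a'" "eq A \<Gamma> P w w'"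
        using h that fun_ext1[OF r(2) oX] fun_ext1[OF s(2) oY] fun_ext1[OF p oX] fun_ext1[OF q oY] by blast
      assume h': "\<exists>x y. rel A \<Gamma> W X r a x \<and> rel A \<Gamma> W Y s a y \<and> rel A \<Gamma> P X p w' x \<and> rel A \<Gamma> P Y q w' y"
      obtain x y x' y' where *: "rel A \<Gamma> W X r a x" "rel A \<Gamma> W Y s a y" "rel A \<Gamma> P X p w x" "rel A \<Gamma> P Y q w y"
        "rel A \<Gamma> W X r a x'" "rel A \<Gamma> W Y s a y'" "rel A \<Gamma> P X p w' x'" "rel A \<Gamma> P Y q w' y'"
        using h h' by blast
      have "rel A \<Gamma> P X p w x'" by (rule fun_ext2[OF p oP *(3) fun_single[OF r(2) *(1) *(5)]])
      moreover have "rel A \<Gamma> P Y q w y'" by (rule fun_ext2[OF q oP *(4) fun_single[OF s(2) *(2) *(6)]])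
      ultimately show "eq A \<Gamma> P w w'" using pbD(1) *(7,8) by blast
    next
      fix \<Gamma> a
      assume "ex A \<Gamma> W a"
      then obtain x where x: "rel A \<Gamma> W X r a x" using fun_total[OF r(2)] by blast
      then obtain z where z: "rel A \<Gamma> X Z f x z" using fun_ex[OF r(2)] fun_total[OF f] by blast
      then obtain y where "rel A \<Gamma> W Y s a y" "rel A \<Gamma> Y Z g y z" using e'[of \<Gamma> a z] x by blast
      then show "\<exists>w x y. rel A \<Gamma> W X r a x \<and> rel A \<Gamma> W Y s a y \<and> rel A \<Gamma> P X p w x \<and> rel A \<Gamma> P Y q w y"
        using pbD(2) x z by blast
    qed
    show ?thesis
    proof (rule ex1I[of _ "rt_arr A W P H"], intro conjI)
      show "rt_arr A W P H \<in> Hom (RT U A) W P" by (rule Hom_RT_arr[OF fH])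
      show "rt_comp A (rt_arr A P X p) (rt_arr A W P H) = u"
        unfolding r(1)
      proof (rule rt_comp_eqI'[OF fH p r(2) oW oP oX])
        fix \<Gamma> a w x assume "rel A \<Gamma> W P H a w" "rel A \<Gamma> P X p w x"
        then show "rel A \<Gamma> W X r a x"
          unfolding H using fun_single[OF p] fun_ext2[OF r(2) oW] by blast
      qed
      show "rt_comp A (rt_arr A P Y q) (rt_arr A W P H) = v"
        unfolding s(1)
      proof (rule rt_comp_eqI'[OF fH q s(2) oW oP oY])
        fix \<Gamma> a w x assume "rel A \<Gamma> W P H a w" "rel A \<Gamma> P Y q w x"
        then show "rel A \<Gamma> W Y s a x"
          unfolding H using fun_single[OF q] fun_ext2[OF s(2) oW] by blast
      qed
      fix h assume h: "h \<in> Hom (RT U A) W P \<and> rt_comp A (rt_arr A P X p) h = u \<and> rt_comp A (rt_arr A P Y q) h = v"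
      then obtain h' where h': "h = rt_arr A W P h'" "stage_fun A W P h'" unfolding Hom_RT by blast
      have u: "rt_comp A (rt_arr A P X p) (rt_arr A W P h') = rt_arr A W X r"
        and v: "rt_comp A (rt_arr A P Y q) (rt_arr A W P h') = rt_arr A W Y s"
        using h h'(1) r(1) s(1) by simp_all
      show "h = rt_arr A W P H"
        unfolding h'(1)
      proof (rule rt_arr_eqI[OF h'(2) fH oW])
        fix \<Gamma> a w assume a: "rel A \<Gamma> W P h' a w"
        then obtain x y where "rel A \<Gamma> P X p w x" "rel A \<Gamma> P Y q w y"
          using fun_ex[OF h'(2)] fun_total[OF p] fun_total[OF q] by blast
        then show "rel A \<Gamma> W P H a w"
          using a rt_comp_eqD'[OF u, of \<Gamma> a x] rt_comp_eqD'[OF v, of \<Gamma> a y] unfolding H by blast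
      qed
    qed
  qed
  then show ?thesis
    unfolding pullback_def RT_simps using ob commute Hom_RT_arr[OF p] Hom_RT_arr[OF q] Hom_RT_arr[OF f] Hom_RT_arr[OF g]
    by simp
qed

text \<open>The universal property is applied to two tabulations. The one of pairs with equal images
  in \<open>Z\<close> yields the existence of \<open>w\<close>; the one of pairs of elements of
  \<open>P\<close> with equal projections yields joint monicity.\<close>

lemma pullback_imp_stage_pullback:
  assumes U: "universe U (code :: 'a \<Rightarrow> 'u)"
    and ob: "is_rtobj U A P" "is_rtobj U A X" "is_rtobj U A Y" "is_rtobj U A Z"
    and p: "stage_fun A P X p" and q: "stage_fun A P Y q"
    and f: "stage_fun A X Z f" and g: "stage_fun A Y Z g"
    and pb: "pullback (RT U A) P X Y Z (rt_arr A P X p) (rt_arr A P Y q) (rt_arr A X Z f) (rt_arr A Y Z g)"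
  shows "stage_pullback A P X Y Z p q f g"
proof -
  note oP = obj[OF ob(1)] and oX = obj[OF ob(2)] and oY = obj[OF ob(3)] and oZ = obj[OF ob(4)]
  have commute: "rt_comp A (rt_arr A X Z f) (rt_arr A P X p) = rt_comp A (rt_arr A Y Z g) (rt_arr A P Y q)"
    and univ: "\<And>W u v. is_rtobj U A W \<Longrightarrow> u \<in> Hom (RT U A) W X \<Longrightarrow> v \<in> Hom (RT U A) W Y \<Longrightarrow>
      rt_comp A (rt_arr A X Z f) u = rt_comp A (rt_arr A Y Z g) v \<Longrightarrow>
      \<exists>!h. h \<in> Hom (RT U A) W P \<and> rt_comp A (rt_arr A P X p) h = u \<and> rt_comp A (rt_arr A P Y q) h = v"
    using pb unfolding pullback_def RT_simps by simp_all
  have 3: "\<exists>z. rel A \<Gamma> X Z f x z \<and> rel A \<Gamma> Y Z g y z" if a: "rel A \<Gamma> P X p w x" "rel A \<Gamma> P Y q w y"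
    for \<Gamma> w x y
  proof -
    obtain z where z: "rel A \<Gamma> X Z f x z" using a fun_ex[OF p] fun_total[OF f] by blast
    then obtain y' where "rel A \<Gamma> P Y q w y'" "rel A \<Gamma> Y Z g y' z"
      using rt_comp_eqD[OF commute, of \<Gamma> w z] a by blast
    then have "rel A \<Gamma> Y Z g y z" using fun_ext1[OF g oZ] fun_single[OF q] a(2) by blast
    then show ?thesis using z by blast
  qed
  have 2: "\<exists>w. rel A \<Gamma> P X p w x \<and> rel A \<Gamma> P Y q w y" if xyz: "rel A \<Gamma> X Z f x z" "rel A \<Gamma> Y Z g y z"
    for \<Gamma> x y z
  proof -
    let ?R = "\<lambda>x y. \<Union>z\<in>Car Z. meet A (f x z) (g y z)"
    have R: "rel A \<Gamma> X Y ?R x y \<longleftrightarrow> (\<exists>z. rel A \<Gamma> X Z f x z \<and> rel A \<Gamma> Y Z g y z)"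
      for \<Gamma> x y
      unfolding rel_def holds_UN holds_meet by blast
    have strict: "ex A \<Gamma> X x \<and> ex A \<Gamma> Y y" if "rel A \<Gamma> X Y ?R x y" for \<Gamma> x y
      using that fun_ex[OF f] fun_ex[OF g] unfolding R by blast
    have ext: "rel A \<Gamma> X Y ?R x' y'" if "rel A \<Gamma> X Y ?R x y" "eq A \<Gamma> X x x'" "eq A \<Gamma> Y y y'"
      for \<Gamma> x y x' y'
      using that fun_ext1[OF f oZ] fun_ext1[OF g oZ] unfolding R by blast
    obtain T a b where T: "is_rtobj U A T" and a: "stage_fun A T X a" and b: "stage_fun A T Y b"
      and ab: "\<And>\<Gamma> x y. rel A \<Gamma> X Y ?R x y \<Longrightarrow> \<exists>t. rel A \<Gamma> T X a t x \<and> rel A \<Gamma> T Y b t y"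
      and ba: "\<And>\<Gamma> t x y. rel A \<Gamma> T X a t x \<Longrightarrow> rel A \<Gamma> T Y b t y \<Longrightarrow> rel A \<Gamma> X Y ?R x y"
      by (rule tabulation[OF U ob(2,3) strict ext]) auto
    note oT = obj[OF T]
    have "rt_comp A (rt_arr A X Z f) (rt_arr A T X a) = rt_comp A (rt_arr A Y Z g) (rt_arr A T Y b)"
    proof (rule rt_comp_eqI[OF a f b g oT oX oY oZ])
      fix \<Gamma> t x z
      assume t: "rel A \<Gamma> T X a t x" "rel A \<Gamma> X Z f x z"
      then obtain y where y: "rel A \<Gamma> T Y b t y" using fun_ex[OF a] fun_total[OF b] by blast
      then obtain z' where z': "rel A \<Gamma> X Z f x z'" "rel A \<Gamma> Y Z g y z'" using ba[OF t(1)] unfolding R by blast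
      then have "rel A \<Gamma> Y Z g y z" using fun_ext2[OF g oY] fun_single[OF f] t(2) by blast
      then show "\<exists>y. rel A \<Gamma> T Y b t y \<and> rel A \<Gamma> Y Z g y z" using y by blast
    qed
    then obtain h' where "h' \<in> Hom (RT U A) T P" "rt_comp A (rt_arr A P X p) h' = rt_arr A T X a"
      "rt_comp A (rt_arr A P Y q) h' = rt_arr A T Y b"
      using univ[OF T Hom_RT_arr[OF a] Hom_RT_arr[OF b]] by auto
    then obtain h where h: "stage_fun A T P h"
      and u: "rt_comp A (rt_arr A P X p) (rt_arr A T P h) = rt_arr A T X a"
      and v: "rt_comp A (rt_arr A P Y q) (rt_arr A T P h) = rt_arr A T Y b"
      unfolding Hom_RT by blast
    obtain t where t: "rel A \<Gamma> T X a t x" "rel A \<Gamma> T Y b t y" using ab xyz unfolding R by blast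
    obtain w where w: "rel A \<Gamma> T P h t w" "rel A \<Gamma> P X p w x"
      using t(1) rt_comp_eqD'[OF u, of \<Gamma> t x] by blast
    obtain w' where w': "rel A \<Gamma> T P h t w'" "rel A \<Gamma> P Y q w' y"
      using t(2) rt_comp_eqD'[OF v, of \<Gamma> t y] by blast
    have "rel A \<Gamma> P Y q w y" by (rule fun_ext1[OF q oY w'(2) fun_single[OF h w'(1) w(1)]])
    then show ?thesis using w by blast
  qed
  have 1: "eq A \<Gamma> P w w'" if a: "rel A \<Gamma> P X p w x" "rel A \<Gamma> P X p w' x" "rel A \<Gamma> P Y q w y" "rel A \<Gamma> P Y q w' y"
    for \<Gamma> w w' x y
  proof -
    let ?R = "\<lambda>w w'. \<Union>x\<in>Car X. \<Union>y\<in>Car Y. meet A (meet A (p w x) (p w' x)) (meet A (q w y) (q w' y))"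
    have R: "rel A \<Gamma> P P ?R w w' \<longleftrightarrow> (\<exists>x y. rel A \<Gamma> P X p w x \<and> rel A \<Gamma> P X p w' x \<and>
        rel A \<Gamma> P Y q w y \<and> rel A \<Gamma> P Y q w' y)"
      for \<Gamma> w w'
      unfolding rel_def holds_UN holds_meet by blast
    show ?thesis
    proof (rule tabulation_eq[where R = ?R, OF U ob(1)]; (unfold R)?)
      fix T a b
      assume T: "is_rtobj U A T" and a: "stage_fun A T P a" and b: "stage_fun A T P b"
        and ab: "\<And>\<Gamma> t w w'. rel A \<Gamma> T P a t w \<Longrightarrow> rel A \<Gamma> T P b t w' \<Longrightarrow>
          \<exists>x y. rel A \<Gamma> P X p w x \<and> rel A \<Gamma> P X p w' x \<and> rel A \<Gamma> P Y q w y \<and> rel A \<Gamma> P Y q w' y"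
      note oT = obj[OF T]
      have comp: "rt_comp A (rt_arr A P V r) (rt_arr A T P a) = rt_comp A (rt_arr A P V r) (rt_arr A T P b)"
        if oV: "stage_obj A V" and r: "stage_fun A P V r"
          and pr: "\<And>\<Gamma> t w w'. rel A \<Gamma> T P a t w \<Longrightarrow> rel A \<Gamma> T P b t w' \<Longrightarrow>
            \<exists>x. rel A \<Gamma> P V r w x \<and> rel A \<Gamma> P V r w' x" for V r
      proof (rule rt_comp_eqI[OF a r b r oT oP oP oV])
        fix \<Gamma> t w x
        assume t: "rel A \<Gamma> T P a t w" "rel A \<Gamma> P V r w x"
        then obtain w' where w': "rel A \<Gamma> T P b t w'" using fun_ex[OF a] fun_total[OF b] by blast
        then obtain x' where "rel A \<Gamma> P V r w x'" "rel A \<Gamma> P V r w' x'" using pr[OF t(1)] by blast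
        then have "rel A \<Gamma> P V r w' x" using t(2) fun_ext2[OF r oP] fun_single[OF r] by blast
        then show "\<exists>w. rel A \<Gamma> T P b t w \<and> rel A \<Gamma> P V r w x" using w' by blast
      qed
      have X: "rt_comp A (rt_arr A P X p) (rt_arr A T P a) = rt_comp A (rt_arr A P X p) (rt_arr A T P b)"
        by (rule comp[OF oX p]) (use ab in blast)
      have Y: "rt_comp A (rt_arr A P Y q) (rt_arr A T P a) = rt_comp A (rt_arr A P Y q) (rt_arr A T P b)"
        by (rule comp[OF oY q]) (use ab in blast)
      have "rt_comp A (rt_arr A X Z f) (rt_comp A (rt_arr A P X p) (rt_arr A T P a)) =
          rt_comp A (rt_arr A Y Z g) (rt_comp A (rt_arr A P Y q) (rt_arr A T P a))"
        using commute by (simp only: Comp_RT_assoc[OF Hom_RT_arr[OF a] Hom_RT_arr[OF p] Hom_RT_arr[OF f]]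
            Comp_RT_assoc[OF Hom_RT_arr[OF a] Hom_RT_arr[OF q] Hom_RT_arr[OF g]])
      then have "\<exists>!h. h \<in> Hom (RT U A) T P \<and>
        rt_comp A (rt_arr A P X p) h = rt_comp A (rt_arr A P X p) (rt_arr A T P a) \<and>
        rt_comp A (rt_arr A P Y q) h = rt_comp A (rt_arr A P Y q) (rt_arr A T P a)"
        by (intro univ[OF T] Comp_RT_in_Hom[OF Hom_RT_arr[OF a] Hom_RT_arr[OF p] T ob(1,2)]
            Comp_RT_in_Hom[OF Hom_RT_arr[OF a] Hom_RT_arr[OF q] T ob(1,3)])
      moreover note Hom_RT_arr[OF a, of U] Hom_RT_arr[OF b, of U] X Y
      ultimately show "rt_arr A T P a = rt_arr A T P b" by (metis (no_types))
    next
      fix \<Gamma> v w v' w'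
      assume "\<exists>x y. rel A \<Gamma> P X p v x \<and> rel A \<Gamma> P X p w x \<and> rel A \<Gamma> P Y q v y \<and> rel A \<Gamma> P Y q w y"
        "eq A \<Gamma> P v v'" "eq A \<Gamma> P w w'"
      then show "\<exists>x y. rel A \<Gamma> P X p v' x \<and> rel A \<Gamma> P X p w' x \<and> rel A \<Gamma> P Y q v' y \<and> rel A \<Gamma> P Y q w' y"
        using fun_ext1[OF p oX] fun_ext1[OF q oY] by blast
    qed (use a fun_ex[OF p] in blast)+
  qed
  show ?thesis
    unfolding stage_pullback_def using 1 2 3 by blast
qed

end

section \<open>Implication, local operators and density\<close>

text \<open>The morphisms of partitioned assemblies: \<open>\<sigma>\<close> is the map of indices
  and \<open>r\<close> tracks it.\<close>

definition sub :: "'a papp \<Rightarrow> ('u, 'a) stage \<Rightarrow> ('u list \<times> 'a list \<Rightarrow> 'u list \<times> 'a list) \<Rightarrow>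
    ('u, 'a) stage \<Rightarrow> bool" where
  "sub A \<Delta> \<sigma> \<Gamma> \<longleftrightarrow>
     (\<exists>r. \<forall>c x. \<Delta> c = Some x \<longrightarrow> (\<exists>y. \<Gamma> (\<sigma> c) = Some y \<and> A r x = Some y))"

lemma sub_dom: "sub A \<Delta> \<sigma> \<Gamma> \<Longrightarrow> c \<in> dom \<Delta> \<Longrightarrow> \<sigma> c \<in> dom \<Gamma>"
  unfolding sub_def by fast

lemma els_sub: "sub A \<Delta> \<sigma> \<Gamma> \<Longrightarrow> x \<in> els \<Gamma> S \<Longrightarrow> x \<circ> \<sigma> \<in> els \<Delta> S"
  by (simp add: els_def sub_dom)

context realizability_logic
begin

lemma sub_refl: "sub A \<Gamma> id \<Gamma>"
  using app_id unfolding sub_def by (metis id_apply)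

lemma holds_sub:
  assumes "sub A \<Delta> \<sigma> \<Gamma>" "holds A \<Gamma> \<phi>"
  shows "holds A \<Delta> (\<lambda>c. \<phi> (\<sigma> c))"
proof -
  obtain r where r: "\<forall>c x. \<Delta> c = Some x \<longrightarrow> (\<exists>y. \<Gamma> (\<sigma> c) = Some y \<and> A r x = Some y)"
    using assms(1) unfolding sub_def by (rule exE)
  obtain r' where r': "\<forall>c x. \<Gamma> c = Some x \<longrightarrow> (\<exists>y\<in>\<phi> c. A r' x = Some y)"
    using assms(2) unfolding holds_def by (rule exE)
  show ?thesis by (rule holds_compose[of _ r _ r']) (use r r' in meson)
qed

lemma rel_sub: "sub A \<Delta> \<sigma> \<Gamma> \<Longrightarrow> rel A \<Gamma> X Y R x y \<Longrightarrow> rel A \<Delta> X Y R (x \<circ> \<sigma>) (y \<circ> \<sigma>)"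
  unfolding rel_def using els_sub holds_sub[of \<Delta> \<sigma> \<Gamma>] by fastforce

end

sublocale pca_pairing \<subseteq> realizability_logic A
proof
  show "\<exists>i. \<forall>x. A i x = Some x" using ex_lam1[of "Var 0"] by auto
  show "\<exists>t. \<forall>x y z. A r x = Some y \<longrightarrow> A r' y = Some z \<longrightarrow> A t x = Some z" for r r'
    using ex_lam1[of "App (Cst r') (App (Cst r) (Var 0))"] by (auto simp: bind_eq_Some_conv)
  show "\<exists>t. \<forall>x y z w. A r x = Some y \<longrightarrow> A r' x = Some z \<longrightarrow> ap2 A q y z = Some w \<longrightarrow> A t x = Some w"
    for r r' q
  proof -
    obtain t where "\<And>x w. ev (env [x])
        (App (App (Cst q) (App (Cst r) (Var 0))) (App (Cst r') (Var 0))) = Some w \<Longrightarrow> A t x = Some w"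
      using ex_lam1[of "App (App (Cst q) (App (Cst r) (Var 0))) (App (Cst r') (Var 0))"] by blast
    then show ?thesis by (intro exI[of _ t]) (simp add: ap2_def bind_eq_Some_conv)
  qed
  show "\<exists>p p0 p1. pairing A p p0 p1" using pairing by blast
qed

context pca_pairing
begin

lemma holds_imp: "holds A \<Gamma> (\<lambda>c. imp A (V c) (W c)) \<longleftrightarrow>
    (\<forall>\<Delta> \<sigma>. sub A \<Delta> \<sigma> \<Gamma> \<longrightarrow> holds A \<Delta> (\<lambda>c. V (\<sigma> c)) \<longrightarrow> holds A \<Delta> (\<lambda>c. W (\<sigma> c)))"
  for \<Gamma> :: "('u, 'a) stage"
proof (intro iffI allI impI)
  fix \<Delta> :: "('u, 'a) stage" and \<sigma>
  assume "holds A \<Gamma> (\<lambda>c. imp A (V c) (W c))" "sub A \<Delta> \<sigma> \<Gamma>" "holds A \<Delta> (\<lambda>c. V (\<sigma> c))"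
  then have "holds A \<Delta> (\<lambda>c. imp A (V (\<sigma> c)) (W (\<sigma> c)))"
    using holds_sub[of \<Delta> \<sigma> \<Gamma> "\<lambda>c. imp A (V c) (W c)"] by blast
  then obtain r where r: "\<forall>c x. \<Delta> c = Some x \<longrightarrow> (\<exists>y\<in>imp A (V (\<sigma> c)) (W (\<sigma> c)). A r x = Some y)"
    unfolding holds_def by (rule exE)
  obtain v where v: "\<forall>c x. \<Delta> c = Some x \<longrightarrow> (\<exists>y\<in>V (\<sigma> c). A v x = Some y)"
    using \<open>holds A \<Delta> (\<lambda>c. V (\<sigma> c))\<close> unfolding holds_def by (rule exE)
  obtain t where t: "\<And>x z. ev (env [x])
      (App (App (Cst r) (Var 0)) (App (Cst v) (Var 0))) = Some z \<Longrightarrow> A t x = Some z"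
    using ex_lam1[of "App (App (Cst r) (Var 0)) (App (Cst v) (Var 0))"] by blast
  show "holds A \<Delta> (\<lambda>c. W (\<sigma> c))"
    unfolding holds_def
  proof (intro exI[of _ t] allI impI)
    fix c x assume c: "\<Delta> c = Some x"
    obtain a b where "a \<in> imp A (V (\<sigma> c)) (W (\<sigma> c))" "A r x = Some a" "b \<in> V (\<sigma> c)" "A v x = Some b"
      using r v c by meson
    moreover from this obtain z where "z \<in> W (\<sigma> c)" "A a b = Some z" by (meson impE)
    ultimately show "\<exists>z\<in>W (\<sigma> c). A t x = Some z" using t[of x z] by auto
  qed
next
  assume R: "\<forall>\<Delta> \<sigma>. sub A \<Delta> \<sigma> \<Gamma> \<longrightarrow> holds A \<Delta> (\<lambda>c. V (\<sigma> c)) \<longrightarrow> holds A \<Delta> (\<lambda>c. W (\<sigma> c))"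
  \<comment> \<open>The generic extension of the stage by a realizer \<open>a\<close> of
    \<open>V\<close>: \<open>a\<close> is put in front of the second list of the index,
    \<open>\<sigma>\<close> removes it, and the new realizer is the pair of the old one and
    \<open>a\<close>.\<close>
  define \<sigma> where "\<sigma> c = (fst c, tl (snd c))" for c :: "'u list \<times> 'a list"
  define \<Delta> where "\<Delta> c = (case snd c of [] \<Rightarrow> None | a # _ \<Rightarrow>
    (case \<Gamma> (\<sigma> c) of None \<Rightarrow> None | Some x \<Rightarrow> if a \<in> V (\<sigma> c) then Some (pair x a) else None))" for c
  have \<Delta>: "\<exists>x a. \<Gamma> (\<sigma> c) = Some x \<and> a \<in> V (\<sigma> c) \<and> y = pair x a" if "\<Delta> c = Some y" for c y
    using that by (auto simp: \<Delta>_def split: list.splits option.splits if_splits)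
  have "sub A \<Delta> \<sigma> \<Gamma>" unfolding sub_def using \<Delta> by (intro exI[of _ p0]) fastforce
  moreover have "holds A \<Delta> (\<lambda>c. V (\<sigma> c))" unfolding holds_def using \<Delta> by (intro exI[of _ p1]) fastforce
  ultimately have "holds A \<Delta> (\<lambda>c. W (\<sigma> c))" using R by blast
  then obtain r where r: "\<forall>c x. \<Delta> c = Some x \<longrightarrow> (\<exists>y\<in>W (\<sigma> c). A r x = Some y)"
    unfolding holds_def by (rule exE)
  let ?t = "App (Cst r) (pairT (Var 0) (Var 1))"
  obtain t where t: "\<forall>x. \<exists>b. A t x = Some b \<and>
     (\<forall>y z. ev (env [x, y]) ?t = Some z \<longrightarrow> A b y = Some z)"
    using ex_lam2[of ?t] by blast
  show "holds A \<Gamma> (\<lambda>c. imp A (V c) (W c))"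
    unfolding holds_def
  proof (intro exI[of _ t] allI impI)
    fix c x assume c: "\<Gamma> c = Some x"
    obtain b where b: "A t x = Some b" "\<And>y z. ev (env [x, y]) ?t = Some z \<Longrightarrow> A b y = Some z"
      using t by blast
    have "\<exists>z\<in>W c. A b a = Some z" if "a \<in> V c" for a
    proof -
      have "\<Delta> (fst c, a # snd c) = Some (pair x a)" using c that by (simp add: \<Delta>_def \<sigma>_def)
      then obtain z where "z \<in> W c" "A r (pair x a) = Some z" using r by (fastforce simp: \<sigma>_def)
      then show ?thesis using b(2)[of a z] by auto
    qed
    then show "\<exists>y\<in>imp A (V c) (W c). A t x = Some y" using b(1) by (auto simp: imp_iff)
  qed
qed

lemma holds_apply_uniform:
  assumes "\<And>c. c \<in> dom \<Gamma> \<Longrightarrow> r \<in> imp A (\<phi> c) (\<psi> c)" "holds A \<Gamma> \<phi>"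
  shows "holds A \<Gamma> \<psi>"
proof -
  obtain s where s: "\<forall>c x. \<Gamma> c = Some x \<longrightarrow> (\<exists>y\<in>\<phi> c. A s x = Some y)"
    using assms(2) unfolding holds_def by (rule exE)
  show ?thesis by (rule holds_compose[of _ s _ r]) (use assms(1) s in \<open>meson impE domI\<close>)
qed

lemma holds_le_operator:
  assumes "le_operator A J K" "holds A \<Gamma> (\<lambda>c. J (\<phi> c))"
  shows "holds A \<Gamma> (\<lambda>c. K (\<phi> c))"
proof -
  obtain r where "\<And>V. r \<in> imp A (J V) (K V)" using assms(1) unfolding le_operator_def by blast
  then show ?thesis by (rule holds_apply_uniform[OF _ assms(2)])
qed

end

locale pca_local_operator = pca_pairing +
  fixes J :: "'a set \<Rightarrow> 'a set"
  assumes local_op: "local_operator A J"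
begin

lemma J_unit:
  assumes "holds A \<Gamma> \<phi>" shows "holds A \<Gamma> (\<lambda>c. J (\<phi> c))"
proof -
  obtain u where "\<forall>V. u \<in> imp A V (J V)" using local_operatorD[OF local_op] by blast
  then show ?thesis by (intro holds_apply_uniform[OF _ assms]) (rule spec)
qed

text \<open>Modus ponens under \<open>J\<close>, with the implication from \<open>\<phi>\<close> to
  \<open>J \<psi>\<close> in its Kripke reading. Functoriality and multiplication of
  \<open>J\<close> enter the arguments below in this combined form.\<close>

lemma J_bind:
  assumes "holds A \<Gamma> (\<lambda>c. J (\<phi> c))"
    and "\<And>\<Delta> \<sigma>. sub A \<Delta> \<sigma> \<Gamma> \<Longrightarrow> holds A \<Delta> (\<lambda>c. \<phi> (\<sigma> c)) \<Longrightarrow> holds A \<Delta> (\<lambda>c. J (\<psi> (\<sigma> c)))"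
  shows "holds A \<Gamma> (\<lambda>c. J (\<psi> c))"
proof -
  obtain u j m where j: "\<forall>V. j \<in> imp A (J (J V)) (J V)"
    and m: "\<forall>V W. m \<in> imp A (imp A V W) (imp A (J V) (J W))"
    using local_operatorD[OF local_op] by (elim exE conjE)
  have "holds A \<Gamma> (\<lambda>c. imp A (\<phi> c) (J (\<psi> c)))" unfolding holds_imp using assms(2) by blast
  then have "holds A \<Gamma> (\<lambda>c. imp A (J (\<phi> c)) (J (J (\<psi> c))))"
    by (rule holds_apply_uniform[where r = m, rotated]) (simp add: m)
  then have "holds A \<Gamma> (\<lambda>c. J (J (\<psi> c)))"
    using assms(1) sub_refl[of \<Gamma>] unfolding holds_imp by (fastforce dest: spec[of _ \<Gamma>] spec[of _ id])
  then show ?thesis by (rule holds_apply_uniform[where r = j, rotated]) (simp add: j)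
qed

end

definition stage_dense ::
  "'a papp \<Rightarrow> ('a set \<Rightarrow> 'a set) \<Rightarrow> ('u, 'a) rtobj \<Rightarrow> ('u, 'a) rtobj \<Rightarrow> ('u \<Rightarrow> 'u \<Rightarrow> 'a set) \<Rightarrow> bool" where
  "stage_dense A J X Y M \<longleftrightarrow> (\<forall>\<Gamma>. \<forall>y. ex A \<Gamma> Y y \<longrightarrow>
     holds A \<Gamma> (\<lambda>c. J (\<Union>x\<in>Car X. M x (y c))))"

text \<open>Closedness of equality is asked of all elements of the carrier, existing or not, so
  existence is closed as well. The truth value object and the direct images satisfy this.\<close>

definition separated :: "'a papp \<Rightarrow> ('a set \<Rightarrow> 'a set) \<Rightarrow> ('u, 'a) rtobj \<Rightarrow> bool" where
  "separated A J S \<longleftrightarrow> (\<forall>\<Gamma>. \<forall>s\<in>els \<Gamma> (Car S). \<forall>s'\<in>els \<Gamma> (Car S).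
     holds A \<Gamma> (\<lambda>c. J (Eq S (s c) (s' c))) \<longrightarrow> eq A \<Gamma> S s s')"

locale pca_universe = pca_local_operator +
  fixes U :: "'u set set" and code :: "'a \<Rightarrow> 'u"
  assumes universe: "universe U code"
begin

text \<open>When a conclusion under \<open>J\<close> is to be proved about \<open>y\<close>, density
  permits the assumption that \<open>y\<close> comes from \<open>X\<close>.\<close>

lemma dense_elim:
  assumes "stage_dense A J X Y M" "ex A \<Gamma> Y y"
    and "\<And>\<Delta> \<sigma> x. sub A \<Delta> \<sigma> \<Gamma> \<Longrightarrow> rel A \<Delta> X Y M x (y \<circ> \<sigma>) \<Longrightarrow> holds A \<Delta> (\<lambda>c. J (\<psi> (\<sigma> c)))"
  shows "holds A \<Gamma> (\<lambda>c. J (\<psi> c))"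
proof (rule J_bind)
  show "holds A \<Gamma> (\<lambda>c. J (\<Union>x\<in>Car X. M x (y c)))"
    using assms(1,2) unfolding stage_dense_def by blast
  fix \<Delta> \<sigma>
  assume s: "sub A \<Delta> \<sigma> \<Gamma>" "holds A \<Delta> (\<lambda>c. \<Union>x\<in>Car X. M x (y (\<sigma> c)))"
  then obtain x where "x \<in> els \<Delta> (Car X)" "holds A \<Delta> (\<lambda>c. M (x c) (y (\<sigma> c)))"
    unfolding holds_UN by blast
  moreover have "y \<circ> \<sigma> \<in> els \<Delta> (Car Y)" using assms(2) by (intro els_sub[OF s(1)]) (simp add: ex_def)
  ultimately have "rel A \<Delta> X Y M x (y \<circ> \<sigma>)" by (simp add: rel_def)
  then show "holds A \<Delta> (\<lambda>c. J (\<psi> (\<sigma> c)))" by (rule assms(3)[OF s(1)])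
qed

text \<open>The values of the two extensions agree wherever \<open>y\<close> comes from
  \<open>X\<close>, so by density they agree under \<open>J\<close>, and equality in
  \<open>S\<close> is closed.\<close>

lemma dense_unique:
  assumes M: "stage_fun A X Y M" "stage_dense A J X Y M"
    and h: "stage_fun A Y S h" "stage_fun A Y S h'"
    and X: "stage_obj A X" and Y: "stage_obj A Y" and S: "stage_obj A S" "separated A J S"
    and e: "rt_comp A (rt_arr A Y S h) (rt_arr A X Y M) = rt_comp A (rt_arr A Y S h') (rt_arr A X Y M)"
  shows "rt_arr A Y S h = rt_arr A Y S h'"
proof (rule rt_arr_eqI[OF h Y])
  fix \<Gamma> y s
  assume ys: "rel A \<Gamma> Y S h y s"
  then have y: "ex A \<Gamma> Y y" using fun_ex[OF h(1)] by blast
  then obtain s' where s': "rel A \<Gamma> Y S h' y s'" using fun_total[OF h(2)] by blast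
  have "holds A \<Gamma> (\<lambda>c. J (Eq S (s' c) (s c)))"
  proof (rule dense_elim[OF M(2) y])
    fix \<Delta> \<sigma> x
    assume sub: "sub A \<Delta> \<sigma> \<Gamma>" and x: "rel A \<Delta> X Y M x (y \<circ> \<sigma>)"
    have "rel A \<Delta> Y S h (y \<circ> \<sigma>) (s \<circ> \<sigma>)" by (rule rel_sub[OF sub ys])
    then obtain y' where y': "rel A \<Delta> X Y M x y'" "rel A \<Delta> Y S h' y' (s \<circ> \<sigma>)"
      using rt_comp_eqD[OF e, of \<Delta> x "s \<circ> \<sigma>"] x by blast
    have "rel A \<Delta> Y S h' (y \<circ> \<sigma>) (s \<circ> \<sigma>)"
      by (rule fun_ext1[OF h(2) S(1) y'(2) fun_single[OF M(1) y'(1) x]])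
    then have "eq A \<Delta> S (s' \<circ> \<sigma>) (s \<circ> \<sigma>)"
      by (rule fun_single[OF h(2) rel_sub[OF sub s']])
    then show "holds A \<Delta> (\<lambda>c. J (Eq S (s' (\<sigma> c)) (s (\<sigma> c))))"
      by (intro J_unit) (simp add: rel_def)
  qed
  moreover have "s \<in> els \<Gamma> (Car S)" "s' \<in> els \<Gamma> (Car S)" using ys s' by (simp_all add: rel_def)
  ultimately have "eq A \<Gamma> S s' s" using S(2) unfolding separated_def by blast
  then show "rel A \<Gamma> Y S h' y s" by (rule fun_ext2[OF h(2) Y s'])
qed

lemma dense_monoE:
  assumes "dense_mono U A J X Y m" and ob: "is_rtobj U A X" "is_rtobj U A Y"
  obtains M where "m = rt_arr A X Y M" "stage_fun A X Y M" "stage_mono A X Y M" "stage_dense A J X Y M"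
proof -
  obtain M where M: "m = rt_arr A X Y M" "entails A (Car Y) (Ex Y) (\<lambda>y. J (\<Union>x\<in>Car X. M x y))"
    and mono: "mono_arr (RT U A) X Y m" using assms(1) unfolding dense_mono_def by blast
  then obtain M' where "m = rt_arr A X Y M'" "stage_fun A X Y M'"
    unfolding mono_arr_def Hom_RT by blast
  \<comment> \<open>\<open>dense_mono\<close> gives a representative \<open>M\<close> not known to
    be functional, but \<open>M\<close> lies in the class of the functional relation
    \<open>M'\<close>.\<close>
  then have fM: "stage_fun A X Y M" using M(1) stage_fun_cong[of X Y M' M] by (simp add: rt_arr_eq_iff)
  moreover have "stage_dense A J X Y M"
    using M(2) unfolding stage_dense_def entails1 ex_def by blast
  ultimately show thesis
    using that M(1) mono mono_arr_iff[OF universe ob fM] by blast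
qed

lemma dense_monoI:
  assumes M: "stage_fun A X Y M" "stage_mono A X Y M" "stage_dense A J X Y M"
    and ob: "is_rtobj U A X" "is_rtobj U A Y"
  shows "dense_mono U A J X Y (rt_arr A X Y M)"
proof -
  have "entails A (Car Y) (Ex Y) (\<lambda>y. J (\<Union>x\<in>Car X. M x y))"
    using M(3) unfolding stage_dense_def entails1 ex_def by blast
  then show ?thesis
    using mono_arr_iff[OF universe ob M(1)] M(2) unfolding dense_mono_def by blast
qed

lemma is_sheafI:
  assumes S: "is_rtobj U A S" "separated A J S"
    and ext: "\<And>X Y M G. is_rtobj U A X \<Longrightarrow> is_rtobj U A Y \<Longrightarrow> stage_fun A X Y M \<Longrightarrow> stage_mono A X Y M \<Longrightarrow>
      stage_dense A J X Y M \<Longrightarrow> stage_fun A X S G \<Longrightarrow>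
      \<exists>H. stage_fun A Y S H \<and> rt_comp A (rt_arr A Y S H) (rt_arr A X Y M) = rt_arr A X S G"
  shows "is_sheaf U A J S"
  unfolding is_sheaf_def
proof (intro conjI ballI allI impI)
  show "S \<in> Ob (RT U A)" using S by simp
  fix X Y m g
  assume ob: "X \<in> Ob (RT U A)" "Y \<in> Ob (RT U A)" and dm: "dense_mono U A J X Y m"
    and g: "g \<in> Hom (RT U A) X S"
  then have ob': "is_rtobj U A X" "is_rtobj U A Y" by simp_all
  obtain M where M: "m = rt_arr A X Y M" "stage_fun A X Y M" "stage_mono A X Y M" "stage_dense A J X Y M"
    using dense_monoE[OF dm ob'] .
  obtain G where G: "g = rt_arr A X S G" "stage_fun A X S G" using g unfolding Hom_RT by blast
  obtain H where H: "stage_fun A Y S H" "rt_comp A (rt_arr A Y S H) (rt_arr A X Y M) = rt_arr A X S G"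
    using ext[OF ob' M(2-4) G(2)] by blast
  show "\<exists>!h. h \<in> Hom (RT U A) Y S \<and> Comp (RT U A) h m = g"
  proof (rule ex1I[of _ "rt_arr A Y S H"])
    show "rt_arr A Y S H \<in> Hom (RT U A) Y S \<and> Comp (RT U A) (rt_arr A Y S H) m = g"
      using H Hom_RT_arr[OF H(1)] M(1) G(1) by simp
    fix h assume h: "h \<in> Hom (RT U A) Y S \<and> Comp (RT U A) h m = g"
    then obtain H' where H': "h = rt_arr A Y S H'" "stage_fun A Y S H'" unfolding Hom_RT by blast
    show "h = rt_arr A Y S H"
      unfolding H'(1)
      by (rule dense_unique[OF M(2,4) H'(2) H(1) obj[OF ob'(1)] obj[OF ob'(2)] obj[OF S(1)] S(2)])
        (use h H(2) H'(1) M(1) G(1) in simp)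
  qed
qed

section \<open>The object of closed truth values\<close>

definition enc :: "'a set \<Rightarrow> 'u" where "enc = (SOME e. inj e \<and> range e \<in> U)"
definition dec :: "'u \<Rightarrow> 'a set" where "dec = inv enc"

text \<open>Subsets of \<open>A\<close> are coded by functions from \<open>A\<close> to two points
  of an infinite small set, using the closure of \<open>U\<close> under \<open>A\<close>-indexed
  powers.\<close>

lemma enc: "inj enc" "range enc \<in> U"
proof -
  have sub: "\<And>S T. S \<in> U \<Longrightarrow> T \<subseteq> S \<Longrightarrow> T \<in> U"
    and pow: "\<And>S. S \<in> U \<Longrightarrow> \<exists>h :: ('a \<Rightarrow> 'u) \<Rightarrow> 'u. inj_on h {g. range g \<subseteq> S} \<and> h ` {g. range g \<subseteq> S} \<in> U"
    and inf: "\<exists>N\<in>U. infinite N"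
    using universe unfolding universe_def by simp_all
  obtain N where N: "N \<in> U" "infinite N" using inf by blast
  obtain a where a: "a \<in> N" using N(2) by fastforce
  obtain b where b: "b \<in> N - {a}" using N(2) by (metis finite.emptyI infinite_remove all_not_in_conv)
  obtain h :: "('a \<Rightarrow> 'u) \<Rightarrow> 'u" where h: "inj_on h {g. range g \<subseteq> N}" "h ` {g. range g \<subseteq> N} \<in> U"
    using pow[OF N(1)] by blast
  let ?g = "\<lambda>V x. if x \<in> V then a else b"
  have g: "?g V \<in> {g. range g \<subseteq> N}" for V :: "'a set" using a b by auto
  have "inj (\<lambda>V. h (?g V))"
  proof (rule injI)
    fix V W assume "h (?g V) = h (?g W)"
    then have "?g V = ?g W" using inj_onD[OF h(1) _ g g] by blast
    then have "x \<in> V \<longleftrightarrow> x \<in> W" for x using b by (drule_tac fun_cong[of _ _ x]) (auto split: if_splits)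
    then show "V = W" by blast
  qed
  moreover have "range (\<lambda>V. h (?g V)) \<in> U" using g by (intro sub[OF h(2)]) blast
  ultimately have "\<exists>e :: 'a set \<Rightarrow> 'u. inj e \<and> range e \<in> U" by blast
  from someI_ex[OF this] show "inj enc" "range enc \<in> U" by (simp_all add: enc_def)
qed

lemma dec_enc [simp]: "dec (enc V) = V"
  by (simp add: dec_def enc(1))

text \<open>The \<open>J\<close>-closed truth values, presented as a quotient: all subsets of
  \<open>A\<close> are kept, and two are identified when \<open>J\<close> makes them
  equivalent.\<close>

definition Omega :: "('u, 'a) rtobj" where
  "Omega = \<lparr>Car = range enc, Ex = (\<lambda>_. UNIV),
     Eq = (\<lambda>v w. meet A (imp A (J (dec v)) (J (dec w))) (imp A (J (dec w)) (J (dec v))))\<rparr>"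

abbreviation tr :: "('u, 'a) stage \<Rightarrow> ('u, 'a) element \<Rightarrow> bool" where
  "tr \<Gamma> v \<equiv> holds A \<Gamma> (\<lambda>c. J (dec (v c)))"

lemma eq_Omega: "eq A \<Gamma> Omega v w \<longleftrightarrow> v \<in> els \<Gamma> (range enc) \<and> w \<in> els \<Gamma> (range enc) \<and>
    (\<forall>\<Delta> \<sigma>. sub A \<Delta> \<sigma> \<Gamma> \<longrightarrow> (tr \<Delta> (v \<circ> \<sigma>) \<longleftrightarrow> tr \<Delta> (w \<circ> \<sigma>)))"
  unfolding rel_def Omega_def by (simp add: holds_meet holds_imp) blast

lemma ex_Omega: "ex A \<Gamma> Omega v \<longleftrightarrow> v \<in> els \<Gamma> (range enc)"
  by (simp add: ex_def Omega_def holds_UNIV)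

lemma is_rtobj_Omega: "is_rtobj U A Omega"
proof -
  have "stage_obj A Omega" by (rule stage_objI; unfold eq_Omega ex_Omega) simp_all
  then show ?thesis by (simp add: is_rtobj_iff) (simp add: Omega_def enc(2))
qed

lemma sub_comp_tr: "sub A \<Delta> \<sigma> \<Gamma> \<Longrightarrow> tr \<Gamma> v \<Longrightarrow> tr \<Delta> (v \<circ> \<sigma>)"
  using holds_sub[of \<Delta> \<sigma> \<Gamma> "\<lambda>c. J (dec (v c))"] by simp

lemma separated_Omega: "separated A J Omega"
  unfolding separated_def
proof (intro allI ballI impI)
  fix \<Gamma> :: "('u, 'a) stage" and v w
  assume vw: "v \<in> els \<Gamma> (Car Omega)" "w \<in> els \<Gamma> (Car Omega)"
    and J: "holds A \<Gamma> (\<lambda>c. J (Eq Omega (v c) (w c)))"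
  have "tr \<Delta> (v \<circ> \<sigma>) \<longleftrightarrow> tr \<Delta> (w \<circ> \<sigma>)" if sub: "sub A \<Delta> \<sigma> \<Gamma>" for \<Delta> \<sigma>
  proof -
    have J': "holds A \<Delta> (\<lambda>c. J (Eq Omega (v (\<sigma> c)) (w (\<sigma> c))))" by (rule holds_sub[OF sub J])
    have e: "tr \<Theta> (v \<circ> \<sigma> \<circ> \<tau>) \<longleftrightarrow> tr \<Theta> (w \<circ> \<sigma> \<circ> \<tau>)"
      if t: "sub A \<Theta> \<tau> \<Delta>" "holds A \<Theta> (\<lambda>c. Eq Omega (v (\<sigma> (\<tau> c))) (w (\<sigma> (\<tau> c))))" for \<Theta> \<tau>
    proof -
      have "eq A \<Theta> Omega (v \<circ> \<sigma> \<circ> \<tau>) (w \<circ> \<sigma> \<circ> \<tau>)"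
        using t els_sub[OF t(1) els_sub[OF sub vw(1)]] els_sub[OF t(1) els_sub[OF sub vw(2)]]
        by (simp add: rel_def)
      then show ?thesis unfolding eq_Omega using sub_refl[of \<Theta>] by fastforce
    qed
    show ?thesis
    proof
      assume v: "tr \<Delta> (v \<circ> \<sigma>)"
      have "holds A \<Delta> (\<lambda>c. J (dec (w (\<sigma> c))))"
        by (rule J_bind[OF J']) (use e sub_comp_tr[OF _ v] in simp)
      then show "tr \<Delta> (w \<circ> \<sigma>)" by simp
    next
      assume w: "tr \<Delta> (w \<circ> \<sigma>)"
      have "holds A \<Delta> (\<lambda>c. J (dec (v (\<sigma> c))))"
        by (rule J_bind[OF J']) (use e sub_comp_tr[OF _ w] in simp)
      then show "tr \<Delta> (v \<circ> \<sigma>)" by simp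
    qed
  qed
  then show "eq A \<Gamma> Omega v w" unfolding eq_Omega using vw by (simp add: Omega_def)
qed

text \<open>The classifying map of the closure of \<open>\<chi>\<close>: \<open>y\<close> is sent to
  every truth value whose closure is equivalent to that of \<open>\<chi> y\<close>.\<close>

definition chi :: "('u, 'a) rtobj \<Rightarrow> ('u \<Rightarrow> 'a set) \<Rightarrow> 'u \<Rightarrow> 'u \<Rightarrow> 'a set" where
  "chi Y \<chi> y v = meet A (Ex Y y)
     (meet A (imp A (J (dec v)) (J (\<chi> y))) (imp A (J (\<chi> y)) (J (dec v))))"

lemma rel_chi: "rel A \<Gamma> Y Omega (chi Y \<chi>) y v \<longleftrightarrow> ex A \<Gamma> Y y \<and> v \<in> els \<Gamma> (range enc) \<and>
    (\<forall>\<Delta> \<sigma>. sub A \<Delta> \<sigma> \<Gamma> \<longrightarrow> (tr \<Delta> (v \<circ> \<sigma>) \<longleftrightarrow> holds A \<Delta> (\<lambda>c. J (\<chi> (y (\<sigma> c))))))"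
  unfolding rel_def chi_def ex_def by (simp add: holds_meet holds_imp Omega_def) blast

lemma stage_fun_chi:
  assumes Y: "stage_obj A Y"
    and ext: "\<And>\<Gamma> y y'. eq A \<Gamma> Y y y' \<Longrightarrow> holds A \<Gamma> (\<lambda>c. J (\<chi> (y c))) \<Longrightarrow> holds A \<Gamma> (\<lambda>c. J (\<chi> (y' c)))"
  shows "stage_fun A Y Omega (chi Y \<chi>)"
proof (rule stage_funI)
  fix \<Gamma> y y' v w
  assume yv: "rel A \<Gamma> Y Omega (chi Y \<chi>) y v"
  show "ex A \<Gamma> Y y" "ex A \<Gamma> Omega v" using yv unfolding rel_chi ex_Omega by simp_all
  show "eq A \<Gamma> Omega v w" if "rel A \<Gamma> Y Omega (chi Y \<chi>) y w"
    using yv that unfolding rel_chi eq_Omega by simp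
  assume y: "eq A \<Gamma> Y y y'" and v: "eq A \<Gamma> Omega v w"
  have "holds A \<Delta> (\<lambda>c. J (\<chi> (y (\<sigma> c)))) \<longleftrightarrow> holds A \<Delta> (\<lambda>c. J (\<chi> (y' (\<sigma> c))))"
    if sub: "sub A \<Delta> \<sigma> \<Gamma>" for \<Delta> \<sigma>
    using ext[of \<Delta> "y \<circ> \<sigma>" "y' \<circ> \<sigma>"] ext[of \<Delta> "y' \<circ> \<sigma>" "y \<circ> \<sigma>"] rel_sub[OF sub y] eq_sym[OF Y]
    by auto
  then show "rel A \<Gamma> Y Omega (chi Y \<chi>) y' w"
    using yv v eq_ex[OF Y y] unfolding rel_chi eq_Omega by simp
next
  fix \<Gamma> y
  assume "ex A \<Gamma> Y y"
  then have "rel A \<Gamma> Y Omega (chi Y \<chi>) y (\<lambda>c. enc (\<chi> (y c)))"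
    unfolding rel_chi by (simp add: els_def)
  then show "\<exists>v. rel A \<Gamma> Y Omega (chi Y \<chi>) y v" by blast
qed

lemma is_sheaf_Omega: "is_sheaf U A J Omega"
proof (rule is_sheafI[OF is_rtobj_Omega separated_Omega])
  fix X Y M G
  assume ob: "is_rtobj U A X" "is_rtobj U A Y" and M: "stage_fun A X Y M" "stage_mono A X Y M"
    "stage_dense A J X Y M" and G: "stage_fun A X Omega G"
  note oX = obj[OF ob(1)] and oY = obj[OF ob(2)] and oO = obj[OF is_rtobj_Omega]
  \<comment> \<open>\<open>\<chi> y\<close> says that \<open>y\<close> comes from some
    \<open>x\<close> whose value under \<open>G\<close> is true. By \<open>key\<close> this is
    \<open>G\<close> again on \<open>X\<close>, up to closure; as \<open>M\<close> is monic, the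
    choice of \<open>x\<close> is immaterial.\<close>
  define \<chi> where "\<chi> y = (\<Union>x\<in>Car X. \<Union>v\<in>Car Omega. meet A (meet A (M x y) (G x v)) (dec v))" for y
  have \<chi>: "holds A \<Gamma> (\<lambda>c. \<chi> (y c)) \<longleftrightarrow>
      (\<exists>x v. rel A \<Gamma> X Y M x y \<and> rel A \<Gamma> X Omega G x v \<and> holds A \<Gamma> (\<lambda>c. dec (v c)))"
    if "y \<in> els \<Gamma> (Car Y)" for \<Gamma> y
    unfolding \<chi>_def holds_UN holds_meet rel_def using that by blast
  have fchi: "stage_fun A Y Omega (chi Y \<chi>)"
  proof (rule stage_fun_chi[OF oY])
    fix \<Gamma> y y'
    assume y: "eq A \<Gamma> Y y y'" and J: "holds A \<Gamma> (\<lambda>c. J (\<chi> (y c)))"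
    show "holds A \<Gamma> (\<lambda>c. J (\<chi> (y' c)))"
    proof (rule J_bind[OF J], rule J_unit)
      fix \<Delta> \<sigma>
      assume sub: "sub A \<Delta> \<sigma> \<Gamma>" and h: "holds A \<Delta> (\<lambda>c. \<chi> (y (\<sigma> c)))"
      have yy: "eq A \<Delta> Y (y \<circ> \<sigma>) (y' \<circ> \<sigma>)" by (rule rel_sub[OF sub y])
      then have els: "y \<circ> \<sigma> \<in> els \<Delta> (Car Y)" "y' \<circ> \<sigma> \<in> els \<Delta> (Car Y)" by (simp_all add: rel_def)
      have "holds A \<Delta> (\<lambda>c. \<chi> ((y \<circ> \<sigma>) c))" using h by simp
      then have "holds A \<Delta> (\<lambda>c. \<chi> ((y' \<circ> \<sigma>) c))"
        unfolding \<chi>[OF els(1)] \<chi>[OF els(2)] using fun_ext2[OF M(1) oX _ yy] by blast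
      then show "holds A \<Delta> (\<lambda>c. \<chi> (y' (\<sigma> c)))" by simp
    qed
  qed
  have key: "tr \<Gamma> w \<longleftrightarrow> holds A \<Gamma> (\<lambda>c. J (\<chi> (y c)))"
    if x: "rel A \<Gamma> X Y M x y" and w: "rel A \<Gamma> X Omega G x w" for \<Gamma> x y w
  proof
    assume J: "tr \<Gamma> w"
    show "holds A \<Gamma> (\<lambda>c. J (\<chi> (y c)))"
    proof (rule J_bind[OF J], rule J_unit)
      fix \<Delta> \<sigma>
      assume sub: "sub A \<Delta> \<sigma> \<Gamma>" and h: "holds A \<Delta> (\<lambda>c. dec (w (\<sigma> c)))"
      have "rel A \<Delta> X Y M (x \<circ> \<sigma>) (y \<circ> \<sigma>)" "rel A \<Delta> X Omega G (x \<circ> \<sigma>) (w \<circ> \<sigma>)"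
        using rel_sub[OF sub] x w by blast+
      moreover from this have "y \<circ> \<sigma> \<in> els \<Delta> (Car Y)" by (simp add: rel_def)
      ultimately have "holds A \<Delta> (\<lambda>c. \<chi> ((y \<circ> \<sigma>) c))" using \<chi> h by fastforce
      then show "holds A \<Delta> (\<lambda>c. \<chi> (y (\<sigma> c)))" by simp
    qed
  next
    assume J: "holds A \<Gamma> (\<lambda>c. J (\<chi> (y c)))"
    show "tr \<Gamma> w"
    proof (rule J_bind[OF J])
      fix \<Delta> \<sigma>
      assume sub: "sub A \<Delta> \<sigma> \<Gamma>" and h: "holds A \<Delta> (\<lambda>c. \<chi> (y (\<sigma> c)))"
      have xs: "rel A \<Delta> X Y M (x \<circ> \<sigma>) (y \<circ> \<sigma>)" and ws: "rel A \<Delta> X Omega G (x \<circ> \<sigma>) (w \<circ> \<sigma>)"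
        using rel_sub[OF sub] x w by blast+
      then have "y \<circ> \<sigma> \<in> els \<Delta> (Car Y)" by (simp add: rel_def)
      then obtain x' w' where x': "rel A \<Delta> X Y M x' (y \<circ> \<sigma>)" "rel A \<Delta> X Omega G x' w'"
        "holds A \<Delta> (\<lambda>c. dec (w' c))"
        using \<chi>[of "y \<circ> \<sigma>" \<Delta>] h by auto
      have "rel A \<Delta> X Omega G (x \<circ> \<sigma>) w'"
        by (rule fun_ext1[OF G oO x'(2) stage_monoD[OF M(2) x'(1) xs]])
      then have "eq A \<Delta> Omega w' (w \<circ> \<sigma>)" using fun_single[OF G] ws by blast
      moreover have "tr \<Delta> w'" by (rule J_unit[OF x'(3)])
      ultimately have "tr \<Delta> (w \<circ> \<sigma>)" unfolding eq_Omega using sub_refl[of \<Delta>] by fastforce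
      then show "holds A \<Delta> (\<lambda>c. J (dec (w (\<sigma> c))))" by simp
    qed
  qed
  have "rt_comp A (rt_arr A Y Omega (chi Y \<chi>)) (rt_arr A X Y M) = rt_arr A X Omega G"
  proof (rule rt_comp_eqI'[OF M(1) fchi G oX oY oO])
    fix \<Gamma> x y v
    assume xy: "rel A \<Gamma> X Y M x y" and yv: "rel A \<Gamma> Y Omega (chi Y \<chi>) y v"
    obtain w where w: "rel A \<Gamma> X Omega G x w" using xy fun_ex[OF M(1)] fun_total[OF G] by blast
    have "tr \<Delta> (w \<circ> \<sigma>) \<longleftrightarrow> tr \<Delta> (v \<circ> \<sigma>)" if sub: "sub A \<Delta> \<sigma> \<Gamma>" for \<Delta> \<sigma>
      using key[OF rel_sub[OF sub xy] rel_sub[OF sub w]] yv sub unfolding rel_chi by simp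
    moreover have "w \<in> els \<Gamma> (range enc)" using fun_ex[OF G w] by (simp add: ex_Omega)
    ultimately have "eq A \<Gamma> Omega w v" using yv unfolding eq_Omega rel_chi by blast
    then show "rel A \<Gamma> X Omega G x v" by (rule fun_ext2[OF G oX w])
  qed
  with fchi show "\<exists>H. stage_fun A Y Omega H \<and>
      rt_comp A (rt_arr A Y Omega H) (rt_arr A X Y M) = rt_arr A X Omega G" by blast
qed

lemma Sh_simps [simp]:
  "Ob (Sh U A J) = {S. is_rtobj U A S \<and> is_sheaf U A J S}" "Hom (Sh U A J) = Hom (RT U A)"
  "Id (Sh U A J) = Id (RT U A)" "Comp (Sh U A J) = rt_comp A"
  by (auto simp: Sh_def full_sub_def RT_def)

text \<open>Two maps to the object of closed truth values that agree on a subobject inverted by the local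
  operator are equal; applied to the truth value ``\<open>y\<close> lies in the subobject'' and to ``true''
  this gives density.\<close>

lemma inverts_imp_dense:
  assumes inv: "inverts U A J X Y (rt_arr A X Y M)"
    and ob: "is_rtobj U A X" "is_rtobj U A Y" and M: "stage_fun A X Y M"
  shows "stage_dense A J X Y M"
proof -
  note oX = obj[OF ob(1)] and oY = obj[OF ob(2)] and oO = obj[OF is_rtobj_Omega]
  let ?m = "rt_arr A X Y M"
  obtain LX eX LY eY l where X: "sheafification U A J X LX eX" and Y: "sheafification U A J Y LY eY"
    and l: "l \<in> Hom (RT U A) LX LY" "rt_comp A l eX = rt_comp A eY ?m"
    and iso: "iso_arr (Sh U A J) LX LY l"
    using inv unfolding inverts_def by auto
  have L: "is_rtobj U A LX" "is_rtobj U A LY" "eX \<in> Hom (RT U A) X LX" "eY \<in> Hom (RT U A) Y LY"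
    using X Y unfolding sheafification_def by simp_all
  obtain l' where l': "l' \<in> Hom (RT U A) LY LX" "rt_comp A l l' = rt_arr A LY LY (Eq LY)"
    using iso unfolding iso_arr_def by auto
  let ?\<chi> = "\<lambda>y. \<Union>x\<in>Car X. M x y"
  let ?c = "chi Y ?\<chi>" and ?t = "chi Y (\<lambda>_. UNIV)"
  have c: "stage_fun A Y Omega ?c"
  proof (rule stage_fun_chi[OF oY])
    fix \<Gamma> y y'
    assume y: "eq A \<Gamma> Y y y'" and J: "holds A \<Gamma> (\<lambda>c. J (?\<chi> (y c)))"
    show "holds A \<Gamma> (\<lambda>c. J (?\<chi> (y' c)))"
    proof (rule J_bind[OF J], rule J_unit)
      fix \<Delta> \<sigma>
      assume sub: "sub A \<Delta> \<sigma> \<Gamma>" and h: "holds A \<Delta> (\<lambda>c. ?\<chi> (y (\<sigma> c)))"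
      have yy: "eq A \<Delta> Y (y \<circ> \<sigma>) (y' \<circ> \<sigma>)" by (rule rel_sub[OF sub y])
      obtain x where "rel A \<Delta> X Y M x (y \<circ> \<sigma>)" using h yy unfolding holds_UN by (auto simp: rel_def)
      then have "rel A \<Delta> X Y M x (y' \<circ> \<sigma>)" by (rule fun_ext2[OF M oX _ yy])
      then show "holds A \<Delta> (\<lambda>c. ?\<chi> (y' (\<sigma> c)))" unfolding holds_UN by (auto simp: rel_def)
    qed
  qed
  have t: "stage_fun A Y Omega ?t" by (rule stage_fun_chi[OF oY])
  have true: "holds A \<Gamma> (\<lambda>c. J UNIV)" for \<Gamma>
    by (rule J_unit) (simp add: holds_UNIV)
  have ct: "rt_comp A (rt_arr A Y Omega ?c) ?m = rt_comp A (rt_arr A Y Omega ?t) ?m"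
  proof (rule rt_comp_eqI[OF M c M t oX oY oY oO])
    fix \<Gamma> x y v
    assume x: "rel A \<Gamma> X Y M x y" and v: "rel A \<Gamma> Y Omega ?c y v"
    have "holds A \<Delta> (\<lambda>c. J (?\<chi> (y (\<sigma> c))))" if "sub A \<Delta> \<sigma> \<Gamma>" for \<Delta> \<sigma>
      using rel_sub[OF that x] unfolding rel_def
      by (intro J_unit) (unfold holds_UN, intro bexI[of _ "x \<circ> \<sigma>"], simp_all)
    then have "rel A \<Gamma> Y Omega ?t y v" using v unfolding rel_chi by (simp add: true)
    then show "\<exists>y. rel A \<Gamma> X Y M x y \<and> rel A \<Gamma> Y Omega ?t y v" using x by blast
  qed
  have Om: "Omega \<in> Ob (Sh U A J)" using is_rtobj_Omega is_sheaf_Omega by simp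
  have extY: "\<exists>h. h \<in> Hom (RT U A) LY Omega \<and> rt_comp A h eY = g" if "g \<in> Hom (RT U A) Y Omega" for g
  proof -
    have "\<exists>!h. h \<in> Hom (RT U A) LY Omega \<and> rt_comp A h eY = g"
      using Y Om that unfolding sheafification_def by simp
    then show ?thesis by (rule ex1_implies_ex)
  qed
  have uniqX: "h = h'" if "h \<in> Hom (RT U A) LX Omega" "h' \<in> Hom (RT U A) LX Omega"
      "rt_comp A h eX = rt_comp A h' eX" for h h'
  proof -
    have "rt_comp A h eX \<in> Hom (RT U A) X Omega"
      by (rule Comp_RT_in_Hom[OF L(3) that(1) ob(1) L(1) is_rtobj_Omega])
    then have "\<exists>!k. k \<in> Hom (RT U A) LX Omega \<and> rt_comp A k eX = rt_comp A h eX"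
      using X Om unfolding sheafification_def by simp
    then show ?thesis using that by metis
  qed
  obtain c' t' where c': "c' \<in> Hom (RT U A) LY Omega" "rt_comp A c' eY = rt_arr A Y Omega ?c"
    and t': "t' \<in> Hom (RT U A) LY Omega" "rt_comp A t' eY = rt_arr A Y Omega ?t"
    using extY[OF Hom_RT_arr[OF c]] extY[OF Hom_RT_arr[OF t]] by blast
  have hl: "rt_comp A (rt_comp A h l) eX = rt_comp A (rt_comp A h eY) ?m"
    if "h \<in> Hom (RT U A) LY Omega" for h
    using Comp_RT_assoc[OF L(3) l(1) that] Comp_RT_assoc[OF Hom_RT_arr[OF M] L(4) that] l(2) by simp
  have "rt_comp A c' l = rt_comp A t' l"
    by (rule uniqX[OF Comp_RT_in_Hom[OF l(1) c'(1) L(1,2) is_rtobj_Omega]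
          Comp_RT_in_Hom[OF l(1) t'(1) L(1,2) is_rtobj_Omega]])
      (simp only: hl[OF c'(1)] hl[OF t'(1)] c'(2) t'(2) ct)
  then have "rt_comp A c' (rt_comp A l l') = rt_comp A t' (rt_comp A l l')"
    using Comp_RT_assoc[OF l'(1) l(1) c'(1)] Comp_RT_assoc[OF l'(1) l(1) t'(1)] by simp
  then have "c' = t'"
    by (simp only: l'(2) Comp_RT_Id(1)[OF c'(1) L(2) is_rtobj_Omega]
        Comp_RT_Id(1)[OF t'(1) L(2) is_rtobj_Omega])
  then have e: "rt_arr A Y Omega ?c = rt_arr A Y Omega ?t" using c' t' by simp
  show ?thesis
    unfolding stage_dense_def
  proof (intro allI impI)
    fix \<Gamma> y assume y: "ex A \<Gamma> Y y"
    \<comment> \<open>The truth value true is a value of \<open>?t\<close> at \<open>y\<close>.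
      Since \<open>?c\<close> and \<open>?t\<close> represent the same arrow, it is also a value of
      \<open>?c\<close>, which means that \<open>y\<close> lies in the closure of the image of
      \<open>M\<close>.\<close>
    let ?v = "\<lambda>_ :: 'u list \<times> 'a list. enc UNIV"
    have "rel A \<Gamma> Y Omega ?t y ?v" unfolding rel_chi using y by (simp add: els_def true)
    then have "rel A \<Gamma> Y Omega ?c y ?v" using e unfolding rt_arr_eq_iff by simp
    then show "holds A \<Gamma> (\<lambda>c. J (?\<chi> (y c)))"
      unfolding rel_chi using sub_refl[of \<Gamma>] true[of \<Gamma>] by (fastforce dest: spec[of _ \<Gamma>] spec[of _ id])
  qed
qed

end

section \<open>Realizability over \<open>A[f]\<close>\<close>

context oracle_pca
begin

text \<open>The codes are fixed as constants so that programs over \<open>A[f]\<close> can be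
  written, in monadic style, as terms over \<open>A\<close> with suspended results.\<close>

definition unit_code :: 'a where "unit_code = (SOME u. \<forall>c. \<exists>e. A u c = Some e \<and> halts e c)"
definition bind_code :: 'a where
  "bind_code = (SOME B. \<forall>g. \<exists>Bg. A B g = Some Bg \<and>
   (\<forall>e. \<exists>e'. A Bg e = Some e' \<and>
      (\<forall>c r c'. halts e c \<longrightarrow> A g c = Some r \<longrightarrow> halts r c' \<longrightarrow> halts e' c')))"
definition app_code :: 'a where
  "app_code = (SOME \<phi>. \<forall>a. \<exists>\<phi>a. A \<phi> a = Some \<phi>a \<and> (\<forall>x. \<exists>e. A \<phi>a x = Some e \<and>
    (\<forall>c. A' a x = Some c \<longrightarrow> halts e c)))"

lemma eval_unit_code:
  assumes "ev \<rho> t = Some c" shows "\<exists>e. ev \<rho> (App (Cst unit_code) t) = Some e \<and> halts e c"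
  using someI_ex[OF ex_unit] assms unfolding unit_code_def[symmetric] by simp

lemma eval_bind_code:
  assumes "\<exists>a. ev \<rho> t = Some a \<and> halts a c"
    and "\<exists>r. ev (\<rho>(n := c)) u = Some r \<and> halts r c'"
  shows "\<exists>e. ev \<rho> (App (App (Cst bind_code) (lm n u)) t) = Some e \<and> halts e c'"
proof -
  obtain a where a: "ev \<rho> t = Some a" "halts a c" using assms(1) by blast
  obtain r where r: "ev (\<rho>(n := c)) u = Some r" "halts r c'" using assms(2) by blast
  obtain g where g: "ev \<rho> (lm n u) = Some g" using eval_lam_Some by blast
  have "A g c = Some r" by (rule eval_lam_app[OF g r(1)])
  moreover obtain Bg e' where "A bind_code g = Some Bg" "A Bg a = Some e'"
    "\<forall>c r c'. halts a c \<longrightarrow> A g c = Some r \<longrightarrow> halts r c' \<longrightarrow> halts e' c'"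
    using someI_ex[OF ex_bind] unfolding bind_code_def[symmetric] by meson
  ultimately show ?thesis using a g r(2) by simp
qed

lemma eval_app_code:
  assumes "ev \<rho> t = Some a" "ev \<rho> u = Some x" "A' a x = Some c"
  shows "\<exists>e. ev \<rho> (App (App (Cst app_code) t) u) = Some e \<and> halts e c"
proof -
  obtain \<phi>a e where "A app_code a = Some \<phi>a" "A \<phi>a x = Some e" "\<forall>c. A' a x = Some c \<longrightarrow> halts e c"
    using someI_ex[OF ex_code] unfolding app_code_def[symmetric] by meson
  then show ?thesis using assms by simp
qed

text \<open>Takes the role of abstraction over \<open>A[f]\<close>: a term over \<open>A\<close>
  that computes a suspended result becomes an element of \<open>A[f]\<close> that returns this
  result.\<close>

lemma ex_adjoin_lam:
  "\<exists>a'. \<forall>x c. (\<exists>e. ev (env [x]) t = Some e \<and> halts e c) \<longrightarrow> A' a' x = Some c"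
proof -
  obtain a where a: "\<forall>x z. ev (env [x]) t = Some z \<longrightarrow> A a x = Some z"
    using ex_lam1[of t] by (rule exE)
  obtain L where L: "\<forall>a. \<exists>a'. A L a = Some a' \<and>
    (\<forall>x e c. A a x = Some e \<longrightarrow> halts e c \<longrightarrow> A' a' x = Some c)" using ex_lift by (rule exE)
  then obtain a' where "\<forall>x e c. A a x = Some e \<longrightarrow> halts e c \<longrightarrow> A' a' x = Some c" by meson
  then show ?thesis using a by meson
qed

text \<open>The pairs formed over \<open>A[f]\<close> are those of \<open>A\<close>. Hence the
  projections of \<open>A\<close> can take apart a pair computed over \<open>A[f]\<close>, as
  \<open>ref_join\<close> requires.\<close>

lemma adjoin_pair:
  "\<exists>q. \<forall>a b. ap2 A' q a b = Some (pair a b)"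
proof -
  obtain L where L: "\<forall>a. \<exists>a'. A L a = Some a' \<and>
    (\<forall>x e c. A a x = Some e \<longrightarrow> halts e c \<longrightarrow> A' a' x = Some c)" using ex_lift by (rule exE)
  let ?t = "App (Cst unit_code) (pairT (Var 0) (Var 1))"
  obtain t where t: "\<forall>a. \<exists>ta. A t a = Some ta \<and>
     (\<forall>b z. ev (env [a, b]) ?t = Some z \<longrightarrow> A ta b = Some z)"
    using ex_lam2[of ?t] by (rule exE)
  obtain q where q: "\<forall>x c. (\<exists>e. ev (env [x])
      (App (Cst unit_code) (App (Cst L) (App (Cst t) (Var 0)))) = Some e \<and> halts e c) \<longrightarrow> A' q x = Some c"
    using ex_adjoin_lam by (rule exE)
  have "ap2 A' q a b = Some (pair a b)" for a b
  proof -
    obtain ta where ta: "A t a = Some ta"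
      "\<And>b z. ev (env [a, b]) ?t = Some z \<Longrightarrow> A ta b = Some z"
      using t by meson
    obtain a' where a': "A L ta = Some a'"
      "\<And>x e c. A ta x = Some e \<Longrightarrow> halts e c \<Longrightarrow> A' a' x = Some c"
      using L by meson
    \<comment> \<open>The value of \<open>q\<close> at \<open>a\<close> must itself be applicable
      over \<open>A[f]\<close>, which is why the program contains \<open>L\<close>.\<close>
    have "A' q a = Some a'" by (rule q[rule_format], rule eval_unit_code) (simp add: ta a')
    moreover have "A' a' b = Some (pair a b)"
    proof -
      obtain e where "ev (env [a, b]) ?t = Some e" "halts e (pair a b)"
        using eval_unit_code[of "env [a, b]" "pairT (Var 0) (Var 1)" "pair a b"]
        by auto
      then show ?thesis using ta(2) a'(2) by blast
    qed
    ultimately show ?thesis by (simp add: ap2_def)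
  qed
  then show ?thesis by blast
qed

end

sublocale oracle_pca \<subseteq> AF: realizability_logic A'
proof
  obtain i where i: "\<forall>x c. (\<exists>e. ev (env [x])
      (App (Cst unit_code) (Var 0)) = Some e \<and> halts e c) \<longrightarrow> A' i x = Some c"
    using ex_adjoin_lam by (rule exE)
  have "A' i x = Some x" for x by (rule i[rule_format], rule eval_unit_code) simp
  then show "\<exists>i. \<forall>x. A' i x = Some x" by blast
next
  fix r r'
  obtain t where t: "\<forall>x c. (\<exists>e. ev (env [x])
      (App (App (Cst bind_code) (lm 1 (App (App (Cst app_code) (Cst r')) (Var 1))))
        (App (App (Cst app_code) (Cst r)) (Var 0))) = Some e \<and> halts e c) \<longrightarrow> A' t x = Some c"
    using ex_adjoin_lam by (rule exE)
  have "A' t x = Some z" if "A' r x = Some y" "A' r' y = Some z" for x y z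
    by (rule t[rule_format], rule eval_bind_code; rule eval_app_code) (use that in simp_all)
  then show "\<exists>t. \<forall>x y z. A' r x = Some y \<longrightarrow> A' r' y = Some z \<longrightarrow> A' t x = Some z" by blast
next
  fix r r' q
  \<comment> \<open>The variables \<open>1\<close>, \<open>2\<close> and \<open>3\<close> hold the
    results of \<open>r\<close>, of \<open>r'\<close>, and of \<open>q\<close> applied to the first
    of these.\<close>
  obtain t where t: "\<forall>x c. (\<exists>e. ev (env [x])
      (App (App (Cst bind_code) (lm 1
        (App (App (Cst bind_code) (lm 2
          (App (App (Cst bind_code) (lm 3 (App (App (Cst app_code) (Var 3)) (Var 2))))
            (App (App (Cst app_code) (Cst q)) (Var 1)))))
          (App (App (Cst app_code) (Cst r')) (Var 0)))))
        (App (App (Cst app_code) (Cst r)) (Var 0))) = Some e \<and> halts e c) \<longrightarrow> A' t x = Some c"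
    using ex_adjoin_lam by (rule exE)
  have "A' t x = Some w" if a: "A' r x = Some y" "A' r' x = Some z" "ap2 A' q y z = Some w" for x y z w
  proof -
    obtain v where v: "A' q y = Some v" "A' v z = Some w"
      using a(3) by (auto simp: ap2_def bind_eq_Some_conv)
    show ?thesis
      by (rule t[rule_format], rule eval_bind_code, rule eval_app_code, simp, simp, rule a(1),
          rule eval_bind_code, rule eval_app_code, simp, simp, rule a(2),
          rule eval_bind_code; rule eval_app_code) (use v in simp_all)
  qed
  then show "\<exists>t. \<forall>x y z w. A' r x = Some y \<longrightarrow> A' r' x = Some z \<longrightarrow> ap2 A' q y z = Some w \<longrightarrow>
      A' t x = Some w" by blast
next
  obtain q where q: "\<forall>a b. ap2 A' q a b = Some (pair a b)" using adjoin_pair by (rule exE)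
  obtain q0 where q0: "\<forall>x c. (\<exists>e. ev (env [x])
      (App (Cst unit_code) (fstT (Var 0))) = Some e \<and> halts e c) \<longrightarrow> A' q0 x = Some c"
    using ex_adjoin_lam by (rule exE)
  obtain q1 where q1: "\<forall>x c. (\<exists>e. ev (env [x])
      (App (Cst unit_code) (sndT (Var 0))) = Some e \<and> halts e c) \<longrightarrow> A' q1 x = Some c"
    using ex_adjoin_lam by (rule exE)
  have "A' q0 (pair a b) = Some a" for a b by (rule q0[rule_format], rule eval_unit_code) simp
  moreover have "A' q1 (pair a b) = Some b" for a b by (rule q1[rule_format], rule eval_unit_code) simp
  ultimately have "pairing A' q q0 q1" unfolding pairing_def using q by blast
  then show "\<exists>p p0 p1. pairing A' p p0 p1" by blast
qed

section \<open>Transfer of truth between \<open>A\<close> and \<open>A[f]\<close>\<close>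

context oracle_pca
begin

text \<open>Realizers are translated by \<open>ex_code\<close> in one direction and by
  \<open>ex_lift\<close> in the other.\<close>

lemma holds_adjoin: "holds A' \<Gamma> \<phi> \<longleftrightarrow> holds A \<Gamma> (\<lambda>c. K (\<phi> c))"
proof
  assume "holds A' \<Gamma> \<phi>"
  then obtain r where r: "\<forall>c x. \<Gamma> c = Some x \<longrightarrow> (\<exists>y\<in>\<phi> c. A' r x = Some y)"
    unfolding holds_def by (rule exE)
  obtain \<phi>r where \<phi>r: "\<forall>x. \<exists>e. A \<phi>r x = Some e \<and> (\<forall>c. A' r x = Some c \<longrightarrow> halts e c)"
    using ex_code by meson
  show "holds A \<Gamma> (\<lambda>c. K (\<phi> c))"
    unfolding holds_def K_def using r \<phi>r by (intro exI[of _ \<phi>r]) fast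
next
  assume "holds A \<Gamma> (\<lambda>c. K (\<phi> c))"
  then obtain r where r: "\<forall>c x. \<Gamma> c = Some x \<longrightarrow> (\<exists>y\<in>K (\<phi> c). A r x = Some y)"
    unfolding holds_def by (rule exE)
  obtain r' where r': "\<forall>x e c. A r x = Some e \<longrightarrow> halts e c \<longrightarrow> A' r' x = Some c"
    using ex_lift by meson
  show "holds A' \<Gamma> \<phi>"
    unfolding holds_def
  proof (intro exI[of _ r'] allI impI)
    fix c x assume "\<Gamma> c = Some x"
    then obtain e where "e \<in> K (\<phi> c)" "A r x = Some e" using r by fast
    then show "\<exists>y\<in>\<phi> c. A' r' x = Some y" using r' unfolding K_def by fast
  qed
qed

end

sublocale oracle_pca \<subseteq> K: pca_local_operator A k s p p0 p1 K
  by unfold_locales (rule local_operator_K)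

context oracle_pca
begin

lemma holds_imp_adjoin: "holds A \<Gamma> \<phi> \<Longrightarrow> holds A' \<Gamma> \<phi>"
  unfolding holds_adjoin by (rule K.J_unit)

lemma holds_adjoin_K: "holds A' \<Gamma> (\<lambda>c. K (\<phi> c)) \<longleftrightarrow> holds A' \<Gamma> \<phi>"
proof
  obtain u j m where j: "\<forall>V. j \<in> imp A (K (K V)) (K V)"
    using local_operatorD[OF local_operator_K] by (elim exE conjE)
  assume "holds A' \<Gamma> (\<lambda>c. K (\<phi> c))"
  then have "holds A \<Gamma> (\<lambda>c. K (K (\<phi> c)))" unfolding holds_adjoin .
  then have "holds A \<Gamma> (\<lambda>c. K (\<phi> c))"
    by (rule holds_apply_uniform[where r = j, rotated]) (simp add: j)
  then show "holds A' \<Gamma> \<phi>" unfolding holds_adjoin .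
next
  show "holds A' \<Gamma> \<phi> \<Longrightarrow> holds A' \<Gamma> (\<lambda>c. K (\<phi> c))"
    unfolding holds_adjoin[of \<Gamma> \<phi>] by (rule holds_imp_adjoin)
qed

text \<open>A refinement of a stage has the same indices, but its realizers also contain results of oracle
  computations; truth over \<open>A[f]\<close> is truth over \<open>A\<close> at some refinement.\<close>

definition ref :: "('u, 'a) stage \<Rightarrow> ('u, 'a) stage \<Rightarrow> bool" where
  "ref \<Gamma> \<Delta> \<longleftrightarrow> dom \<Gamma> = dom \<Delta> \<and> sub A' \<Gamma> id \<Delta>"

lemma ref_els: "ref \<Gamma> \<Delta> \<Longrightarrow> els \<Delta> S = els \<Gamma> S"
  by (simp add: ref_def els_def)

text \<open>Lets facts about \<open>A\<close> be used over \<open>A[f]\<close> without looking into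
  dialogues. The refinement replaces each realizer of the stage by the result that the
  \<open>A[f]\<close>-realizer gives on it, so that over \<open>A\<close> the identity
  suffices.\<close>

lemma holds_adjoin_iff_ref: "holds A' \<Gamma> \<phi> \<longleftrightarrow> (\<exists>\<Delta>. ref \<Gamma> \<Delta> \<and> holds A \<Delta> \<phi>)"
proof
  assume "holds A' \<Gamma> \<phi>"
  then obtain r where r: "\<forall>c x. \<Gamma> c = Some x \<longrightarrow> (\<exists>y\<in>\<phi> c. A' r x = Some y)"
    unfolding holds_def by (rule exE)
  define \<Delta> where "\<Delta> c = Option.bind (\<Gamma> c) (A' r)" for c
  have \<Delta>: "\<exists>y\<in>\<phi> c. \<Delta> c = Some y \<and> A' r x = Some y" if "\<Gamma> c = Some x" for c x
    using r that by (fastforce simp: \<Delta>_def)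
  have "dom \<Gamma> = dom \<Delta>"
  proof
    show "dom \<Gamma> \<subseteq> dom \<Delta>" using \<Delta> by blast
    show "dom \<Delta> \<subseteq> dom \<Gamma>" by (auto simp: \<Delta>_def bind_eq_Some_conv)
  qed
  moreover have "sub A' \<Gamma> id \<Delta>" unfolding sub_def using \<Delta> by (intro exI[of _ r]) fastforce
  moreover have "holds A \<Delta> \<phi>"
  proof -
    obtain i where i: "\<And>x. A i x = Some x" using app_id by blast
    have "\<exists>y\<in>\<phi> c. A i x = Some y" if d: "\<Delta> c = Some x" for c x
    proof -
      obtain z where "\<Gamma> c = Some z" using d by (auto simp: \<Delta>_def bind_eq_Some_conv)
      then show ?thesis using \<Delta> d i by fastforce
    qed
    then show ?thesis unfolding holds_def by blast
  qed
  ultimately show "\<exists>\<Delta>. ref \<Gamma> \<Delta> \<and> holds A \<Delta> \<phi>" unfolding ref_def by blast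
next
  assume "\<exists>\<Delta>. ref \<Gamma> \<Delta> \<and> holds A \<Delta> \<phi>"
  then obtain \<Delta> where "sub A' \<Gamma> id \<Delta>" "holds A' \<Delta> \<phi>"
    using holds_imp_adjoin unfolding ref_def by blast
  from AF.holds_sub[OF this] show "holds A' \<Gamma> \<phi>" by simp
qed

text \<open>Refinements are directed: the realizers of two of them are paired over
  \<open>A[f]\<close> and projected over \<open>A\<close>. This moves finitely many premises to one
  refinement, as recorded by \<open>rel_adjoin2\<close> to \<open>rel_adjoin4\<close>.\<close>

lemma ref_join:
  assumes "ref \<Gamma> \<Delta>" "ref \<Gamma> \<Theta>"
  shows "\<exists>\<Lambda>. ref \<Gamma> \<Lambda> \<and> sub A \<Lambda> id \<Delta> \<and> sub A \<Lambda> id \<Theta>"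
proof -
  obtain r where r: "\<forall>c x. \<Gamma> c = Some x \<longrightarrow> (\<exists>y. \<Delta> c = Some y \<and> A' r x = Some y)"
    using assms(1) by (auto simp: ref_def sub_def)
  obtain r' where r': "\<forall>c x. \<Gamma> c = Some x \<longrightarrow> (\<exists>y. \<Theta> c = Some y \<and> A' r' x = Some y)"
    using assms(2) by (auto simp: ref_def sub_def)
  obtain q where q: "\<forall>a b. ap2 A' q a b = Some (pair a b)" using adjoin_pair by (rule exE)
  obtain t where t: "\<forall>x y z w. A' r x = Some y \<longrightarrow> A' r' x = Some z \<longrightarrow> ap2 A' q y z = Some w \<longrightarrow>
      A' t x = Some w" using AF.app_pair by (rule exE)
  define \<Lambda> where "\<Lambda> c = Option.bind (\<Delta> c) (\<lambda>y. Option.bind (\<Theta> c) (\<lambda>z. Some (pair y z)))" for c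
  have \<Lambda>: "\<exists>y z. \<Delta> c = Some y \<and> \<Theta> c = Some z \<and> w = pair y z" if "\<Lambda> c = Some w" for c w
    using that by (auto simp: \<Lambda>_def bind_eq_Some_conv)
  have "dom \<Gamma> = dom \<Lambda>"
  proof
    show "dom \<Gamma> \<subseteq> dom \<Lambda>" using r r' by (fastforce simp: \<Lambda>_def)
    have "dom \<Lambda> \<subseteq> dom \<Delta>" by (auto simp: \<Lambda>_def bind_eq_Some_conv)
    then show "dom \<Lambda> \<subseteq> dom \<Gamma>" using assms(1) by (simp add: ref_def)
  qed
  moreover have "sub A' \<Gamma> id \<Lambda>"
    unfolding sub_def
  proof (rule exI[of _ t], intro allI impI)
    fix c x assume c: "\<Gamma> c = Some x"
    obtain y where y: "\<Delta> c = Some y" "A' r x = Some y" using r c by blast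
    obtain z where z: "\<Theta> c = Some z" "A' r' x = Some z" using r' c by blast
    have "A' t x = Some (pair y z)" using t y(2) z(2) q by blast
    then show "\<exists>w. \<Lambda> (id c) = Some w \<and> A' t x = Some w" using y z by (simp add: \<Lambda>_def)
  qed
  moreover have "sub A \<Lambda> id \<Delta>" unfolding sub_def using \<Lambda> by (intro exI[of _ p0]) fastforce
  moreover have "sub A \<Lambda> id \<Theta>" unfolding sub_def using \<Lambda> by (intro exI[of _ p1]) fastforce
  ultimately show ?thesis unfolding ref_def by blast
qed

lemma rel_adjoin_iff: "rel A' \<Gamma> X Y R x y \<longleftrightarrow> (\<exists>\<Delta>. ref \<Gamma> \<Delta> \<and> rel A \<Delta> X Y R x y)"
  unfolding rel_def holds_adjoin_iff_ref using ref_els by blast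

lemma ex_adjoin_iff: "ex A' \<Gamma> X x \<longleftrightarrow> (\<exists>\<Delta>. ref \<Gamma> \<Delta> \<and> ex A \<Delta> X x)"
  unfolding ex_def holds_adjoin_iff_ref using ref_els by blast

lemma rel_imp_adjoin: "rel A \<Gamma> X Y R x y \<Longrightarrow> rel A' \<Gamma> X Y R x y"
  and ex_imp_adjoin: "ex A \<Gamma> X x \<Longrightarrow> ex A' \<Gamma> X x"
  by (simp_all add: rel_def ex_def holds_imp_adjoin)

lemma rel_sub_id: "sub A \<Delta> id \<Gamma> \<Longrightarrow> rel A \<Gamma> X Y R x y \<Longrightarrow> rel A \<Delta> X Y R x y"
  using rel_sub[of \<Delta> id \<Gamma>] by simp

lemma rel_ref: "ref \<Gamma> \<Delta> \<Longrightarrow> rel A' \<Delta> X Y R x y \<Longrightarrow> rel A' \<Gamma> X Y R x y"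
  using AF.rel_sub[of \<Gamma> id \<Delta>] by (simp add: ref_def)

lemma rel_adjoin2:
  assumes "rel A' \<Gamma> X Y R x y" "rel A' \<Gamma> X' Y' R' x' y'"
  shows "\<exists>\<Delta>. ref \<Gamma> \<Delta> \<and> rel A \<Delta> X Y R x y \<and> rel A \<Delta> X' Y' R' x' y'"
proof -
  obtain \<Delta> \<Theta> where "ref \<Gamma> \<Delta>" "rel A \<Delta> X Y R x y" "ref \<Gamma> \<Theta>" "rel A \<Theta> X' Y' R' x' y'"
    using assms unfolding rel_adjoin_iff by blast
  then show ?thesis using ref_join rel_sub_id by meson
qed

lemma rel_adjoin3:
  assumes "rel A' \<Gamma> X Y R x y" "rel A' \<Gamma> X' Y' R' x' y'" "rel A' \<Gamma> X'' Y'' R'' x'' y''"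
  shows "\<exists>\<Delta>. ref \<Gamma> \<Delta> \<and> rel A \<Delta> X Y R x y \<and> rel A \<Delta> X' Y' R' x' y' \<and> rel A \<Delta> X'' Y'' R'' x'' y''"
proof -
  obtain \<Delta> \<Theta> where "ref \<Gamma> \<Delta>" "rel A \<Delta> X Y R x y" "rel A \<Delta> X' Y' R' x' y'"
    "ref \<Gamma> \<Theta>" "rel A \<Theta> X'' Y'' R'' x'' y''"
    using rel_adjoin2[OF assms(1,2)] assms(3) unfolding rel_adjoin_iff by blast
  then show ?thesis using ref_join rel_sub_id by meson
qed

lemma rel_adjoin4:
  assumes "rel A' \<Gamma> X Y R x y" "rel A' \<Gamma> X' Y' R' x' y'" "rel A' \<Gamma> X'' Y'' R'' x'' y''"
    "rel A' \<Gamma> V W S v w"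
  shows "\<exists>\<Delta>. ref \<Gamma> \<Delta> \<and> rel A \<Delta> X Y R x y \<and> rel A \<Delta> X' Y' R' x' y' \<and> rel A \<Delta> X'' Y'' R'' x'' y'' \<and>
    rel A \<Delta> V W S v w"
proof -
  obtain \<Delta> \<Theta> where "ref \<Gamma> \<Delta>" "rel A \<Delta> X Y R x y" "rel A \<Delta> X' Y' R' x' y'" "rel A \<Delta> X'' Y'' R'' x'' y''"
    "ref \<Gamma> \<Theta>" "rel A \<Theta> V W S v w"
    using rel_adjoin3[OF assms(1-3)] assms(4) unfolding rel_adjoin_iff by blast
  then show ?thesis using ref_join rel_sub_id by meson
qed

lemma stage_obj_adjoin:
  assumes X: "stage_obj A X" shows "stage_obj A' X"
proof (rule stage_objI)
  fix \<Gamma> x y z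
  show "ex A' \<Gamma> X x" if "eq A' \<Gamma> X x y"
    using that eq_ex[OF X] unfolding rel_adjoin_iff ex_adjoin_iff by blast
  show "eq A' \<Gamma> X x x" if "ex A' \<Gamma> X x"
    using that eq_refl[OF X] unfolding rel_adjoin_iff ex_adjoin_iff by blast
  show "eq A' \<Gamma> X y x" if "eq A' \<Gamma> X x y"
    using that eq_sym[OF X] unfolding rel_adjoin_iff by blast
  show "eq A' \<Gamma> X x z" if "eq A' \<Gamma> X x y" "eq A' \<Gamma> X y z"
    using rel_adjoin2[OF that] eq_trans[OF X] unfolding rel_adjoin_iff by blast
qed

lemma stage_fun_adjoin:
  assumes R: "stage_fun A X Y R" shows "stage_fun A' X Y R"
proof (rule stage_funI)
  fix \<Gamma> x x' y y'
  assume xy: "rel A' \<Gamma> X Y R x y"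
  show "ex A' \<Gamma> X x" "ex A' \<Gamma> Y y"
    using xy fun_ex[OF R] unfolding rel_adjoin_iff ex_adjoin_iff by blast+
  show "rel A' \<Gamma> X Y R x' y'" if "eq A' \<Gamma> X x x'" "eq A' \<Gamma> Y y y'"
    using rel_adjoin3[OF xy that] fun_ext[OF R] unfolding rel_adjoin_iff by blast
  show "eq A' \<Gamma> Y y y'" if "rel A' \<Gamma> X Y R x y'"
    using rel_adjoin2[OF xy that] fun_single[OF R] unfolding rel_adjoin_iff by blast
next
  fix \<Gamma> x
  show "\<exists>y. rel A' \<Gamma> X Y R x y" if "ex A' \<Gamma> X x"
    using that fun_total[OF R] unfolding rel_adjoin_iff ex_adjoin_iff by blast
qed

lemma stage_mono_adjoin:
  assumes "stage_mono A X Y M" shows "stage_mono A' X Y M"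
  unfolding stage_mono_def
proof (intro allI impI)
  fix \<Gamma> x x' y
  assume "rel A' \<Gamma> X Y M x y" "rel A' \<Gamma> X Y M x' y"
  from rel_adjoin2[OF this] show "eq A' \<Gamma> X x x'"
    using stage_monoD[OF assms] unfolding rel_adjoin_iff by blast
qed

lemma stage_terminal_adjoin:
  assumes "stage_terminal A T" and T: "stage_obj A T"
  shows "stage_terminal A' T"
  unfolding stage_terminal_def
proof (intro allI impI conjI)
  fix \<Gamma> x y
  have t: "\<exists>x. ex A \<Delta> T x" "ex A \<Delta> T x \<Longrightarrow> ex A \<Delta> T y \<Longrightarrow> eq A \<Delta> T x y"
    for \<Delta> x y
    using assms(1) unfolding stage_terminal_def by blast+
  show "\<exists>x. ex A' \<Gamma> T x" using t(1)[of \<Gamma>] ex_imp_adjoin by blast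
  assume "ex A' \<Gamma> T x" "ex A' \<Gamma> T y"
  \<comment> \<open>Existence is expressed by self-equality, the form to which
    \<open>rel_adjoin2\<close> applies.\<close>
  then have "eq A' \<Gamma> T x x" "eq A' \<Gamma> T y y" using eq_refl[OF stage_obj_adjoin[OF T]] by blast+
  from rel_adjoin2[OF this] show "eq A' \<Gamma> T x y"
    using t(2) eq_ex[OF T] unfolding rel_adjoin_iff by blast
qed

lemma stage_pullback_adjoin:
  assumes pb: "stage_pullback A P X Y Z p' q f' g"
  shows "stage_pullback A' P X Y Z p' q f' g"
  unfolding stage_pullback_def
proof (intro allI impI conjI)
  fix \<Gamma> w w' x y z
  show "eq A' \<Gamma> P w w'" if "rel A' \<Gamma> P X p' w x" "rel A' \<Gamma> P X p' w' x"
      "rel A' \<Gamma> P Y q w y" "rel A' \<Gamma> P Y q w' y"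
    using rel_adjoin4[OF that] stage_pullbackD(1)[OF pb] unfolding rel_adjoin_iff by blast
  show "\<exists>w. rel A' \<Gamma> P X p' w x \<and> rel A' \<Gamma> P Y q w y" if a: "rel A' \<Gamma> X Z f' x z" "rel A' \<Gamma> Y Z g y z"
  proof -
    obtain \<Delta> where "ref \<Gamma> \<Delta>" "rel A \<Delta> X Z f' x z" "rel A \<Delta> Y Z g y z" using rel_adjoin2[OF a] by blast
    moreover from this obtain w where "rel A \<Delta> P X p' w x" "rel A \<Delta> P Y q w y"
      using stage_pullbackD(2)[OF pb] by blast
    ultimately show ?thesis unfolding rel_adjoin_iff by blast
  qed
  show "\<exists>z. rel A' \<Gamma> X Z f' x z \<and> rel A' \<Gamma> Y Z g y z" if a: "rel A' \<Gamma> P X p' w x" "rel A' \<Gamma> P Y q w y"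
  proof -
    obtain \<Delta> where "ref \<Gamma> \<Delta>" "rel A \<Delta> P X p' w x" "rel A \<Delta> P Y q w y" using rel_adjoin2[OF a] by blast
    moreover from this obtain z where "rel A \<Delta> X Z f' x z" "rel A \<Delta> Y Z g y z"
      using stage_pullbackD(3)[OF pb] by blast
    ultimately show ?thesis unfolding rel_adjoin_iff by blast
  qed
qed

end

section \<open>The geometric inclusion\<close>

locale oracle_universe = oracle_pca +
  fixes U :: "'u set set" and code :: "'a \<Rightarrow> 'u"
  assumes universe: "universe U code"
begin

definition Krel :: "('u \<Rightarrow> 'u \<Rightarrow> 'a set) \<Rightarrow> 'u \<Rightarrow> 'u \<Rightarrow> 'a set" where
  "Krel R x y = K (R x y)"

definition Kobj :: "('u, 'a) rtobj \<Rightarrow> ('u, 'a) rtobj" where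
  "Kobj X = \<lparr>Car = Car X, Ex = (\<lambda>x. K (Ex X x)), Eq = Krel (Eq X)\<rparr>"

abbreviation I where "I \<equiv> inverse_image A' :: (('u, 'a) rtobj, ('u, 'a) rtarr, ('u, 'a) rtobj, ('u, 'a) rtarr) fnctr"

text \<open>The direct image: \<open>K\<close> commutes with unions, hence with existential quantification, so it can
  be applied to objects and functional relations without changing the underlying sets.\<close>

definition G :: "(('u, 'a) rtobj, ('u, 'a) rtarr, ('u, 'a) rtobj, ('u, 'a) rtarr) fnctr" where
  "G = \<lparr>omap = Kobj, amap = (\<lambda>(X, Y, c). (Kobj X, Kobj Y, {H. \<exists>R\<in>c. same_rel A (Kobj X) (Kobj Y) (Krel R) H}))\<rparr>"

lemma Kobj_simps [simp]: "Car (Kobj X) = Car X" "Eq (Kobj X) = Krel (Eq X)"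
  by (simp_all add: Kobj_def)

lemma rel_Kobj [simp]:
  "rel B \<Gamma> (Kobj X) Y R = rel B \<Gamma> X Y R" "rel B \<Gamma> X (Kobj Y) R = rel B \<Gamma> X Y R"
  by (simp_all add: rel_def fun_eq_iff)

text \<open>The dictionary for the direct image: over \<open>A\<close>, applying \<open>K\<close>
  amounts to passing to \<open>A[f]\<close>; over \<open>A[f]\<close>, it has no effect because
  \<open>K\<close> is idempotent.\<close>

lemma rel_Krel [simp]: "rel A \<Gamma> X Y (Krel R) = rel A' \<Gamma> X Y R" "rel A' \<Gamma> X Y (Krel R) = rel A' \<Gamma> X Y R"
  by (simp_all add: rel_def fun_eq_iff Krel_def holds_adjoin_K) (simp add: holds_adjoin)

lemma ex_Kobj [simp]: "ex A \<Gamma> (Kobj X) = ex A' \<Gamma> X" "ex A' \<Gamma> (Kobj X) = ex A' \<Gamma> X"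
  by (simp_all add: ex_def fun_eq_iff Kobj_def holds_adjoin_K) (simp add: holds_adjoin)

lemma stage_obj_Kobj [simp]: "stage_obj A (Kobj X) \<longleftrightarrow> stage_obj A' X" "stage_obj A' (Kobj X) \<longleftrightarrow> stage_obj A' X"
  by (simp_all add: stage_obj_def)

lemma stage_fun_Kobj [simp]:
  "stage_fun A (Kobj X) (Kobj Y) (Krel R) \<longleftrightarrow> stage_fun A' X Y R"
  "stage_fun A' (Kobj X) Y R \<longleftrightarrow> stage_fun A' X Y R"
  "stage_fun A' X (Kobj Y) R \<longleftrightarrow> stage_fun A' X Y R"
  "stage_fun A' X Y (Krel R) \<longleftrightarrow> stage_fun A' X Y R"
  by (simp_all add: stage_fun_def)

lemma K_nonempty: "V \<noteq> {} \<Longrightarrow> K V \<noteq> {}"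
proof -
  obtain u where "\<forall>c. \<exists>e. A u c = Some e \<and> halts e c" using ex_unit by (rule exE)
  then show "V \<noteq> {} \<Longrightarrow> K V \<noteq> {}" unfolding K_def by blast
qed

lemma is_rtobj_adjoin: "is_rtobj U A X \<Longrightarrow> is_rtobj U A' X"
  by (simp add: is_rtobj_iff AF.is_rtobj_iff stage_obj_adjoin)

lemma is_rtobj_Kobj:
  assumes "is_rtobj U A' X" shows "is_rtobj U A (Kobj X)"
proof -
  have "\<forall>x\<in>Car X. Ex (Kobj X) x \<noteq> {}"
    using assms K_nonempty by (auto simp: AF.is_rtobj_iff Kobj_def)
  then show ?thesis using assms by (simp add: is_rtobj_iff AF.is_rtobj_iff)
qed

lemma G_arr: "amap G (rt_arr A' X Y R) = rt_arr A (Kobj X) (Kobj Y) (Krel R)"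
proof -
  have "same_rel A (Kobj X) (Kobj Y) (Krel R) H"
    if "same_rel A' X Y R R'" "same_rel A (Kobj X) (Kobj Y) (Krel R') H" for R' H
    using that by (simp add: same_rel_iff AF.same_rel_iff)
  moreover have "same_rel A' X Y R R" by (simp add: AF.same_rel_iff)
  ultimately have "{H. \<exists>R'\<in>{R'. same_rel A' X Y R R'}. same_rel A (Kobj X) (Kobj Y) (Krel R') H} =
      {H. same_rel A (Kobj X) (Kobj Y) (Krel R) H}" by auto
  then show ?thesis by (simp add: G_def rt_arr_def)
qed

lemma same_rel_adjoin: "same_rel A X Y R R' \<Longrightarrow> same_rel A' X Y R R'"
  unfolding same_rel_iff AF.same_rel_iff by (intro allI ext) (simp add: rel_adjoin_iff)

lemma I_arr: "amap I (rt_arr A X Y R) = rt_arr A' X Y R"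
proof -
  have "same_rel A' X Y R H" if "same_rel A X Y R R'" "same_rel A' X Y R' H" for R' H
    using same_rel_adjoin[OF that(1)] that(2) by (simp add: AF.same_rel_iff)
  moreover have "same_rel A X Y R R" by (simp add: same_rel_iff)
  ultimately have "{H. \<exists>R'\<in>{R'. same_rel A X Y R R'}. same_rel A' X Y R' H} =
      {H. same_rel A' X Y R H}" by auto
  then show ?thesis by (simp add: inverse_image_def rt_arr_def)
qed

lemma omap_simps [simp]: "omap G = Kobj" "omap I X = X"
  by (simp_all add: G_def inverse_image_def)

text \<open>The two composites may pair realizers differently, so they need not be the same
  relation. Over \<open>A[f]\<close> they agree in truth, because both conjuncts hold at a common
  refinement.\<close>

lemma rel_adjoin_rcomp: "rel A' \<Gamma> X Z (rcomp A Y R S) = rel A' \<Gamma> X Z (rcomp A' Y R S)"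
proof (intro ext iffI)
  fix x z
  show "rel A' \<Gamma> X Z (rcomp A' Y R S) x z" if "rel A' \<Gamma> X Z (rcomp A Y R S) x z"
    using that unfolding AF.rel_rcomp rel_adjoin_iff[of _ _ _ "rcomp A Y R S"] rel_rcomp
    unfolding rel_adjoin_iff by blast
  assume "rel A' \<Gamma> X Z (rcomp A' Y R S) x z"
  then obtain y where "rel A' \<Gamma> X Y R x y" "rel A' \<Gamma> Y Z S y z" unfolding AF.rel_rcomp by blast
  from rel_adjoin2[OF this] show "rel A' \<Gamma> X Z (rcomp A Y R S) x z"
    unfolding rel_adjoin_iff rel_rcomp by blast
qed

lemma functor_I: "is_functor (RT U A) (RT U A') I"
  unfolding is_functor_def
proof (intro conjI ballI)
  fix X assume X: "X \<in> Ob (RT U A)"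
  show "omap I X \<in> Ob (RT U A')" using X is_rtobj_adjoin by simp
  show "amap I (Id (RT U A) X) = Id (RT U A') (omap I X)" by (simp add: I_arr)
next
  fix X Y m assume "m \<in> Hom (RT U A) X Y"
  then obtain M where "m = rt_arr A X Y M" "stage_fun A X Y M" unfolding Hom_RT by blast
  then show "amap I m \<in> Hom (RT U A') (omap I X) (omap I Y)"
    using AF.Hom_RT_arr[OF stage_fun_adjoin] by (simp add: I_arr)
next
  fix X Y Z m n assume "m \<in> Hom (RT U A) X Y" "n \<in> Hom (RT U A) Y Z"
  then obtain M N where "m = rt_arr A X Y M" "n = rt_arr A Y Z N" unfolding Hom_RT by blast
  then show "amap I (Comp (RT U A) n m) = Comp (RT U A') (amap I n) (amap I m)"
    by (simp add: rt_comp_arr AF.rt_comp_arr I_arr AF.rt_arr_eq_iff rel_adjoin_rcomp)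
qed

lemma functor_G: "is_functor (RT U A') (RT U A) G"
  unfolding is_functor_def
proof (intro conjI ballI)
  fix X assume X: "X \<in> Ob (RT U A')"
  show "omap G X \<in> Ob (RT U A)" using X is_rtobj_Kobj by simp
  show "amap G (Id (RT U A') X) = Id (RT U A) (omap G X)" by (simp add: G_arr)
next
  fix X Y m assume "m \<in> Hom (RT U A') X Y"
  then obtain M where "m = rt_arr A' X Y M" "stage_fun A' X Y M" unfolding AF.Hom_RT by blast
  then show "amap G m \<in> Hom (RT U A) (omap G X) (omap G Y)"
    using Hom_RT_arr[of "Kobj X" "Kobj Y" "Krel M"] by (simp add: G_arr)
next
  fix X Y Z m n assume "m \<in> Hom (RT U A') X Y" "n \<in> Hom (RT U A') Y Z"
  then obtain M N where mn: "m = rt_arr A' X Y M" "n = rt_arr A' Y Z N" unfolding AF.Hom_RT by blast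
  have "rel A' \<Gamma> X Z (rcomp A' Y M N) = rel A \<Gamma> X Z (rcomp A (Kobj Y) (Krel M) (Krel N))"
    for \<Gamma>
    by (intro ext) (simp add: AF.rel_rcomp rel_rcomp)
  then show "amap G (Comp (RT U A') n m) = Comp (RT U A) (amap G n) (amap G m)"
    by (simp add: mn rt_comp_arr AF.rt_comp_arr G_arr rt_arr_eq_iff)
qed

text \<open>The unit is not \<open>K (Eq X x y)\<close> alone, which is not strict in \<open>x\<close>.\<close>

definition eta :: "('u, 'a) rtobj \<Rightarrow> 'u \<Rightarrow> 'u \<Rightarrow> 'a set" where
  "eta X x y = meet A (Ex X x) (K (Eq X x y))"

lemma rel_eta: "stage_obj A X \<Longrightarrow> rel A \<Gamma> X Y (eta X) x y \<longleftrightarrow> ex A \<Gamma> X x \<and> rel A' \<Gamma> X Y (Eq X) x y"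
  unfolding rel_def ex_def eta_def holds_meet holds_adjoin by blast

lemma stage_fun_eta:
  assumes X: "stage_obj A X" shows "stage_fun A X (Kobj X) (eta X)"
proof -
  note X' = stage_obj_adjoin[OF X]
  have r: "rel A \<Gamma> X (Kobj X) (eta X) x y \<longleftrightarrow> ex A \<Gamma> X x \<and> eq A' \<Gamma> X x y"
    for \<Gamma> x y
    by (simp add: rel_eta[OF X])
  show ?thesis
  proof (rule stage_funI; unfold r)
    fix \<Gamma> x x' y y'
    assume a: "ex A \<Gamma> X x \<and> eq A' \<Gamma> X x y"
    show "ex A \<Gamma> X x" using a by simp
    show "ex A \<Gamma> (Kobj X) y" using a eq_ex[OF X', of \<Gamma> x y] by simp
    show "eq A \<Gamma> (Kobj X) y y'" if "ex A \<Gamma> X x \<and> eq A' \<Gamma> X x y'"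
      using a that eq_sym[OF X', of \<Gamma> x y] eq_trans[OF X', of \<Gamma> y x y'] by simp
    assume e: "eq A \<Gamma> X x x'" "eq A \<Gamma> (Kobj X) y y'"
    have "eq A' \<Gamma> X x' x" using e(1) eq_sym[OF X] rel_imp_adjoin by blast
    then show "ex A \<Gamma> X x' \<and> eq A' \<Gamma> X x' y'"
      using a e(2) eq_ex[OF X e(1)] eq_trans[OF X', of \<Gamma> x' x y] eq_trans[OF X', of \<Gamma> x' y y'] by simp
  next
    fix \<Gamma> x
    assume x: "ex A \<Gamma> X x"
    then have "eq A' \<Gamma> X x x" using eq_refl[OF X] rel_imp_adjoin by blast
    then show "\<exists>y. ex A \<Gamma> X x \<and> eq A' \<Gamma> X x y" using x by blast
  qed
qed

lemma rel_adjoin_eta: "stage_obj A X \<Longrightarrow> rel A' \<Gamma> X X (eta X) x y \<Longrightarrow> eq A' \<Gamma> X x y"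
  using rel_ref by (subst (asm) rel_adjoin_iff) (auto simp: rel_eta)

lemma eta_natural:
  assumes X: "stage_obj A X" and Y: "stage_obj A Y" and M: "stage_fun A X Y M"
  shows "rt_comp A (rt_arr A Y (Kobj Y) (eta Y)) (rt_arr A X Y M) =
    rt_comp A (rt_arr A (Kobj X) (Kobj Y) (Krel M)) (rt_arr A X (Kobj X) (eta X))"
proof (rule rt_comp_eqI[OF M stage_fun_eta[OF Y] stage_fun_eta[OF X]])
  show "stage_fun A (Kobj X) (Kobj Y) (Krel M)" by (simp add: stage_fun_adjoin[OF M])
  fix \<Gamma> x y z
  assume a: "rel A \<Gamma> X Y M x y" "rel A \<Gamma> Y (Kobj Y) (eta Y) y z"
  have "rel A' \<Gamma> X Y M x z"
    using fun_ext2[OF stage_fun_adjoin[OF M] stage_obj_adjoin[OF X] rel_imp_adjoin[OF a(1)]] a(2)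
    by (simp add: rel_eta[OF Y])
  moreover have "ex A \<Gamma> X x" using fun_ex[OF M a(1)] by blast
  moreover from this have "eq A' \<Gamma> X x x" using eq_refl[OF X] rel_imp_adjoin by blast
  ultimately show "\<exists>y. rel A \<Gamma> X (Kobj X) (eta X) x y \<and> rel A \<Gamma> (Kobj X) (Kobj Y) (Krel M) y z"
    by (auto simp: rel_eta[OF X])
qed (simp_all add: X Y stage_obj_adjoin)

lemma adjunction: "left_adjoint (RT U A) (RT U A') I G"
  unfolding left_adjoint_def
proof (intro conjI functor_I functor_G exI ballI)
  let ?\<eta> = "\<lambda>X. rt_arr A X (Kobj X) (eta X)"
  \<comment> \<open>Over \<open>A[f]\<close>, existence and equality of \<open>Kobj Y\<close> and of
    \<open>Y\<close> are equivalent, so \<open>Eq Y\<close> itself represents the counit.\<close>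
  let ?\<epsilon> = "\<lambda>Y. rt_arr A' (Kobj Y) Y (Eq Y)"
  fix X assume X: "X \<in> Ob (RT U A)"
  then have X': "is_rtobj U A X" by simp
  note oX = obj[OF X'] and oX' = AF.obj[OF is_rtobj_adjoin[OF X']]
  show "?\<eta> X \<in> Hom (RT U A) X (omap G (omap I X))"
    using Hom_RT_arr[OF stage_fun_eta[OF oX]] by simp
  show "Comp (RT U A') (?\<epsilon> (omap I X)) (amap I (?\<eta> X)) = Id (RT U A') (omap I X)"
    unfolding RT_simps I_arr omap_simps
  proof (rule AF.rt_comp_eqI'[OF stage_fun_adjoin[OF stage_fun_eta[OF oX]]])
    fix \<Gamma> x y z
    assume "rel A' \<Gamma> X (Kobj X) (eta X) x y" "rel A' \<Gamma> (Kobj X) X (Eq X) y z"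
    then show "rel A' \<Gamma> X X (Eq X) x z" using eq_trans[OF oX' rel_adjoin_eta[OF oX]] by simp
  qed (use AF.stage_fun_Eq[OF oX'] oX' in simp_all)
next
  let ?\<epsilon> = "\<lambda>Y. rt_arr A' (Kobj Y) Y (Eq Y)"
  fix Y assume "Y \<in> Ob (RT U A')"
  then have oY: "stage_obj A' Y" using AF.obj[of U Y] by simp
  have fY: "stage_fun A' Y Y (Eq Y)" by (rule AF.stage_fun_Eq[OF oY])
  show "?\<epsilon> Y \<in> Hom (RT U A') (omap I (omap G Y)) Y"
    using AF.Hom_RT_arr[of "Kobj Y" Y "Eq Y"] fY by simp
  show "Comp (RT U A) (amap G (?\<epsilon> Y)) (rt_arr A (omap G Y) (Kobj (omap G Y)) (eta (omap G Y))) = Id (RT U A) (omap G Y)"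
    unfolding RT_simps G_arr omap_simps
  proof (rule rt_comp_eqI'[OF stage_fun_eta])
    fix \<Gamma> x y z
    assume "rel A \<Gamma> (Kobj Y) (Kobj (Kobj Y)) (eta (Kobj Y)) x y"
      "rel A \<Gamma> (Kobj (Kobj Y)) (Kobj Y) (Krel (Eq Y)) y z"
    then show "eq A \<Gamma> (Kobj Y) x z"
      using eq_trans[OF oY, of \<Gamma> x y z] rel_eta[of "Kobj Y" \<Gamma> Y x y] oY by simp
  qed (use oY fY in simp_all)
next
  let ?\<eta> = "\<lambda>X. rt_arr A X (Kobj X) (eta X)"
  fix X X' m assume ob: "X \<in> Ob (RT U A)" "X' \<in> Ob (RT U A)" and "m \<in> Hom (RT U A) X X'"
  then obtain M where M: "m = rt_arr A X X' M" "stage_fun A X X' M" unfolding Hom_RT by blast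
  have "stage_obj A X" "stage_obj A X'" using ob obj[of U X] obj[of U X'] by simp_all
  then show "Comp (RT U A) (?\<eta> X') m = Comp (RT U A) (amap G (amap I m)) (?\<eta> X)"
    unfolding M(1) I_arr G_arr RT_simps using M(2) by (rule eta_natural)
next
  let ?\<epsilon> = "\<lambda>Y. rt_arr A' (Kobj Y) Y (Eq Y)"
  fix Y Y' n assume "Y \<in> Ob (RT U A')" "Y' \<in> Ob (RT U A')" and "n \<in> Hom (RT U A') Y Y'"
  then obtain N where N: "n = rt_arr A' Y Y' N" "stage_fun A' Y Y' N"
    and oY: "stage_obj A' Y" "stage_obj A' Y'" unfolding AF.Hom_RT using AF.obj[of U Y] AF.obj[of U Y'] by auto
  show "Comp (RT U A') n (?\<epsilon> Y) = Comp (RT U A') (?\<epsilon> Y') (amap I (amap G n))"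
    unfolding N(1) I_arr G_arr RT_simps
  proof (rule AF.rt_comp_eqI)
    fix \<Gamma> x y z
    assume a: "rel A' \<Gamma> (Kobj Y) Y (Eq Y) x y" "rel A' \<Gamma> Y Y' N y z"
    have "rel A' \<Gamma> Y Y' N x z"
      by (rule fun_ext1[OF N(2) oY(2) a(2)]) (use a(1) eq_sym[OF oY(1)] in simp)
    moreover have "eq A' \<Gamma> Y' z z" using fun_ex[OF N(2) a(2)] eq_refl[OF oY(2)] by blast
    ultimately show "\<exists>y. rel A' \<Gamma> (Kobj Y) (Kobj Y') (Krel N) x y \<and> rel A' \<Gamma> (Kobj Y') Y' (Eq Y') y z"
      by auto
  qed (use oY N(2) AF.stage_fun_Eq in simp_all)
qed

text \<open>Finite limits are detected at stages, and the conditions found there pass from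
  \<open>A\<close> to \<open>A[f]\<close> along refinements.\<close>

lemma left_exact_I: "left_exact (RT U A) (RT U A') I"
  unfolding left_exact_def
proof (intro conjI allI impI)
  fix T :: "('u, 'a) rtobj" assume "terminal (RT U A) T"
  then have "is_rtobj U A T" "stage_terminal A T" using terminal_iff[OF universe] by blast+
  then show "terminal (RT U A') (omap I T)"
    using AF.terminal_iff[OF universe, of T] is_rtobj_adjoin stage_terminal_adjoin obj[of U T] by simp
next
  fix P X Y Z p' q f' g assume pb: "pullback (RT U A) P X Y Z p' q f' g"
  then have ob: "is_rtobj U A P" "is_rtobj U A X" "is_rtobj U A Y" "is_rtobj U A Z"
    unfolding pullback_def by simp_all
  obtain P' where p: "p' = rt_arr A P X P'" "stage_fun A P X P'"
    using pb unfolding pullback_def Hom_RT by blast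
  obtain Q where q: "q = rt_arr A P Y Q" "stage_fun A P Y Q"
    using pb unfolding pullback_def Hom_RT by blast
  obtain M where f: "f' = rt_arr A X Z M" "stage_fun A X Z M"
    using pb unfolding pullback_def Hom_RT by blast
  obtain N where g: "g = rt_arr A Y Z N" "stage_fun A Y Z N"
    using pb unfolding pullback_def Hom_RT by blast
  have "stage_pullback A P X Y Z P' Q M N"
    using pullback_imp_stage_pullback[OF universe ob p(2) q(2) f(2) g(2)] pb by (simp add: p q f g)
  then have "stage_pullback A' P X Y Z P' Q M N" by (rule stage_pullback_adjoin)
  then show "pullback (RT U A') (omap I P) (omap I X) (omap I Y) (omap I Z)
      (amap I p') (amap I q) (amap I f') (amap I g)"
    unfolding p(1) q(1) f(1) g(1) I_arr omap_simps
    using ob p q f g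
    by (intro AF.stage_pullback_imp_pullback is_rtobj_adjoin stage_fun_adjoin)
qed

lemma fully_faithful_G: "fully_faithful (RT U A') (RT U A) G"
  unfolding fully_faithful_def
proof (intro ballI)
  fix X Y assume ob: "X \<in> Ob (RT U A')" "Y \<in> Ob (RT U A')"
  then have oX: "stage_obj A' X" and oY: "stage_obj A' Y" using AF.obj[of U X] AF.obj[of U Y] by simp_all
  show "bij_betw (amap G) (Hom (RT U A') X Y) (Hom (RT U A) (omap G X) (omap G Y))"
    unfolding bij_betw_def
  proof
    show "inj_on (amap G) (Hom (RT U A') X Y)"
    proof (rule inj_onI)
      fix m n assume "m \<in> Hom (RT U A') X Y" "n \<in> Hom (RT U A') X Y" and e: "amap G m = amap G n"
      then obtain M N where "m = rt_arr A' X Y M" "n = rt_arr A' X Y N" unfolding AF.Hom_RT by blast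
      then show "m = n" using e by (simp add: G_arr rt_arr_eq_iff AF.rt_arr_eq_iff)
    qed
    show "amap G ` Hom (RT U A') X Y = Hom (RT U A) (omap G X) (omap G Y)"
    proof
      show "amap G ` Hom (RT U A') X Y \<subseteq> Hom (RT U A) (omap G X) (omap G Y)"
        using functor_G ob unfolding is_functor_def by blast
      show "Hom (RT U A) (omap G X) (omap G Y) \<subseteq> amap G ` Hom (RT U A') X Y"
      proof
        fix h assume "h \<in> Hom (RT U A) (omap G X) (omap G Y)"
        then obtain H where H: "h = rt_arr A (Kobj X) (Kobj Y) H" "stage_fun A (Kobj X) (Kobj Y) H"
          unfolding Hom_RT by auto
        have H': "stage_fun A' X Y H" using stage_fun_adjoin[OF H(2)] by simp
        \<comment> \<open>Fullness: \<open>H\<close> is functional over \<open>A[f]\<close> too and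
          is contained in \<open>Krel H\<close>, and inclusion of functional relations is
          equality.\<close>
        have "h = rt_arr A (Kobj X) (Kobj Y) (Krel H)"
          unfolding H(1)
          by (rule rt_arr_eqI[OF H(2)]) (use H' oX rel_imp_adjoin in simp_all)
        also have "\<dots> = amap G (rt_arr A' X Y H)" by (simp add: G_arr)
        finally show "h \<in> amap G ` Hom (RT U A') X Y" using AF.Hom_RT_arr[OF H'] by blast
      qed
    qed
  qed
qed

lemma geometric_inclusion_G: "geometric_inclusion (RT U A') (RT U A) I G"
  unfolding geometric_inclusion_def
  using adjunction left_exact_I fully_faithful_G by blast

end

section \<open>Sheaves for \<open>K\<close>\<close>

lemma sheaf_extension:
  assumes "is_sheaf U A J S" "dense_mono U A J X Y m" "is_rtobj U A X" "is_rtobj U A Y"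
    "g \<in> Hom (RT U A) X S"
  shows "\<exists>!h. h \<in> Hom (RT U A) Y S \<and> rt_comp A h m = g"
proof -
  have "X \<in> Ob (RT U A)" "Y \<in> Ob (RT U A)" using assms(3,4) by simp_all
  then show ?thesis
    using assms(1)[unfolded is_sheaf_def, THEN conjunct2, rule_format, OF _ _ assms(2,5)]
    by (simp only: RT_simps(3))
qed

sublocale oracle_universe \<subseteq> SK: pca_universe A k s p p0 p1 K U code
  by unfold_locales (rule universe)

context oracle_universe
begin

text \<open>A \<open>K\<close>-dense mono becomes surjective, hence invertible, over
  \<open>A[f]\<close>. The extension is \<open>R\<close> after this inverse, computed over
  \<open>A[f]\<close>.\<close>

lemma is_sheaf_Kobj:
  assumes X: "is_rtobj U A' X" shows "is_sheaf U A K (Kobj X)"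
proof (rule SK.is_sheafI[OF is_rtobj_Kobj[OF X]])
  note oX = AF.obj[OF X]
  show "separated A K (Kobj X)"
    unfolding separated_def by (simp add: rel_def holds_adjoin[symmetric] Krel_def holds_adjoin_K)
  fix Z Y M R
  assume ob: "is_rtobj U A Z" "is_rtobj U A Y" and M: "stage_fun A Z Y M" "stage_mono A Z Y M"
    "stage_dense A K Z Y M" and R: "stage_fun A Z (Kobj X) R"
  note oZ = obj[OF ob(1)] and oY = obj[OF ob(2)]
  note oZ' = stage_obj_adjoin[OF oZ] and oY' = stage_obj_adjoin[OF oY]
  note M' = stage_fun_adjoin[OF M(1)] and mono' = stage_mono_adjoin[OF M(2)]
  have R': "stage_fun A' Z X R" using stage_fun_adjoin[OF R] by simp
  \<comment> \<open>The converse of \<open>M\<close> is composed with \<open>R\<close> by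
    \<open>meet A'\<close> under \<open>K\<close>, that is, over \<open>A[f]\<close>.
    \<open>Ex Y y\<close> stays outside of \<open>K\<close> to make \<open>H\<close> strict over
    \<open>A\<close>.\<close>
  define H where "H y s = meet A (Ex Y y) (K (\<Union>x\<in>Car Z. meet A' (M x y) (R x s)))" for y s
  have H: "rel A \<Gamma> Y X H y s \<longleftrightarrow> ex A \<Gamma> Y y \<and> (\<exists>x. rel A' \<Gamma> Z Y M x y \<and> rel A' \<Gamma> Z X R x s)"
    for \<Gamma> y s
    unfolding rel_def ex_def H_def holds_meet holds_adjoin[symmetric] holds_UN AF.holds_meet by blast
  have fH: "stage_fun A Y (Kobj X) H"
  proof (rule stage_funI; unfold rel_Kobj H)
    fix \<Gamma> y y' s s'
    assume a: "ex A \<Gamma> Y y \<and> (\<exists>x. rel A' \<Gamma> Z Y M x y \<and> rel A' \<Gamma> Z X R x s)"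
    then obtain x where x: "rel A' \<Gamma> Z Y M x y" "rel A' \<Gamma> Z X R x s" by blast
    show "ex A \<Gamma> Y y" using a by simp
    show "ex A \<Gamma> (Kobj X) s" using fun_ex[OF R' x(2)] by simp
    show "rel A \<Gamma> X X (Eq (Kobj X)) s s'"
      if "ex A \<Gamma> Y y \<and> (\<exists>x. rel A' \<Gamma> Z Y M x y \<and> rel A' \<Gamma> Z X R x s')"
    proof -
      from that obtain x' where x': "rel A' \<Gamma> Z Y M x' y" "rel A' \<Gamma> Z X R x' s'" by blast
      have "rel A' \<Gamma> Z X R x' s"
        by (rule fun_ext1[OF R' oX x(2) AF.stage_monoD[OF mono' x(1) x'(1)]])
      from fun_single[OF R' this x'(2)] show ?thesis by simp
    qed
    assume e: "eq A \<Gamma> Y y y'" "rel A \<Gamma> X X (Eq (Kobj X)) s s'"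
    have "rel A' \<Gamma> Z Y M x y'" by (rule fun_ext2[OF M' oZ' x(1) rel_imp_adjoin[OF e(1)]])
    moreover have "rel A' \<Gamma> Z X R x s'" by (rule fun_ext2[OF R' oZ' x(2)]) (use e(2) in simp)
    ultimately show "ex A \<Gamma> Y y' \<and> (\<exists>x. rel A' \<Gamma> Z Y M x y' \<and> rel A' \<Gamma> Z X R x s')"
      using eq_ex[OF oY e(1)] by blast
  next
    fix \<Gamma> y
    assume y: "ex A \<Gamma> Y y"
    then have "holds A' \<Gamma> (\<lambda>c. \<Union>x\<in>Car Z. M x (y c))"
      using M(3) unfolding stage_dense_def holds_adjoin by blast
    then obtain x where x: "rel A' \<Gamma> Z Y M x y"
      using y unfolding holds_UN by (auto simp: rel_def ex_def)
    then obtain s where "rel A' \<Gamma> Z X R x s" using fun_ex[OF M' x] fun_total[OF R'] by blast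
    then show "\<exists>s. ex A \<Gamma> Y y \<and> (\<exists>x. rel A' \<Gamma> Z Y M x y \<and> rel A' \<Gamma> Z X R x s)"
      using x y by blast
  qed
  have "rt_comp A (rt_arr A Y (Kobj X) H) (rt_arr A Z Y M) = rt_arr A Z (Kobj X) R"
  proof (rule rt_comp_eqI'[OF M(1) fH R oZ oY])
    show "stage_obj A (Kobj X)" using oX by simp
    fix \<Gamma> x y s
    assume x: "rel A \<Gamma> Z Y M x y" and "rel A \<Gamma> Y (Kobj X) H y s"
    then obtain x' where x': "rel A' \<Gamma> Z Y M x' y" "rel A' \<Gamma> Z X R x' s" unfolding rel_Kobj H by blast
    have s: "rel A' \<Gamma> Z X R x s"
      by (rule fun_ext1[OF R' oX x'(2) AF.stage_monoD[OF mono' x'(1) rel_imp_adjoin[OF x]]])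
    obtain s0 where s0: "rel A \<Gamma> Z (Kobj X) R x s0" using fun_ex[OF M(1) x] fun_total[OF R] by blast
    then have "rel A' \<Gamma> Z X R x s0" using rel_imp_adjoin by fastforce
    then have "eq A' \<Gamma> X s0 s" using fun_single[OF R'] s by blast
    then show "rel A \<Gamma> Z (Kobj X) R x s" by (intro fun_ext2[OF R oZ s0]) simp
  qed
  with fH show "\<exists>H. stage_fun A Y (Kobj X) H \<and>
      rt_comp A (rt_arr A Y (Kobj X) H) (rt_arr A Z Y M) = rt_arr A Z (Kobj X) R" by blast
qed

lemma dense_eta:
  assumes X: "stage_obj A X" shows "stage_dense A K X (Kobj X) (eta X)"
  unfolding stage_dense_def
proof (intro allI impI)
  fix \<Gamma> y
  assume "ex A \<Gamma> (Kobj X) y"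
  then have "ex A' \<Gamma> X y" by simp
  then obtain \<Delta> where \<Delta>: "ref \<Gamma> \<Delta>" "ex A \<Delta> X y" unfolding ex_adjoin_iff by blast
  have "rel A \<Delta> X X (eta X) y y"
    using \<Delta>(2) eq_refl[OF X \<Delta>(2)] rel_imp_adjoin by (simp add: rel_eta[OF X])
  then have "rel A' \<Gamma> X X (eta X) y y" unfolding rel_adjoin_iff using \<Delta>(1) by blast
  then have "holds A' \<Gamma> (\<lambda>c. \<Union>x\<in>Car X. eta X x (y c))" unfolding holds_UN rel_def by blast
  then show "holds A \<Gamma> (\<lambda>c. K (\<Union>x\<in>Car X. eta X x (y c)))" unfolding holds_adjoin .
qed

text \<open>Sheaves are separated. \<open>T\<close> is the closure of the diagonal of
  \<open>S\<close>, given by equality over \<open>A[f]\<close>, and \<open>D\<close> embeds the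
  diagonal densely. Both legs of \<open>T\<close> extend the identity of \<open>S\<close> along
  \<open>D\<close>, so they coincide.\<close>

lemma sheaf_stage1:
  assumes S: "is_rtobj U A S" and sheaf: "is_sheaf U A K S"
    and xy: "ex A \<Gamma> S x" "ex A \<Gamma> S y" "eq A' \<Gamma> S x y"
  shows "eq A \<Gamma> S x y"
proof -
  note oS = obj[OF S] and oS' = stage_obj_adjoin[OF obj[OF S]]
  define R where "R x y = meet A (meet A (Ex S x) (Ex S y)) (K (Eq S x y))" for x y
  have R: "rel A \<Gamma> S S R x y \<longleftrightarrow> ex A \<Gamma> S x \<and> ex A \<Gamma> S y \<and> eq A' \<Gamma> S x y"
    for \<Gamma> x y
    unfolding rel_def ex_def R_def holds_meet holds_adjoin by blast
  have strict: "ex A \<Gamma> S x \<and> ex A \<Gamma> S y" if "rel A \<Gamma> S S R x y" for \<Gamma> x y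
    using that unfolding R by blast
  have ext: "rel A \<Gamma> S S R x' y'" if a: "rel A \<Gamma> S S R x y" "eq A \<Gamma> S x x'" "eq A \<Gamma> S y y'"
    for \<Gamma> x y x' y'
  proof -
    have "eq A' \<Gamma> S x' x" "eq A' \<Gamma> S x y" "eq A' \<Gamma> S y y'"
      using a eq_sym[OF oS] rel_imp_adjoin unfolding R by blast+
    then have "eq A' \<Gamma> S x' y'" using eq_trans[OF oS'] by blast
    then show ?thesis using a eq_ex[OF oS] unfolding R by blast
  qed
  obtain T P Q where T: "is_rtobj U A T" and P: "stage_fun A T S P" and Q: "stage_fun A T S Q"
    and t1: "\<And>\<Gamma> x y. rel A \<Gamma> S S R x y \<Longrightarrow> \<exists>t. rel A \<Gamma> T S P t x \<and> rel A \<Gamma> T S Q t y"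
    and t2: "\<And>\<Gamma> t x y. rel A \<Gamma> T S P t x \<Longrightarrow> rel A \<Gamma> T S Q t y \<Longrightarrow> rel A \<Gamma> S S R x y"
    and t3: "\<And>\<Gamma> t t' x y. rel A \<Gamma> T S P t x \<Longrightarrow> rel A \<Gamma> T S Q t y \<Longrightarrow>
      rel A \<Gamma> T S P t' x \<Longrightarrow> rel A \<Gamma> T S Q t' y \<Longrightarrow> eq A \<Gamma> T t t'"
    by (rule tabulation[OF universe S S strict ext]) auto
  note oT = obj[OF T]
  define D where "D x t = meet A (P t x) (Q t x)" for x t
  have D: "rel A \<Gamma> S T D x t \<longleftrightarrow> rel A \<Gamma> T S P t x \<and> rel A \<Gamma> T S Q t x" for \<Gamma> x t
    unfolding rel_def D_def holds_meet by blast
  have D': "rel A' \<Gamma> S T D x t" if "rel A' \<Gamma> T S P t x" "rel A' \<Gamma> T S Q t x"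
    for \<Gamma> x t
    using rel_adjoin2[OF that] D unfolding rel_adjoin_iff by blast
  have fD: "stage_fun A S T D"
  proof (rule stage_funI; unfold D)
    fix \<Gamma> x x' t t'
    assume a: "rel A \<Gamma> T S P t x \<and> rel A \<Gamma> T S Q t x"
    show "ex A \<Gamma> S x" "ex A \<Gamma> T t" using a fun_ex[OF P] by blast+
    show "eq A \<Gamma> T t t'" if "rel A \<Gamma> T S P t' x \<and> rel A \<Gamma> T S Q t' x" using a that t3 by blast
    show "rel A \<Gamma> T S P t' x' \<and> rel A \<Gamma> T S Q t' x'" if "eq A \<Gamma> S x x'" "eq A \<Gamma> T t t'"
      using a that fun_ext[OF P] fun_ext[OF Q] by blast
  next
    fix \<Gamma> x
    assume x: "ex A \<Gamma> S x"
    then have "rel A \<Gamma> S S R x x" using eq_refl[OF oS] rel_imp_adjoin unfolding R by blast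
    then show "\<exists>t. rel A \<Gamma> T S P t x \<and> rel A \<Gamma> T S Q t x" by (rule t1)
  qed
  have mD: "stage_mono A S T D"
    unfolding stage_mono_def D using fun_single[OF P] by blast
  have dD: "stage_dense A K S T D"
    unfolding stage_dense_def
  proof (intro allI impI)
    fix \<Gamma> t
    assume "ex A \<Gamma> T t"
    then obtain x y where a: "rel A \<Gamma> T S P t x" "rel A \<Gamma> T S Q t y"
      using fun_total[OF P] fun_total[OF Q] by blast
    then have "eq A' \<Gamma> S x y" using t2 unfolding R by blast
    then have "rel A' \<Gamma> T S Q t x"
      using eq_sym[OF oS'] by (intro fun_ext2[OF stage_fun_adjoin[OF Q] stage_obj_adjoin[OF oT] rel_imp_adjoin[OF a(2)]])
    then have "rel A' \<Gamma> S T D x t" using D' rel_imp_adjoin[OF a(1)] by blast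
    then have "holds A' \<Gamma> (\<lambda>c. \<Union>x\<in>Car S. D x (t c))" unfolding holds_UN rel_def by blast
    then show "holds A \<Gamma> (\<lambda>c. K (\<Union>x\<in>Car S. D x (t c)))" unfolding holds_adjoin .
  qed
  have id: "rt_comp A (rt_arr A T S V) (rt_arr A S T D) = rt_arr A S S (Eq S)"
    if V: "stage_fun A T S V" "\<And>\<Gamma> x t. rel A \<Gamma> S T D x t \<Longrightarrow> rel A \<Gamma> T S V t x" for V
    by (rule rt_comp_eqI'[OF fD V(1) stage_fun_Eq[OF oS] oS oT oS])
      (use V(2) fun_single[OF V(1)] in blast)
  have dm: "dense_mono U A K S T (rt_arr A S T D)" by (rule SK.dense_monoI[OF fD mD dD S T])
  have "\<exists>!h. h \<in> Hom (RT U A) T S \<and> rt_comp A h (rt_arr A S T D) = rt_arr A S S (Eq S)"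
    by (rule sheaf_extension[OF sheaf dm S T Hom_RT_arr[OF stage_fun_Eq[OF oS]]])
  moreover have "rt_comp A (rt_arr A T S P) (rt_arr A S T D) = rt_arr A S S (Eq S)"
    "rt_comp A (rt_arr A T S Q) (rt_arr A S T D) = rt_arr A S S (Eq S)"
    by (rule id; use P Q D in blast)+
  ultimately have "rt_arr A T S P = rt_arr A T S Q" using Hom_RT_arr[OF P] Hom_RT_arr[OF Q] by blast
  moreover obtain t where "rel A \<Gamma> T S P t x" "rel A \<Gamma> T S Q t y" using t1 xy unfolding R by blast
  ultimately show ?thesis using fun_single[OF Q] unfolding rt_arr_eq_iff by metis
qed

lemma rel_eta_Kobj:
  "stage_obj A X \<Longrightarrow> rel A \<Gamma> X (Kobj X) (eta X) x y \<longleftrightarrow> ex A \<Gamma> X x \<and> eq A' \<Gamma> X x y"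
  by (simp add: rel_eta)

lemma mono_eta_iff:
  assumes X: "stage_obj A X"
    and sep: "\<And>\<Gamma> x y. ex A \<Gamma> X x \<Longrightarrow> ex A \<Gamma> X y \<Longrightarrow> eq A' \<Gamma> X x y \<Longrightarrow> eq A \<Gamma> X x y"
  shows "stage_mono A X (Kobj X) (eta X)"
  unfolding stage_mono_def rel_eta_Kobj[OF X]
proof (intro allI impI)
  fix \<Gamma> x x' y
  assume a: "ex A \<Gamma> X x \<and> eq A' \<Gamma> X x y" "ex A \<Gamma> X x' \<and> eq A' \<Gamma> X x' y"
  then have "eq A' \<Gamma> X x x'"
    using eq_sym[OF stage_obj_adjoin[OF X]] eq_trans[OF stage_obj_adjoin[OF X]] by blast
  then show "eq A \<Gamma> X x x'" using sep a by blast
qed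

text \<open>By separatedness the unit of a sheaf is a dense mono, so the identity extends along it
  to a retraction \<open>r\<close>; \<open>z\<close> is the value of \<open>r\<close> at
  \<open>x\<close>.\<close>

lemma sheaf_stage2:
  assumes S: "is_rtobj U A S" and sheaf: "is_sheaf U A K S" and x: "ex A' \<Gamma> S x"
  shows "\<exists>z. ex A \<Gamma> S z \<and> eq A' \<Gamma> S x z"
proof -
  note oS = obj[OF S] and oS' = stage_obj_adjoin[OF obj[OF S]]
  have GS: "is_rtobj U A (Kobj S)" by (rule is_rtobj_Kobj[OF is_rtobj_adjoin[OF S]])
  have dm: "dense_mono U A K S (Kobj S) (rt_arr A S (Kobj S) (eta S))"
    by (rule SK.dense_monoI[OF stage_fun_eta[OF oS] mono_eta_iff[OF oS sheaf_stage1[OF S sheaf]] dense_eta[OF oS] S GS])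
  have "\<exists>!h. h \<in> Hom (RT U A) (Kobj S) S \<and> rt_comp A h (rt_arr A S (Kobj S) (eta S)) = rt_arr A S S (Eq S)"
    by (rule sheaf_extension[OF sheaf dm S GS Hom_RT_arr[OF stage_fun_Eq[OF oS]]])
  then obtain r where r: "stage_fun A (Kobj S) S r"
    and e: "rt_comp A (rt_arr A (Kobj S) S r) (rt_arr A S (Kobj S) (eta S)) = rt_arr A S S (Eq S)"
    unfolding Hom_RT by blast
  obtain z where z: "rel A \<Gamma> (Kobj S) S r x z" using fun_total[OF r] x by fastforce
  \<comment> \<open>At the given stage \<open>x\<close> exists only over \<open>A[f]\<close>; at a
    refinement it exists over \<open>A\<close>, and there the retraction returns \<open>x\<close>
    itself.\<close>
  obtain \<Delta> where \<Delta>: "ref \<Gamma> \<Delta>" "ex A \<Delta> S x" "rel A \<Delta> (Kobj S) S r x z"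
  proof -
    have "rel A' \<Gamma> S S (Eq S) x x" using eq_refl[OF oS' x] .
    from rel_adjoin2[OF this rel_imp_adjoin[OF z]] show thesis using that eq_ex[OF oS] by blast
  qed
  have "rel A \<Delta> S (Kobj S) (eta S) x x"
    using \<Delta>(2) eq_refl[OF oS \<Delta>(2)] rel_imp_adjoin unfolding rel_eta_Kobj[OF oS] by blast
  then have "eq A \<Delta> S x z" using rt_comp_eqD'[OF e, of \<Delta> x z] \<Delta>(3) by blast
  then have "eq A' \<Gamma> S x z" unfolding rel_adjoin_iff using \<Delta>(1) by blast
  then show ?thesis using fun_ex[OF r z] by blast
qed

text \<open>A monic unit is a dense mono into a sheaf, so its universal property is the extension
  property of sheaves. By \<open>mono_eta_asm\<close> this covers all assemblies.\<close>

lemma sheafification_eta: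
  assumes X: "is_rtobj U A X" and mono: "stage_mono A X (Kobj X) (eta X)"
  shows "sheafification U A K X (Kobj X) (rt_arr A X (Kobj X) (eta X))"
proof -
  note oX = obj[OF X]
  have GX: "is_rtobj U A (Kobj X)" by (rule is_rtobj_Kobj[OF is_rtobj_adjoin[OF X]])
  have dm: "dense_mono U A K X (Kobj X) (rt_arr A X (Kobj X) (eta X))"
    by (rule SK.dense_monoI[OF stage_fun_eta[OF oX] mono dense_eta[OF oX] X GX])
  have "\<exists>!h. h \<in> Hom (RT U A) (Kobj X) S \<and> rt_comp A h (rt_arr A X (Kobj X) (eta X)) = g"
    if "is_sheaf U A K S" "g \<in> Hom (RT U A) X S" for S g
    by (rule sheaf_extension[OF that(1) dm X GX that(2)])
  then show ?thesis
    unfolding sheafification_def SK.Sh_simps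
    using GX is_sheaf_Kobj[OF is_rtobj_adjoin[OF X]] Hom_RT_arr[OF stage_fun_eta[OF oX]] by simp
qed

text \<open>Over \<open>A[f]\<close> a dense mono is also surjective, so its converse is a
  functional relation there; the direct image turns it into an inverse of \<open>?l\<close>.\<close>

lemma dense_mono_inverts:
  assumes ob: "is_rtobj U A X" "is_rtobj U A Y" and M: "stage_fun A X Y M" "stage_mono A X Y M"
    "stage_dense A K X Y M"
    and eta: "stage_mono A X (Kobj X) (eta X)" "stage_mono A Y (Kobj Y) (eta Y)"
  shows "inverts U A K X Y (rt_arr A X Y M)"
proof -
  note oX = obj[OF ob(1)] and oY = obj[OF ob(2)]
  note oX' = stage_obj_adjoin[OF oX] and oY' = stage_obj_adjoin[OF oY]
  note M' = stage_fun_adjoin[OF M(1)] and mono' = stage_mono_adjoin[OF M(2)]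
  let ?l = "rt_arr A (Kobj X) (Kobj Y) (Krel M)"
  have fM: "stage_fun A (Kobj X) (Kobj Y) (Krel M)" using M' by simp
  have N: "rel A' \<Gamma> Y X (\<lambda>y x. M x y) y x \<longleftrightarrow> rel A' \<Gamma> X Y M x y" for \<Gamma> x y
    unfolding rel_def by blast
  have "stage_fun A' Y X (\<lambda>y x. M x y)"
  proof (rule stage_funI; unfold N)
    fix \<Gamma> x x' y y'
    assume xy: "rel A' \<Gamma> X Y M x y"
    show "ex A' \<Gamma> Y y" "ex A' \<Gamma> X x" using fun_ex[OF M' xy] by blast+
    show "eq A' \<Gamma> X x x'" if "rel A' \<Gamma> X Y M x' y" using AF.stage_monoD[OF mono' xy that] .
    show "rel A' \<Gamma> X Y M x' y'" if "eq A' \<Gamma> Y y y'" "eq A' \<Gamma> X x x'"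
      using fun_ext[OF M' xy] that by blast
  next
    fix \<Gamma> y
    assume "ex A' \<Gamma> Y y"
    then obtain \<Delta> where \<Delta>: "ref \<Gamma> \<Delta>" "ex A \<Delta> Y y" unfolding ex_adjoin_iff by blast
    then have "holds A' \<Delta> (\<lambda>c. \<Union>x\<in>Car X. M x (y c))"
      using M(3) unfolding stage_dense_def holds_adjoin by blast
    then obtain x where "rel A' \<Delta> X Y M x y"
      using \<Delta>(2) unfolding holds_UN by (auto simp: rel_def ex_def)
    then show "\<exists>x. rel A' \<Gamma> X Y M x y" using rel_ref[OF \<Delta>(1)] by blast
  qed
  then have fN: "stage_fun A (Kobj Y) (Kobj X) (Krel (\<lambda>y x. M x y))" by simp
  have "rt_comp A (rt_arr A (Kobj Y) (Kobj X) (Krel (\<lambda>y x. M x y))) ?l = rt_arr A (Kobj X) (Kobj X) (Eq (Kobj X))"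
    by (rule rt_comp_eqI'[OF fM fN])
      (use oX' oY' AF.stage_fun_Eq[OF oX'] in \<open>simp_all add: N AF.stage_monoD[OF mono']\<close>)
  moreover have "rt_comp A ?l (rt_arr A (Kobj Y) (Kobj X) (Krel (\<lambda>y x. M x y))) = rt_arr A (Kobj Y) (Kobj Y) (Eq (Kobj Y))"
    by (rule rt_comp_eqI'[OF fN fM])
      (use oX' oY' AF.stage_fun_Eq[OF oY'] in \<open>simp_all add: N fun_single[OF M']\<close>)
  ultimately have iso: "iso_arr (Sh U A K) (Kobj X) (Kobj Y) ?l"
    unfolding iso_arr_def SK.Sh_simps RT_simps using Hom_RT_arr[OF fM] Hom_RT_arr[OF fN] by blast
  show ?thesis
    unfolding inverts_def
    using sheafification_eta[OF ob(1) eta(1)] sheafification_eta[OF ob(2) eta(2)] iso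
      eta_natural[OF oX oY M(1)] Hom_RT_arr[OF fM] unfolding SK.Sh_simps RT_simps by metis
qed

lemma equivalence_G: "equivalence (RT U A') (Sh U A K) G"
  unfolding equivalence_def
proof (intro conjI ballI)
  have "omap G X \<in> Ob (Sh U A K)" if "X \<in> Ob (RT U A')" for X
    using that is_rtobj_Kobj is_sheaf_Kobj by simp
  then show "is_functor (RT U A') (Sh U A K) G"
    using functor_G unfolding is_functor_def SK.Sh_simps(2-4) RT_simps(3) by blast
  show "fully_faithful (RT U A') (Sh U A K) G"
    using fully_faithful_G unfolding fully_faithful_def SK.Sh_simps .
next
  fix S assume "S \<in> Ob (Sh U A K)"
  then have S: "is_rtobj U A S" and sheaf: "is_sheaf U A K S" by simp_all
  note oS = obj[OF S] and oS' = stage_obj_adjoin[OF obj[OF S]]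
  \<comment> \<open>The inverse of the unit: single-valued by \<open>sheaf_stage1\<close>, total by
    \<open>sheaf_stage2\<close>.\<close>
  define R where "R x y = meet A (Ex S y) (K (Eq S x y))" for x y
  have R: "rel A \<Gamma> S S R x y \<longleftrightarrow> ex A \<Gamma> S y \<and> eq A' \<Gamma> S x y" for \<Gamma> x y
    unfolding rel_def ex_def R_def holds_meet holds_adjoin by blast
  have fR: "stage_fun A (Kobj S) S R"
  proof (rule stage_funI; unfold rel_Kobj R)
    fix \<Gamma> x x' y y'
    assume a: "ex A \<Gamma> S y \<and> eq A' \<Gamma> S x y"
    show "ex A \<Gamma> (Kobj S) x" using a eq_ex[OF oS', of \<Gamma> x y] by simp
    show "ex A \<Gamma> S y" using a by simp
    show "eq A \<Gamma> S y y'" if b: "ex A \<Gamma> S y' \<and> eq A' \<Gamma> S x y'"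
      by (rule sheaf_stage1[OF S sheaf]) (use a b eq_sym[OF oS'] eq_trans[OF oS'] in blast)+
    assume e: "rel A \<Gamma> S S (Eq (Kobj S)) x x'" "eq A \<Gamma> S y y'"
    have "eq A' \<Gamma> S x' x" using e(1) eq_sym[OF oS'] by simp
    moreover have "eq A' \<Gamma> S y y'" by (rule rel_imp_adjoin[OF e(2)])
    ultimately show "ex A \<Gamma> S y' \<and> eq A' \<Gamma> S x' y'" using a eq_ex[OF oS e(2)] eq_trans[OF oS'] by blast
  next
    fix \<Gamma> x
    assume "ex A \<Gamma> (Kobj S) x"
    then show "\<exists>y. ex A \<Gamma> S y \<and> eq A' \<Gamma> S x y" using sheaf_stage2[OF S sheaf] by simp
  qed
  note fE = stage_fun_eta[OF oS]
  have "rt_comp A (rt_arr A S (Kobj S) (eta S)) (rt_arr A (Kobj S) S R) = rt_arr A (Kobj S) (Kobj S) (Eq (Kobj S))"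
  proof (rule rt_comp_eqI'[OF fR fE])
    fix \<Gamma> x y z
    assume "rel A \<Gamma> (Kobj S) S R x y" "rel A \<Gamma> S (Kobj S) (eta S) y z"
    then show "rel A \<Gamma> (Kobj S) (Kobj S) (Eq (Kobj S)) x z"
      using eq_trans[OF oS', of \<Gamma> x y z] unfolding rel_eta_Kobj[OF oS] by (simp add: R)
  qed (use oS oS' AF.stage_fun_Eq[OF oS'] in simp_all)
  moreover have "rt_comp A (rt_arr A (Kobj S) S R) (rt_arr A S (Kobj S) (eta S)) = rt_arr A S S (Eq S)"
  proof (rule rt_comp_eqI'[OF fE fR])
    fix \<Gamma> x y z
    assume "rel A \<Gamma> S (Kobj S) (eta S) x y" "rel A \<Gamma> (Kobj S) S R y z"
    then show "eq A \<Gamma> S x z"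
      using eq_trans[OF oS', of \<Gamma> x y z] unfolding rel_Kobj R rel_eta[OF oS]
      by (intro sheaf_stage1[OF S sheaf]) blast+
  qed (use oS oS' stage_fun_Eq[OF oS] in simp_all)
  ultimately have "iso_arr (Sh U A K) (omap G S) S (rt_arr A (Kobj S) S R)"
    unfolding iso_arr_def SK.Sh_simps RT_simps omap_simps using Hom_RT_arr[OF fR] Hom_RT_arr[OF fE] by blast
  then show "\<exists>X\<in>Ob (RT U A'). \<exists>m. iso_arr (Sh U A K) (omap G X) S m"
    using is_rtobj_adjoin[OF S] unfolding RT_simps by blast
qed

end

section \<open>Assemblies, and the mono that forces \<open>f\<close> to be realizable\<close>

lemma holds_if:
  "holds A \<Gamma> (\<lambda>c. if P c then \<phi> c else {}) \<longleftrightarrow> (\<forall>c\<in>dom \<Gamma>. P c) \<and> holds A \<Gamma> \<phi>"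
proof
  assume h: "holds A \<Gamma> (\<lambda>c. if P c then \<phi> c else {})"
  have "P c" if "c \<in> dom \<Gamma>" for c using holds_nonempty[OF h that] by (simp split: if_splits)
  moreover have "holds A \<Gamma> \<phi>" by (rule holds_mono[OF h]) simp
  ultimately show "(\<forall>c\<in>dom \<Gamma>. P c) \<and> holds A \<Gamma> \<phi>" by blast
next
  assume "(\<forall>c\<in>dom \<Gamma>. P c) \<and> holds A \<Gamma> \<phi>"
  then show "holds A \<Gamma> (\<lambda>c. if P c then \<phi> c else {})"
    using holds_cong[of \<Gamma> "\<lambda>c. if P c then \<phi> c else {}" \<phi>] by simp
qed

lemma asm_simps [simp]: "Car (asm X) = Car X" "Ex (asm X) = Ex X"
  by (simp_all add: asm_def)

lemma eq_asm: "eq A \<Gamma> (asm X) x y \<longleftrightarrow> ex A \<Gamma> (asm X) x \<and> (\<forall>c\<in>dom \<Gamma>. x c = y c)"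
proof -
  have "(\<forall>c\<in>dom \<Gamma>. x c = y c) \<Longrightarrow> x \<in> els \<Gamma> (Car X) \<Longrightarrow> y \<in> els \<Gamma> (Car X)" by (auto simp: els_def)
  then show ?thesis by (auto simp: rel_def ex_def asm_def holds_if)
qed

lemma stage_obj_asm: "stage_obj A (asm X)" for X :: "('u, 'a) assembly"
proof (rule stage_objI; unfold eq_asm)
  fix \<Gamma> x y z
  assume a: "ex A \<Gamma> (asm X) x \<and> (\<forall>c\<in>dom \<Gamma>. x c = y c)"
  have "holds A \<Gamma> (\<lambda>c. Ex X (x c)) = holds A \<Gamma> (\<lambda>c. Ex X (y c))"
    by (rule holds_cong) (use a in simp)
  moreover have "x \<in> els \<Gamma> (Car X) \<longleftrightarrow> y \<in> els \<Gamma> (Car X)" by (rule els_cong) (use a in simp)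
  ultimately show "ex A \<Gamma> (asm X) y \<and> (\<forall>c\<in>dom \<Gamma>. y c = x c)" using a by (simp add: ex_def)
qed auto

text \<open>\<open>id x\<close> is kept so that the body matches the relation that
  \<open>asm_arr\<close> forms from \<open>id\<close>.\<close>

definition graph_rel :: "('u, 'a) assembly \<Rightarrow> 'u \<Rightarrow> 'u \<Rightarrow> 'a set" where
  "graph_rel X x y = (if y = id x then Ex X x else {})"

lemma rel_graph_rel: "rel A \<Gamma> (asm X) (asm Y) (graph_rel X) x y \<longleftrightarrow>
    ex A \<Gamma> (asm X) x \<and> y \<in> els \<Gamma> (Car Y) \<and> (\<forall>c\<in>dom \<Gamma>. y c = x c)"
  by (auto simp: rel_def ex_def graph_rel_def holds_if)

context oracle_universe
begin

text \<open>Assemblies are separated: equality of existing elements is equality in the carrier,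
  which does not depend on the realizers available.\<close>

lemma mono_eta_asm: "stage_mono A (asm X) (Kobj (asm X)) (eta (asm X))"
  by (rule mono_eta_iff[OF stage_obj_asm]) (simp add: eq_asm)

abbreviation XB where "XB \<equiv> graph_asm A p code f"
abbreviation YB where "YB \<equiv> dom_asm code f"

lemma code_eq [simp]: "code a = code b \<longleftrightarrow> a = b"
proof -
  have "inj code" using universe unfolding universe_def by (rule conjunct1)
  then show ?thesis by (rule inj_eq)
qed

lemma Ex_XB: "f b = Some c \<Longrightarrow> Ex XB (code b) = {pair b c}"
  and Ex_YB: "Ex YB (code b) = {b}"
  by (auto simp: graph_asm_def dom_asm_def)

lemma Car_B: "Car XB = code ` dom f" "Car YB = code ` dom f"
  by (simp_all add: graph_asm_def dom_asm_def)

lemma is_rtobj_B: "is_rtobj U A (asm XB)" "is_rtobj U A (asm YB)"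
proof -
  have "range code \<in> U" "\<forall>S\<in>U. \<forall>T. T \<subseteq> S \<longrightarrow> T \<in> U"
    using universe unfolding universe_def by simp_all
  then have "code ` dom f \<in> U" by (meson image_mono subset_UNIV)
  moreover have "\<forall>x\<in>Car XB. Ex XB x \<noteq> {}" "\<forall>x\<in>Car YB. Ex YB x \<noteq> {}"
    unfolding Car_B using Ex_XB Ex_YB by fastforce+
  ultimately show "is_rtobj U A (asm XB)" "is_rtobj U A (asm YB)"
    by (simp_all add: is_rtobj_iff stage_obj_asm Car_B)
qed

lemma ex_XB_imp_ex_YB:
  assumes "ex A \<Gamma> (asm XB) x" shows "ex A \<Gamma> (asm YB) x"
proof -
  have "p0 \<in> imp A (Ex XB u) (Ex YB u)" if "u \<in> code ` dom f" for u
    using that by (auto simp: imp_iff Ex_XB Ex_YB)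
  moreover have "x \<in> els \<Gamma> (code ` dom f)" "holds A \<Gamma> (\<lambda>c. Ex XB (x c))"
    using assms by (simp_all add: ex_def Car_B)
  ultimately have "holds A \<Gamma> (\<lambda>c. Ex YB (x c))"
    by (intro holds_apply_uniform[OF _ \<open>holds A \<Gamma> (\<lambda>c. Ex XB (x c))\<close>, where r = p0]) (simp add: els_def)
  then show ?thesis using assms by (simp add: ex_def Car_B)
qed

lemma ex_YB_imp_adjoin_ex_XB:
  assumes "ex A \<Gamma> (asm YB) x" shows "ex A' \<Gamma> (asm XB) x"
proof -
  obtain q where q: "\<forall>b c. f b = Some c \<longrightarrow> (\<exists>e. A q b = Some e \<and> halts e c)"
    using ex_query by (rule exE)
  \<comment> \<open>Ask the oracle at \<open>b\<close>, then return the pair of \<open>b\<close> and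
    the answer.\<close>
  let ?t = "App (App (Cst bind_code) (lm 1 (App (Cst unit_code) (pairT (Var 0) (Var 1))))) (App (Cst q) (Var 0))"
  obtain r where r: "\<forall>x z. ev (env [x]) ?t = Some z \<longrightarrow> A r x = Some z"
    using ex_lam1[of ?t] by (rule exE)
  have "r \<in> imp A (Ex YB u) (K (Ex XB u))" if u: "u \<in> code ` dom f" for u
  proof -
    obtain b c where b: "u = code b" "f b = Some c" using u by blast
    have "\<exists>e. ev (env [b]) ?t = Some e \<and> halts e (pair b c)"
      by (rule eval_bind_code[where c = c], use q b in simp, rule eval_unit_code) simp
    then show ?thesis using r b by (auto simp: imp_iff Ex_XB Ex_YB K_def)
  qed
  moreover have "x \<in> els \<Gamma> (code ` dom f)" "holds A \<Gamma> (\<lambda>c. Ex YB (x c))"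
    using assms by (simp_all add: ex_def Car_B)
  ultimately have "holds A \<Gamma> (\<lambda>c. K (Ex XB (x c)))"
    by (intro holds_apply_uniform[OF _ \<open>holds A \<Gamma> (\<lambda>c. Ex YB (x c))\<close>, where r = r]) (simp add: els_def)
  then show ?thesis using assms by (simp add: ex_def Car_B holds_adjoin)
qed

lemma stage_fun_B: "stage_fun A (asm XB) (asm YB) (graph_rel XB)"
proof (rule stage_funI; unfold rel_graph_rel eq_asm)
  fix \<Gamma> x x' y y'
  assume a: "ex A \<Gamma> (asm XB) x \<and> y \<in> els \<Gamma> (Car YB) \<and> (\<forall>c\<in>dom \<Gamma>. y c = x c)"
  then have "eq A \<Gamma> (asm YB) x y" using ex_XB_imp_ex_YB by (auto simp: eq_asm)
  then have y: "ex A \<Gamma> (asm YB) y" using eq_ex[OF stage_obj_asm] by blast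
  show "ex A \<Gamma> (asm XB) x" using a by simp
  show "ex A \<Gamma> (asm YB) y" by (rule y)
  show "ex A \<Gamma> (asm YB) y \<and> (\<forall>c\<in>dom \<Gamma>. y c = y' c)"
    if "ex A \<Gamma> (asm XB) x \<and> y' \<in> els \<Gamma> (Car YB) \<and> (\<forall>c\<in>dom \<Gamma>. y' c = x c)"
    using y a that by simp
  assume x': "ex A \<Gamma> (asm XB) x \<and> (\<forall>c\<in>dom \<Gamma>. x c = x' c)"
    and y': "ex A \<Gamma> (asm YB) y \<and> (\<forall>c\<in>dom \<Gamma>. y c = y' c)"
  have "ex A \<Gamma> (asm XB) x'" "ex A \<Gamma> (asm YB) y'"
    using x' y' unfolding eq_asm[symmetric] using eq_ex[OF stage_obj_asm] by blast+
  then show "ex A \<Gamma> (asm XB) x' \<and> y' \<in> els \<Gamma> (Car YB) \<and> (\<forall>c\<in>dom \<Gamma>. y' c = x' c)"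
    using a x' y' by (simp add: ex_def)
next
  fix \<Gamma> x
  assume "ex A \<Gamma> (asm XB) x"
  then show "\<exists>y. ex A \<Gamma> (asm XB) x \<and> y \<in> els \<Gamma> (Car YB) \<and> (\<forall>c\<in>dom \<Gamma>. y c = x c)"
    by (intro exI[of _ x]) (simp add: ex_def Car_B)
qed

lemma stage_mono_B: "stage_mono A (asm XB) (asm YB) (graph_rel XB)"
  unfolding stage_mono_def rel_graph_rel eq_asm by simp

lemma stage_dense_B: "stage_dense A K (asm XB) (asm YB) (graph_rel XB)"
  unfolding stage_dense_def
proof (intro allI impI)
  fix \<Gamma> y
  assume y: "ex A \<Gamma> (asm YB) y"
  have "rel A' \<Gamma> (asm XB) (asm YB) (graph_rel XB) y y"
    unfolding rel_graph_rel using ex_YB_imp_adjoin_ex_XB[OF y] y by (simp add: ex_def)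
  then have "holds A' \<Gamma> (\<lambda>c. \<Union>x\<in>Car (asm XB). graph_rel XB x (y c))"
    unfolding holds_UN rel_def by blast
  then show "holds A \<Gamma> (\<lambda>c. K (\<Union>x\<in>Car (asm XB). graph_rel XB x (y c)))"
    unfolding holds_adjoin .
qed

lemma asm_arr_B: "asm_arr A XB YB id = rt_arr A (asm XB) (asm YB) (graph_rel XB)"
  by (simp add: asm_arr_def graph_rel_def[abs_def])

lemma K_inverts: "inverts U A K (asm XB) (asm YB) (asm_arr A XB YB id)"
  unfolding asm_arr_B
  by (rule dense_mono_inverts[OF is_rtobj_B stage_fun_B stage_mono_B stage_dense_B mono_eta_asm mono_eta_asm])

text \<open>Density for \<open>J\<close> gives one element that maps each \<open>b\<close> with
  \<open>f b = Some c\<close> into \<open>J {pair b c}\<close>. The second projection, applied under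
  \<open>J\<close>, leads to \<open>J {c}\<close>, as \<open>K_least\<close> demands.\<close>

lemma K_le_inverting:
  assumes J: "local_operator A J" and inv: "inverts U A J (asm XB) (asm YB) (asm_arr A XB YB id)"
  shows "le_operator A K J"
proof -
  interpret J: pca_universe A k s p p0 p1 J U code
    by unfold_locales (rule J, rule universe)
  have "stage_dense A J (asm XB) (asm YB) (graph_rel XB)"
    by (rule J.inverts_imp_dense[OF inv[unfolded asm_arr_B] is_rtobj_B stage_fun_B])
  then have "entails A (Car YB) (Ex YB) (\<lambda>y. J (\<Union>x\<in>Car XB. graph_rel XB x y))"
    unfolding entails1 stage_dense_def by (simp add: ex_def)
  then obtain r where r: "r \<in> (\<Inter>y\<in>Car YB. imp A (Ex YB y) (J (\<Union>x\<in>Car XB. graph_rel XB x y)))"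
    unfolding entails_def by blast
  have r': "\<exists>e\<in>J {pair b c}. A r b = Some e" if fb: "f b = Some c" for b c
  proof -
    have b: "code b \<in> code ` dom f" using fb by blast
    have "(\<Union>x\<in>Car XB. graph_rel XB x (code b)) = Ex XB (code b)"
      using b by (auto simp: graph_rel_def Car_B split: if_splits)
    moreover have "r \<in> imp A (Ex YB (code b)) (J (\<Union>x\<in>Car XB. graph_rel XB x (code b)))"
      using r b unfolding Car_B by blast
    ultimately show ?thesis using Ex_XB[OF fb] by (simp add: imp_iff Ex_YB)
  qed
  obtain u j m where m: "\<forall>V W. m \<in> imp A (imp A V W) (imp A (J V) (J W))"
    using local_operatorD[OF J] by (elim exE conjE)
  have p1: "p1 \<in> imp A {pair b c} {c}" for b c by (simp add: imp_iff)
  \<comment> \<open>The value of \<open>m\<close> at \<open>p1\<close> is the same for all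
    \<open>b\<close> and \<open>c\<close>, so an arbitrary instance provides it; this keeps the
    resulting realizer uniform.\<close>
  obtain g where g: "A m p1 = Some g"
    using m[rule_format, of "{pair undefined undefined}" "{undefined}"] p1 by (meson impE)
  have g': "\<exists>e'\<in>J {c}. A g e = Some e'" if e: "e \<in> J {pair b c}" for b c e
  proof -
    obtain g'' where "g'' \<in> imp A (J {pair b c}) (J {c})" "A m p1 = Some g''"
      using impE[OF m[rule_format] p1] .
    then show ?thesis using e g by (auto simp: imp_iff)
  qed
  obtain q where q: "\<forall>x y z. A r x = Some y \<longrightarrow> A g y = Some z \<longrightarrow> A q x = Some z"
    using app_comp by (rule exE)
  show ?thesis
  proof (rule K_least[OF J])
    fix b c assume "f b = Some c"
    then obtain e where "e \<in> J {pair b c}" "A r b = Some e" using r' by blast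
    then show "\<exists>e\<in>J {c}. A q b = Some e" using g' q by blast
  qed
qed

lemma dense_mono_le:
  assumes "le_operator A J L" "dense_mono U A J X Y m"
  shows "dense_mono U A L X Y m"
proof -
  obtain M where M: "m = rt_arr A X Y M" "entails A (Car Y) (Ex Y) (\<lambda>y. J (\<Union>x\<in>Car X. M x y))"
    and mono: "mono_arr (RT U A) X Y m" using assms(2) unfolding dense_mono_def by blast
  have "entails A (Car Y) (Ex Y) (\<lambda>y. L (\<Union>x\<in>Car X. M x y))"
    using M(2) unfolding entails1
    by (intro allI ballI impI, intro holds_le_operator[OF assms(1)]) blast
  then show ?thesis using M(1) mono unfolding dense_mono_def by blast
qed

text \<open>The category of sheaves sees an operator only through its dense monos, so equivalent
  operators give literally the same category.\<close>

lemma Sh_cong: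
  assumes "le_operator A J L" "le_operator A L J" shows "Sh U A J = Sh U A L"
proof -
  have "dense_mono U A J = dense_mono U A L"
    by (intro ext iffI) (erule dense_mono_le[OF assms(1)], erule dense_mono_le[OF assms(2)])
  then show ?thesis by (simp add: Sh_def is_sheaf_def)
qed

end

theorem theorem3p2:
  fixes A :: "'a papp" and k s p p0 p1 :: 'a
    and f :: "'a \<Rightarrow> 'a option"
    and U :: "'u set set" and code :: "'a \<Rightarrow> 'u"
    and J :: "'a set \<Rightarrow> 'a set"
  assumes "pca A k s"
    and "pairing A p p0 p1"
    and "universe U code"
    and "least_inverting U A J (asm (graph_asm A p code f)) (asm (dom_asm code f))
           (asm_arr A (graph_asm A p code f) (dom_asm code f) id)"
  shows "\<exists>G. geometric_inclusion (RT U (adjoin A k s p f)) (RT U A)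
               (inverse_image (adjoin A k s p f)) G \<and>
             equivalence (RT U (adjoin A k s p f)) (Sh U A J) G"
proof -
  interpret oracle_universe A k s p p0 p1 f U code
    using assms(1-3) by unfold_locales
  have J: "local_operator A J" "inverts U A J (asm XB) (asm YB) (asm_arr A XB YB id)"
    and least: "\<And>L. local_operator A L \<Longrightarrow> inverts U A L (asm XB) (asm YB) (asm_arr A XB YB id) \<Longrightarrow>
      le_operator A J L"
    using assms(4) unfolding least_inverting_def by blast+
  have "Sh U A J = Sh U A K"
    by (rule Sh_cong[OF least[OF local_operator_K K_inverts] K_le_inverting[OF J]])
  then show ?thesis using geometric_inclusion_G equivalence_G by auto
qed

end
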